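(* Let $T>0$, $n\ge1$, $s\ge 1$, and consider the Cauchy problem \[ \begin{split} \partial_t^2u(t,x)-\sum_{i=1}^n a_i(t)\partial_{x_i}^2u(t,x)+l(t,\partial_t,\partial_x)u(t,x)&=f(t,x),\\ u(0,x)&=g_0(x),\\ \partial_t u(0,x)&=g_1(x), \end{split} \] where $t\in[0,T]$, $x\in\mathbb{R}^n$ and \[ l(t,\partial_t,\partial_x)=\sum_{i=1}^n c_i(t)\partial_{x_i}+d(t)\partial_t+e(t). \] Assume that: (i) the coefficients $a_i,c_i,d,e$ are distributions on $\mathbb{R}$ with compact support contained in $[0,T]$, and each $a_i$ is real-valued with $a_i\ge 0$, $i=1,\dots,n$; (ii) $f\in C([0,T],\gamma_c^s(\mathbb{R}^n))$; (iii) $g_0,g_1\in\gamma_c^s(\mathbb{R}^n)$. Suppose that the equation coefficients are regularised with a scale of logarithmic type, giving nets $a_{i,\varepsilon},c_{i,\varepsilon},d_\varepsilon,e_\varepsilon$, and that there exist constants $c_1,c_2>0$ such that the Levi conditions \[ \left|\mathrm{i}\sum_{i=1}^n c_{i,\varepsilon}(t)\xi_{i}+e_{\varepsilon}(t) \right|^2 \le c_1(\ln(\varepsilon^{-1}))^2 \left( 2\sum_{i=1}^n a_{i,\varepsilon}(t)\xi_i^2 \right),\qquad \left| d_{\varepsilon}(t)\right|^2\le c_2(\ln(\varepsilon^{-1}))^2 \] are fulfilled for all $t\in[0,T]$, $\varepsilon\in(0,1]$, and for $|\xi|$ large enough (i.e. for all $|\xi|\ge R$, with some $R>0$ independent of $\varepsilon$).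 Then the Cauchy problem has a very weak solution of order $s$.
   Context: Gevrey classes: $\gamma^s(\mathbb{R}^n)$ is the set of $v\in C^\infty(\mathbb{R}^n)$ such that for every compact $K$ there is $C>0$ with $|\partial^\alpha v(x)|\le C^{|\alpha|+1}(\alpha!)^s$ for all $\alpha\in\mathbb{N}_0^n$, $x\in K$; $\gamma^s_c(\mathbb{R}^n)$ are its compactly supported elements. A distribution is $\ge0$ if it is nonnegative on nonnegative test functions. Mollifiers. Type (1): $\psi\in C^\infty_c$ with $\int\psi=1$, here taken with $\psi\ge0$. Type (2): $\varphi\in\mathscr{S}(\mathbb{R}^n)$ with $\int\varphi=1$ and $\int x^\alpha\varphi(x)\,dx=0$ for all $\alpha\ne0$. For a mollifier $\theta$ on $\mathbb{R}^m$ and $\eta>0$, $\theta_\eta(x)=\eta^{-m}\theta(x/\eta)$. A scale of logarithmic type is $\omega(\varepsilon)$ with $\omega(\varepsilon)^{-1}=(\ln(\varepsilon^{-1}))^{r}$ for some $r>0$. Regularising the coefficients with such a scale means $a_{i,\varepsilon}=a_i\ast\psi_{\omega(\varepsilon)}$, $c_{i,\varepsilon}=c_i\ast\psi_{\omega(\varepsilon)}$, $d_\varepsilon=d\ast\psi_{\omega(\varepsilon)}$, $e_\varepsilon=e\ast\psi_{\omega(\varepsilon)}$ with $\psi\ge 0$ of type (1); the initial data and right-hand side are regularised by convolution in $x$ with a mollifier of type (2). Estimates on nets are understood for $\varepsilon$ small enough, i.e. $\varepsilon\in(0,\eta]$ for some $\eta\in(0,1]$, which is normalised to $\varepsilon\in(0,1]$.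 Moderateness. (a) $(h_\varepsilon)_\varepsilon\in C^\infty(\mathbb{R}^m)^{(0,1]}$ is $C^\infty$-moderate if for all compact $K$ and all $\alpha$ there are $N\in\mathbb{N}_0$, $c>0$ with $\sup_{K}|\partial^\alpha h_\varepsilon|\le c\varepsilon^{-N}$ for all $\varepsilon\in(0,1]$. (b) $(h_\varepsilon)_\varepsilon\in\gamma^s(\mathbb{R}^n)^{(0,1]}$ is $\gamma^s$-moderate if for all compact $K$ there are $c_K>0$, $N\in\mathbb{N}_0$ with $|\partial^\alpha h_\varepsilon(x)|\le c_K^{|\alpha|+1}(\alpha!)^s\varepsilon^{-N-|\alpha|}$ for all $\alpha$, $x\in K$, $\varepsilon\in(0,1]$. (c) $(h_\varepsilon)_\varepsilon\in C^\infty([0,T];\gamma^s(\mathbb{R}^n))^{(0,1]}$ is $C^\infty([0,T];\gamma^s(\mathbb{R}^n))$-moderate if for all compact $K\subset\mathbb{R}^n$ there are $N\in\mathbb{N}_0$, $c>0$ and for all $k\in\mathbb{N}_0$ there are $N_k\in\mathbb{N}_0$, $c_k>0$ with $|\partial_t^k\partial_x^\alpha h_\varepsilon(t,x)|\le c_k\varepsilon^{-N_k}c^{|\alpha|+1}(\alpha!)^s\varepsilon^{-N-|\alpha|}$ for all $\alpha$, $t\in[0,T]$, $x\in K$, $\varepsilon\in(0,1]$. Very weak solution. A net $(u_\varepsilon)_\varepsilon$ in $C^\infty([0,T];\gamma^s(\mathbb{R}^n))$ is a very weak solution of order $s$ of the Cauchy problem if there exist regularisations (by convolution with mollifiers of type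 (1) or type (2)) of the data such that: the regularised coefficients $a_{i,\varepsilon},c_{i,\varepsilon},d_\varepsilon,e_\varepsilon$ are $C^\infty$-moderate, the regularised right-hand side $f_\varepsilon$ is $C^\infty([0,T];\gamma^s(\mathbb{R}^n))$-moderate, the regularised initial data $g_{0,\varepsilon},g_{1,\varepsilon}$ are $\gamma^s$-moderate, $u_\varepsilon$ solves \[ \partial_t^2u_{\varepsilon}-\sum_{i=1}^n a_{i,\varepsilon}(t)\partial_{x_i}^2u_{\varepsilon}+\sum_{i=1}^n c_{i,\varepsilon}(t)\partial_{x_i}u_\varepsilon+d_{\varepsilon}(t)\partial_tu_\varepsilon+e_{\varepsilon}(t)u_\varepsilon=f_{\varepsilon},\quad u_{\varepsilon}(0,\cdot)=g_{0,\varepsilon},\ \partial_t u_{\varepsilon}(0,\cdot)=g_{1,\varepsilon} \] on $[0,T]\times\mathbb{R}^n$ for all $\varepsilon\in(0,1]$, and $(u_\varepsilon)_\varepsilon$ is $C^\infty([0,T];\gamma^s(\mathbb{R}^n))$-moderate.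
   Formalization: The right-hand side f may be regularised by convolution in t (after zero extension outside [0,T]) as well as in x; convolution in x alone cannot make a merely continuous-in-time f smooth in t, as the definition of very weak solution requires. *)

theory Defs
  imports "HOL-Analysis.Analysis"
begin

section \<open>Smooth functions and multi-indices\<close>

text \<open>
  All functions are complex valued. A multi-index on a Euclidean space is a function
  \<open>\<alpha> :: 'a \<Rightarrow> nat\<close> of which only the values on \<open>Basis\<close> matter; on \<open>real ^ 'n\<close> the value
  \<open>\<alpha> (axis i 1)\<close> is the \<open>i\<close>-th entry.
\<close>

definition mlen :: "('a::euclidean_space \<Rightarrow> nat) \<Rightarrow> nat"
  where "mlen \<alpha> = (\<Sum>b\<in>Basis. \<alpha> b)"

definition mfact :: "('a::euclidean_space \<Rightarrow> nat) \<Rightarrow> real"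
  where "mfact \<alpha> = (\<Prod>b\<in>Basis. fact (\<alpha> b))"

definition monomial :: "('a::euclidean_space \<Rightarrow> nat) \<Rightarrow> 'a \<Rightarrow> real"
  where "monomial \<alpha> x = (\<Prod>b\<in>Basis. (x \<bullet> b) ^ \<alpha> b)"

definition pd :: "'a::euclidean_space \<Rightarrow> ('a \<Rightarrow> complex) \<Rightarrow> 'a \<Rightarrow> complex"
  where "pd b g x = vector_derivative (\<lambda>h. g (x + h *\<^sub>R b)) (at 0)"

text \<open>
  Smooth: all iterated partial derivatives exist and are (Frechet) differentiable, hence
  continuous.
\<close>

definition smooth :: "('a::euclidean_space \<Rightarrow> complex) \<Rightarrow> bool"
  where "smooth g \<longleftrightarrow> (\<forall>bs. set bs \<subseteq> Basis \<longrightarrow> foldr pd bs g differentiable_on UNIV)"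

definition basis_list :: "'a::euclidean_space list"
  where "basis_list = (SOME bs. distinct bs \<and> set bs = Basis)"

text \<open>
  The order in which \<open>mdiff\<close> takes the partial derivatives is fixed but arbitrary;
  \<open>mdiff\<close> is only ever used for smooth functions, where the order is irrelevant.
\<close>

definition mdiff :: "('a::euclidean_space \<Rightarrow> nat) \<Rightarrow> ('a \<Rightarrow> complex) \<Rightarrow> 'a \<Rightarrow> complex"
  where "mdiff \<alpha> g = foldr (\<lambda>b. pd b ^^ \<alpha> b) basis_list g"

definition csupp :: "('a::euclidean_space \<Rightarrow> complex) \<Rightarrow> 'a set"
  where "csupp g = closure {x. g x \<noteq> 0}"

definition test_fun :: "('a::euclidean_space \<Rightarrow> complex) \<Rightarrow> bool"
  where "test_fun \<phi> \<longleftrightarrow> smooth \<phi> \<and> compact (csupp \<phi>)"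

definition schwartz :: "('a::euclidean_space \<Rightarrow> complex) \<Rightarrow> bool"
  where "schwartz \<phi> \<longleftrightarrow> smooth \<phi> \<and>
    (\<forall>\<alpha> k. \<exists>C. \<forall>x. (1 + norm x) ^ k * norm (mdiff \<alpha> \<phi> x) \<le> C)"


section \<open>Gevrey classes\<close>

definition gevrey :: "real \<Rightarrow> ('a::euclidean_space \<Rightarrow> complex) set"
  where "gevrey s = {v. smooth v \<and>
    (\<forall>K. compact K \<longrightarrow> (\<exists>C>0. \<forall>\<alpha>. \<forall>x\<in>K.
       norm (mdiff \<alpha> v x) \<le> C ^ (mlen \<alpha> + 1) * mfact \<alpha> powr s))}"

definition gevrey_c :: "real \<Rightarrow> ('a::euclidean_space \<Rightarrow> complex) set"
  where "gevrey_c s = {v \<in> gevrey s. compact (csupp v)}"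

text \<open>
  \<open>C([0,T], \<gamma>\<^sub>c\<^sup>s)\<close>. The space \<open>\<gamma>\<^sub>c\<^sup>s\<close> carries the inductive limit topology of the Banach
  spaces of smooth functions supported in a compact set \<open>K\<close> with finite norm
  \<open>sup \<bar>\<partial>\<^sup>\<alpha>v(x)\<bar> / (C\<^sup>|\<^sup>\<alpha>\<^sup>| (\<alpha>!)\<^sup>s)\<close>. The linking maps are compact (up to enlarging \<open>C\<close>), so a map
  from a compact interval is continuous iff it is continuous into one of these Banach spaces.
\<close>

definition cont_gevrey_c :: "real \<Rightarrow> real \<Rightarrow> (real \<Rightarrow> 'a::euclidean_space \<Rightarrow> complex) \<Rightarrow> bool"
  where "cont_gevrey_c T s f \<longleftrightarrow>
    (\<forall>t\<in>{0..T}. f t \<in> gevrey_c s) \<and>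
    (\<exists>K C. compact K \<and> C > 0 \<and>
      (\<forall>t\<in>{0..T}. csupp (f t) \<subseteq> K \<and>
        (\<exists>M. \<forall>\<alpha> x. norm (mdiff \<alpha> (f t) x) \<le> M * (C ^ mlen \<alpha> * mfact \<alpha> powr s))) \<and>
      (\<forall>t0\<in>{0..T}. \<forall>\<delta>>0. \<exists>\<rho>>0. \<forall>t\<in>{0..T}. \<bar>t - t0\<bar> < \<rho> \<longrightarrow>
        (\<forall>\<alpha> x. norm (mdiff \<alpha> (f t) x - mdiff \<alpha> (f t0) x)
                 \<le> \<delta> * (C ^ mlen \<alpha> * mfact \<alpha> powr s))))"

text \<open>Derivative in time on \<open>[0,T]\<close>, one-sided at the end points.\<close>

definition dt :: "real \<Rightarrow> (real \<Rightarrow> 'a \<Rightarrow> complex) \<Rightarrow> real \<Rightarrow> 'a \<Rightarrow> complex"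
  where "dt T h t x = vector_derivative (\<lambda>\<tau>. h \<tau> x) (at t within {0..T})"

definition dtx :: "real \<Rightarrow> nat \<Rightarrow> ('a::euclidean_space \<Rightarrow> nat)
    \<Rightarrow> (real \<Rightarrow> 'a \<Rightarrow> complex) \<Rightarrow> real \<Rightarrow> 'a \<Rightarrow> complex"
  where "dtx T k \<alpha> h = (dt T ^^ k) (\<lambda>t. mdiff \<alpha> (h t))"

text \<open>
  \<open>C\<^sup>\<infinity>([0,T]; \<gamma>\<^sup>s)\<close>: all derivatives \<open>\<partial>\<^sub>t\<^sup>k \<partial>\<^sub>x\<^sup>\<alpha> h\<close> exist on \<open>[0,T]\<close>, and for every \<open>k\<close> and every
  compact \<open>K\<close> the Gevrey estimate for \<open>\<partial>\<^sub>t\<^sup>k h(t,\<cdot>)\<close> on \<open>K\<close> is uniform in \<open>t\<close>. These bounds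
  make each \<open>\<partial>\<^sub>t\<^sup>k \<partial>\<^sub>x\<^sup>\<alpha> h\<close> jointly continuous and let derivatives in \<open>t\<close> and \<open>x\<close> commute.
\<close>

definition smooth_gevrey :: "real \<Rightarrow> real \<Rightarrow> (real \<Rightarrow> 'a::euclidean_space \<Rightarrow> complex) set"
  where "smooth_gevrey T s = {h.
    (\<forall>t\<in>{0..T}. smooth (h t)) \<and>
    (\<forall>k \<alpha> x. (\<lambda>t. dtx T k \<alpha> h t x) differentiable_on {0..T}) \<and>
    (\<forall>K k. compact K \<longrightarrow> (\<exists>C>0. \<forall>\<alpha>. \<forall>t\<in>{0..T}. \<forall>x\<in>K.
       norm (dtx T k \<alpha> h t x) \<le> C ^ (mlen \<alpha> + 1) * mfact \<alpha> powr s))}"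


section \<open>Distributions\<close>

text \<open>A distribution is a functional of which only the values on test functions matter.\<close>

definition distribution :: "(('a::euclidean_space \<Rightarrow> complex) \<Rightarrow> complex) \<Rightarrow> bool"
  where "distribution w \<longleftrightarrow>
    (\<forall>\<phi> \<zeta>. test_fun \<phi> \<and> test_fun \<zeta> \<longrightarrow> w (\<lambda>x. \<phi> x + \<zeta> x) = w \<phi> + w \<zeta>) \<and>
    (\<forall>z \<phi>. test_fun \<phi> \<longrightarrow> w (\<lambda>x. z * \<phi> x) = z * w \<phi>) \<and>
    (\<forall>K. compact K \<longrightarrow> (\<exists>C N. \<forall>\<phi> M. test_fun \<phi> \<and> csupp \<phi> \<subseteq> K \<and>
       (\<forall>\<alpha> x. mlen \<alpha> \<le> N \<longrightarrow> norm (mdiff \<alpha> \<phi> x) \<le> M) \<longrightarrow> norm (w \<phi>) \<le> C * M))"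

text \<open>For closed \<open>S\<close>: the support of \<open>w\<close> is contained in \<open>S\<close>, i.e. \<open>w\<close> vanishes on \<open>- S\<close>.\<close>

definition dist_supp_in :: "(('a::euclidean_space \<Rightarrow> complex) \<Rightarrow> complex) \<Rightarrow> 'a set \<Rightarrow> bool"
  where "dist_supp_in w S \<longleftrightarrow> (\<forall>\<phi>. test_fun \<phi> \<and> csupp \<phi> \<inter> S = {} \<longrightarrow> w \<phi> = 0)"

definition dist_real :: "(('a::euclidean_space \<Rightarrow> complex) \<Rightarrow> complex) \<Rightarrow> bool"
  where "dist_real w \<longleftrightarrow> (\<forall>\<phi>. test_fun \<phi> \<and> (\<forall>x. \<phi> x \<in> \<real>) \<longrightarrow> w \<phi> \<in> \<real>)"

definition dist_nonneg :: "(('a::euclidean_space \<Rightarrow> complex) \<Rightarrow> complex) \<Rightarrow> bool"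
  where "dist_nonneg w \<longleftrightarrow>
    (\<forall>\<phi>. test_fun \<phi> \<and> (\<forall>x. \<phi> x \<in> \<real>\<^sub>\<ge>\<^sub>0) \<longrightarrow> w \<phi> \<in> \<real>\<^sub>\<ge>\<^sub>0)"

definition cutoff :: "'a::euclidean_space set \<Rightarrow> ('a \<Rightarrow> complex) \<Rightarrow> bool"
  where "cutoff S \<zeta> \<longleftrightarrow> test_fun \<zeta> \<and> (\<exists>U. open U \<and> S \<subseteq> U \<and> (\<forall>x\<in>U. \<zeta> x = 1))"

text \<open>
  A distribution supported in a compact set \<open>S\<close> acts on every smooth function \<open>g\<close> through a
  cut-off around \<open>S\<close>; the value does not depend on the cut-off and is \<open>w g\<close> if \<open>g\<close> is a test
  function. The cut-off is needed for mollifiers that are not compactly supported.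
\<close>

definition dist_pair :: "'a set \<Rightarrow> (('a::euclidean_space \<Rightarrow> complex) \<Rightarrow> complex)
    \<Rightarrow> ('a \<Rightarrow> complex) \<Rightarrow> complex"
  where "dist_pair S w g = w (\<lambda>x. (SOME \<zeta>. cutoff S \<zeta>) x * g x)"

definition dist_conv :: "'a set \<Rightarrow> (('a::euclidean_space \<Rightarrow> complex) \<Rightarrow> complex)
    \<Rightarrow> ('a \<Rightarrow> complex) \<Rightarrow> 'a \<Rightarrow> complex"
  where "dist_conv S w \<theta> x = dist_pair S w (\<lambda>y. \<theta> (x - y))"

definition fun_conv :: "('a::euclidean_space \<Rightarrow> complex) \<Rightarrow> ('a \<Rightarrow> complex) \<Rightarrow> 'a \<Rightarrow> complex"
  where "fun_conv g \<theta> x = (LINT y|lborel. g y * \<theta> (x - y))"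


section \<open>Mollifiers and regularisations\<close>

definition mollifier1 :: "('a::euclidean_space \<Rightarrow> complex) \<Rightarrow> bool"
  where "mollifier1 \<psi> \<longleftrightarrow> test_fun \<psi> \<and> (\<forall>x. \<psi> x \<in> \<real>\<^sub>\<ge>\<^sub>0) \<and> (LINT x|lborel. \<psi> x) = 1"

definition mollifier2 :: "('a::euclidean_space \<Rightarrow> complex) \<Rightarrow> bool"
  where "mollifier2 \<phi> \<longleftrightarrow> schwartz \<phi> \<and> (LINT x|lborel. \<phi> x) = 1 \<and>
    (\<forall>\<alpha>. mlen \<alpha> \<noteq> 0 \<longrightarrow> (LINT x|lborel. of_real (monomial \<alpha> x) * \<phi> x) = 0)"

definition mollifier :: "('a::euclidean_space \<Rightarrow> complex) \<Rightarrow> bool"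
  where "mollifier \<theta> \<longleftrightarrow> mollifier1 \<theta> \<or> mollifier2 \<theta>"

definition rescale :: "real \<Rightarrow> ('a::euclidean_space \<Rightarrow> complex) \<Rightarrow> 'a \<Rightarrow> complex"
  where "rescale \<eta> \<theta> x = of_real (1 / \<eta> ^ DIM('a)) * \<theta> (x /\<^sub>R \<eta>)"

definition scale :: "(real \<Rightarrow> real) \<Rightarrow> bool"
  where "scale \<omega> \<longleftrightarrow> (\<forall>\<epsilon>\<in>{0<..1}. 0 < \<omega> \<epsilon>) \<and> (\<omega> \<longlongrightarrow> 0) (at_right 0)"

definition log_scale :: "real \<Rightarrow> real \<Rightarrow> real"
  where "log_scale r \<epsilon> = 1 / (ln (1 / \<epsilon>) powr r)"

text \<open>Regularisation of a coefficient, that is, of a distribution on the line supported in \<open>[0,T]\<close>.\<close>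

definition reg_coeff :: "real \<Rightarrow> ((real \<Rightarrow> complex) \<Rightarrow> complex) \<Rightarrow> (real \<Rightarrow> real \<Rightarrow> complex) \<Rightarrow> bool"
  where "reg_coeff T w W \<longleftrightarrow> (\<exists>\<theta> \<omega>. mollifier \<theta> \<and> scale \<omega> \<and>
    (\<forall>\<epsilon>\<in>{0<..1}. \<forall>t. W \<epsilon> t = dist_conv {0..T} w (rescale (\<omega> \<epsilon>) \<theta>) t))"

text \<open>\<open>P\<close> is the class of admissible mollifiers in \<open>x\<close>: \<open>mollifier\<close> or \<open>mollifier2\<close>.\<close>

definition reg_init :: "(('a::euclidean_space \<Rightarrow> complex) \<Rightarrow> bool)
    \<Rightarrow> ('a \<Rightarrow> complex) \<Rightarrow> (real \<Rightarrow> 'a \<Rightarrow> complex) \<Rightarrow> bool"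
  where "reg_init P g G \<longleftrightarrow> (\<exists>\<theta> \<omega>. P \<theta> \<and> scale \<omega> \<and>
    (\<forall>\<epsilon>\<in>{0<..1}. \<forall>x. G \<epsilon> x = fun_conv g (rescale (\<omega> \<epsilon>) \<theta>) x))"

text \<open>
  The right-hand side is convolved with a mollifier in \<open>x\<close>. This does not make a merely
  continuous function of \<open>t\<close> smooth in \<open>t\<close>, so it may in addition be convolved with a mollifier
  in \<open>t\<close>, after extension by zero outside \<open>[0,T]\<close>.
\<close>

definition reg_rhs :: "(('a::euclidean_space \<Rightarrow> complex) \<Rightarrow> bool) \<Rightarrow> real
    \<Rightarrow> (real \<Rightarrow> 'a \<Rightarrow> complex) \<Rightarrow> (real \<Rightarrow> real \<Rightarrow> 'a \<Rightarrow> complex) \<Rightarrow> bool"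
  where "reg_rhs P T f F \<longleftrightarrow> (\<exists>\<theta> \<omega>. P \<theta> \<and> scale \<omega> \<and>
    ((\<forall>\<epsilon>\<in>{0<..1}. \<forall>t\<in>{0..T}. \<forall>x. F \<epsilon> t x = fun_conv (f t) (rescale (\<omega> \<epsilon>) \<theta>) x) \<or>
     (\<exists>\<theta>' \<omega>'. mollifier \<theta>' \<and> scale \<omega>' \<and>
       (\<forall>\<epsilon>\<in>{0<..1}. \<forall>t\<in>{0..T}. \<forall>x. F \<epsilon> t x =
          fun_conv (\<lambda>\<tau>. if \<tau> \<in> {0..T} then fun_conv (f \<tau>) (rescale (\<omega> \<epsilon>) \<theta>) x else 0)
            (rescale (\<omega>' \<epsilon>) \<theta>') t))))"


section \<open>Moderate nets and very weak solutions\<close>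

definition smooth_moderate :: "(real \<Rightarrow> 'a::euclidean_space \<Rightarrow> complex) \<Rightarrow> bool"
  where "smooth_moderate h \<longleftrightarrow> (\<forall>\<epsilon>\<in>{0<..1}. smooth (h \<epsilon>)) \<and>
    (\<forall>K \<alpha>. compact K \<longrightarrow> (\<exists>N. \<exists>c>0. \<forall>\<epsilon>\<in>{0<..1}. \<forall>x\<in>K.
       norm (mdiff \<alpha> (h \<epsilon>) x) \<le> c * (1 / \<epsilon>) ^ N))"

definition gevrey_moderate :: "real \<Rightarrow> (real \<Rightarrow> 'a::euclidean_space \<Rightarrow> complex) \<Rightarrow> bool"
  where "gevrey_moderate s h \<longleftrightarrow> (\<forall>\<epsilon>\<in>{0<..1}. h \<epsilon> \<in> gevrey s) \<and>
    (\<forall>K. compact K \<longrightarrow> (\<exists>c>0. \<exists>N. \<forall>\<alpha>. \<forall>x\<in>K. \<forall>\<epsilon>\<in>{0<..1}.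
       norm (mdiff \<alpha> (h \<epsilon>) x)
         \<le> c ^ (mlen \<alpha> + 1) * mfact \<alpha> powr s * (1 / \<epsilon>) ^ (N + mlen \<alpha>)))"

definition smooth_gevrey_moderate ::
    "real \<Rightarrow> real \<Rightarrow> (real \<Rightarrow> real \<Rightarrow> 'a::euclidean_space \<Rightarrow> complex) \<Rightarrow> bool"
  where "smooth_gevrey_moderate T s h \<longleftrightarrow> (\<forall>\<epsilon>\<in>{0<..1}. h \<epsilon> \<in> smooth_gevrey T s) \<and>
    (\<forall>K. compact K \<longrightarrow> (\<exists>N. \<exists>c>0. \<forall>k. \<exists>Nk. \<exists>ck>0.
       \<forall>\<alpha>. \<forall>t\<in>{0..T}. \<forall>x\<in>K. \<forall>\<epsilon>\<in>{0<..1}.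
         norm (dtx T k \<alpha> (h \<epsilon>) t x)
           \<le> ck * (1 / \<epsilon>) ^ Nk * c ^ (mlen \<alpha> + 1) * mfact \<alpha> powr s * (1 / \<epsilon>) ^ (N + mlen \<alpha>)))"

definition solves_cauchy :: "real \<Rightarrow> ('n::finite \<Rightarrow> real \<Rightarrow> complex) \<Rightarrow> ('n \<Rightarrow> real \<Rightarrow> complex)
    \<Rightarrow> (real \<Rightarrow> complex) \<Rightarrow> (real \<Rightarrow> complex) \<Rightarrow> (real \<Rightarrow> real ^ 'n \<Rightarrow> complex)
    \<Rightarrow> (real ^ 'n \<Rightarrow> complex) \<Rightarrow> (real ^ 'n \<Rightarrow> complex) \<Rightarrow> (real \<Rightarrow> real ^ 'n \<Rightarrow> complex) \<Rightarrow> bool"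
  where "solves_cauchy T a c d e f g0 g1 u \<longleftrightarrow>
    (\<forall>t\<in>{0..T}. \<forall>x.
       dt T (dt T u) t x
       - (\<Sum>i\<in>UNIV. a i t * pd (axis i 1) (pd (axis i 1) (u t)) x)
       + (\<Sum>i\<in>UNIV. c i t * pd (axis i 1) (u t) x)
       + d t * dt T u t x + e t * u t x = f t x) \<and>
    (\<forall>x. u 0 x = g0 x \<and> dt T u 0 x = g1 x)"

text \<open>
  \<open>u\<close> is a very weak solution for the given nets of regularised coefficients, with \<open>f\<close>, \<open>g0\<close>, \<open>g1\<close>
  regularised by mollifiers from the class \<open>P\<close>.
\<close>

definition very_weak_for :: "((real ^ 'n \<Rightarrow> complex) \<Rightarrow> bool) \<Rightarrow> real \<Rightarrow> real
    \<Rightarrow> ('n::finite \<Rightarrow> real \<Rightarrow> real \<Rightarrow> complex) \<Rightarrow> ('n \<Rightarrow> real \<Rightarrow> real \<Rightarrow> complex)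
    \<Rightarrow> (real \<Rightarrow> real \<Rightarrow> complex) \<Rightarrow> (real \<Rightarrow> real \<Rightarrow> complex)
    \<Rightarrow> (real \<Rightarrow> real ^ 'n \<Rightarrow> complex) \<Rightarrow> (real ^ 'n \<Rightarrow> complex) \<Rightarrow> (real ^ 'n \<Rightarrow> complex)
    \<Rightarrow> (real \<Rightarrow> real \<Rightarrow> real ^ 'n \<Rightarrow> complex) \<Rightarrow> bool"
  where "very_weak_for P T s a\<epsilon> c\<epsilon> d\<epsilon> e\<epsilon> f g0 g1 u \<longleftrightarrow>
    (\<forall>i. smooth_moderate (a\<epsilon> i)) \<and> (\<forall>i. smooth_moderate (c\<epsilon> i)) \<and>
    smooth_moderate d\<epsilon> \<and> smooth_moderate e\<epsilon> \<and>
    (\<exists>f\<epsilon> g0\<epsilon> g1\<epsilon>.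
      reg_rhs P T f f\<epsilon> \<and> smooth_gevrey_moderate T s f\<epsilon> \<and>
      reg_init P g0 g0\<epsilon> \<and> gevrey_moderate s g0\<epsilon> \<and>
      reg_init P g1 g1\<epsilon> \<and> gevrey_moderate s g1\<epsilon> \<and>
      (\<forall>\<epsilon>\<in>{0<..1}. solves_cauchy T (\<lambda>i. a\<epsilon> i \<epsilon>) (\<lambda>i. c\<epsilon> i \<epsilon>) (d\<epsilon> \<epsilon>) (e\<epsilon> \<epsilon>)
         (f\<epsilon> \<epsilon>) (g0\<epsilon> \<epsilon>) (g1\<epsilon> \<epsilon>) (u \<epsilon>))) \<and>
    smooth_gevrey_moderate T s u"

definition very_weak_solution :: "real \<Rightarrow> real
    \<Rightarrow> ('n::finite \<Rightarrow> (real \<Rightarrow> complex) \<Rightarrow> complex) \<Rightarrow> ('n \<Rightarrow> (real \<Rightarrow> complex) \<Rightarrow> complex)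
    \<Rightarrow> ((real \<Rightarrow> complex) \<Rightarrow> complex) \<Rightarrow> ((real \<Rightarrow> complex) \<Rightarrow> complex)
    \<Rightarrow> (real \<Rightarrow> real ^ 'n \<Rightarrow> complex) \<Rightarrow> (real ^ 'n \<Rightarrow> complex) \<Rightarrow> (real ^ 'n \<Rightarrow> complex)
    \<Rightarrow> (real \<Rightarrow> real \<Rightarrow> real ^ 'n \<Rightarrow> complex) \<Rightarrow> bool"
  where "very_weak_solution T s a c d e f g0 g1 u \<longleftrightarrow>
    (\<exists>a\<epsilon> c\<epsilon> d\<epsilon> e\<epsilon>.
      (\<forall>i. reg_coeff T (a i) (a\<epsilon> i)) \<and> (\<forall>i. reg_coeff T (c i) (c\<epsilon> i)) \<and>
      reg_coeff T d d\<epsilon> \<and> reg_coeff T e e\<epsilon> \<and>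
      very_weak_for mollifier T s a\<epsilon> c\<epsilon> d\<epsilon> e\<epsilon> f g0 g1 u)"

text \<open>
  The net of coefficients regularised with the scale of logarithmic type with exponent \<open>r\<close>. It is
  meaningful for \<open>0 < \<epsilon> < 1\<close>, where \<open>log_scale r \<epsilon>\<close> is positive.
\<close>

definition log_reg :: "real \<Rightarrow> real \<Rightarrow> (real \<Rightarrow> complex) \<Rightarrow> ((real \<Rightarrow> complex) \<Rightarrow> complex)
    \<Rightarrow> real \<Rightarrow> real \<Rightarrow> complex"
  where "log_reg T r \<psi> w \<epsilon> t = dist_conv {0..T} w (rescale (log_scale r \<epsilon>) \<psi>) t"

end

theory Submission
  imports Defs "HOL-Probability.Sinc_Integral"
begin

text \<open>
  Write \<open>L = ln (1/\<epsilon>)\<close>. The data and the right-hand side are regularised with a band-limited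
  mollifier of type (2), the tensor power of the Fourier transform of a plateau function, and with
  the slow scale \<open>1/L\<close>. Then \<open>\<partial>\<^sub>x\<^sub>i\<close> acts on them as a bounded operator of norm \<open>B L\<close>, so
  the regularised problem is a linear ordinary differential equation that Picard iteration solves
  globally, with no energy estimate and no Fourier transform in \<open>x\<close>.

  Measuring \<open>\<partial>\<^sub>t u\<close> in units of \<open>L\<close>, the growth rate of the system is at most a constant times
  \<open>L + L \<Sum>\<^sub>i a\<^sub>i\<^sub>,\<^sub>\<epsilon> + \<Sum>\<^sub>i \<bar>c\<^sub>i\<^sub>,\<^sub>\<epsilon>\<bar> + \<bar>e\<^sub>\<epsilon>\<bar>/L + \<bar>d\<^sub>\<epsilon>\<bar>\<close>. The Levi conditions at \<open>\<xi> = \<plusminus> R e\<^sub>i\<close>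
  bound \<open>\<bar>c\<^sub>i\<^sub>,\<^sub>\<epsilon>\<bar>\<close> and \<open>\<bar>e\<^sub>\<epsilon>\<bar>\<close> by a constant times \<open>L (1 + a\<^sub>i\<^sub>,\<^sub>\<epsilon>)\<close>, and \<open>a\<^sub>i\<^sub>,\<^sub>\<epsilon>\<close> is bounded in \<open>L\<^sup>1\<close> because
  \<open>a\<^sub>i\<close> is a positive measure. Hence the integrated rate is \<open>O(L)\<close> and the solution grows at most
  like a power of \<open>1/\<epsilon>\<close>.
\<close>

section \<open>Smooth functions on the line\<close>

text \<open>The definition of a very weak solution leaves the mollifier and the scale of the data
  free; this freedom admits the band-limited kernel and the slow scale. The unknowns of the
  iteration are all space derivatives at once, indexed by words in the coordinate directions.
  Convergence produces limits \<open>D l\<close> but does not show that \<open>D (i # l)\<close> is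
  a derivative of \<open>D l\<close>. This obstacle shapes the proof: the first-order Taylor
  remainders are adjoined as further unknowns with a weight quadratic in the increment. They obey
  the same equations, uniqueness identifies them with the remainders of the limits, and the
  quadratic weight is then differentiability. Remainder bounds are also linear in the function, so
  they pass through convolutions and distributions where a limit would have to be interchanged. The
  supremum of the rate in \<open>t\<close> may be a higher power of \<open>L\<close>; it is its
  integral that must be \<open>O(L)\<close>, and this is why positivity of the \<open>a i\<close> is
  used through a primitive. As \<open>f\<close> is only continuous in \<open>t\<close>, it is
  mollified in \<open>t\<close> too. Plateau functions and cut-offs come from the primitive of
  \<psi>.\<close>

definition dseq :: "(nat \<Rightarrow> real \<Rightarrow> complex) \<Rightarrow> bool"
  where "dseq G \<longleftrightarrow> (\<forall>k x. (G k has_vector_derivative G (Suc k) x) (at x))"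

lemma has_vector_derivative_affine: "((\<lambda>x::real. p * x + q) has_vector_derivative p) (at x within S)"
  by (auto simp flip: has_real_derivative_iff_has_vector_derivative intro!: derivative_eq_intros)

lemma dseqD: "dseq G \<Longrightarrow> (G k has_vector_derivative G (Suc k) x) (at x)"
  by (simp add: dseq_def)

lemma dseq_continuous: "dseq G \<Longrightarrow> continuous_on S (G k)"
  by (meson continuous_at_imp_continuous_on dseqD has_vector_derivative_continuous)

lemma pd_real_eq:
  assumes "(g has_vector_derivative d) (at (x::real))"
  shows "pd 1 g x = d"
proof -
  have "((\<lambda>h. g (x + h)) has_vector_derivative d) (at 0)"
    using vector_diff_chain_at[OF has_vector_derivative_affine[of 1 x], of g d 0] assms
    by (simp add: o_def add.commute)
  then show ?thesis unfolding pd_def by (simp add: vector_derivative_at)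
qed

lemma funpow_pd_dseq: "dseq G \<Longrightarrow> (pd 1 ^^ k) (G 0) = G k"
proof (induction k)
  case (Suc k)
  then show ?case by (auto intro!: pd_real_eq dseqD)
qed simp

lemma foldr_pd_real:
  assumes "set bs \<subseteq> {1::real}"
  shows "foldr pd bs g = (pd 1 ^^ length bs) g"
  using assms by (induction bs) auto

text \<open>On the line the only basis vector is 1, so a word of partial derivatives is determined
  by its length and the iterates of \<open>pd 1\<close> form the sequence. From here on a smooth
  function is carried together with all its derivatives: a derivative is exhibited rather than
  computed, and shifting the index turns a derivative into a function of the same kind.\<close>

lemma smooth_real_iff: "smooth (g :: real \<Rightarrow> complex) \<longleftrightarrow> (\<exists>G. dseq G \<and> G 0 = g)"
proof
  assume g: "smooth g"
  have "dseq (\<lambda>k. (pd 1 ^^ k) g)"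
    unfolding dseq_def
  proof (intro allI)
    fix k and x :: real
    have "set (replicate k (1::real)) \<subseteq> Basis" by auto
    then have "foldr pd (replicate k 1) g differentiable_on UNIV"
      using g unfolding smooth_def by blast
    then have "(pd 1 ^^ k) g differentiable_on UNIV"
      by (subst (asm) foldr_pd_real) auto
    then have "((pd 1 ^^ k) g has_vector_derivative vector_derivative ((pd 1 ^^ k) g) (at x)) (at x)"
      by (simp add: differentiable_on_def vector_derivative_works)
    then show "((pd 1 ^^ k) g has_vector_derivative (pd 1 ^^ Suc k) g x) (at x)"
      using pd_real_eq by fastforce
  qed
  then show "\<exists>G. dseq G \<and> G 0 = g"
    by (intro exI[of _ "\<lambda>k. (pd 1 ^^ k) g"]) auto
next
  assume "\<exists>G. dseq G \<and> G 0 = g"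
  then obtain G where G: "dseq G" "G 0 = g" by blast
  show "smooth g" unfolding smooth_def
  proof (intro allI impI)
    fix bs :: "real list" assume "set bs \<subseteq> Basis"
    then have "foldr pd bs g = G (length bs)"
      using foldr_pd_real[of bs g] funpow_pd_dseq[OF G(1)] G(2) by auto
    then show "foldr pd bs g differentiable_on UNIV"
      using dseqD[OF G(1)] differentiableI_vector unfolding differentiable_on_def by fastforce
  qed
qed

section \<open>Multi-indices, supports and derivatives on the line\<close>

lemma basis_list_works: "distinct (basis_list :: 'a::euclidean_space list) \<and> set (basis_list :: 'a list) = Basis"
  unfolding basis_list_def by (rule someI_ex) (metis finite_Basis finite_distinct_list)

lemma basis_list_real: "(basis_list :: real list) = [1]"
proof -
  have d: "distinct (basis_list :: real list)" and s: "set (basis_list :: real list) = {1}"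
    using basis_list_works[where 'a=real] by auto
  then have "length (basis_list :: real list) = 1" by (metis distinct_card is_singletonI is_singleton_altdef)
  with s show ?thesis by (metis One_nat_def length_0_conv length_Suc_conv list.set_intros(1) singletonD)
qed

lemma mlen_real: "mlen (\<alpha> :: real \<Rightarrow> nat) = \<alpha> 1"
  by (simp add: mlen_def)

lemma mdiff_real: "mdiff \<alpha> g = (pd 1 ^^ \<alpha> 1) (g :: real \<Rightarrow> complex)"
  by (simp add: mdiff_def basis_list_real)

lemma mdiff_dseq: "dseq G \<Longrightarrow> mdiff \<alpha> (G 0) = G (\<alpha> 1)"
  by (simp add: mdiff_real funpow_pd_dseq)

lemma csupp_subset:
  assumes "closed K" "\<And>x. x \<notin> K \<Longrightarrow> g x = 0"
  shows "csupp g \<subseteq> K"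
  unfolding csupp_def using assms by (intro closure_minimal) auto

lemma csupp_subset_interval:
  assumes "\<And>x::real. \<bar>x\<bar> > b \<Longrightarrow> g x = 0"
  shows "csupp g \<subseteq> {-b..b}"
  using assms by (intro csupp_subset) (auto simp: abs_if not_le)

lemma test_fun_dseq:
  assumes "dseq G" "\<And>x. \<bar>x\<bar> > b \<Longrightarrow> G 0 x = 0"
  shows "test_fun (G 0)"
  unfolding test_fun_def
proof
  show "smooth (G 0)" using assms smooth_real_iff by blast
  have "csupp (G 0) \<subseteq> {-b..b}" using assms by (intro csupp_subset_interval) auto
  then show "compact (csupp (G 0))"
    by (metis bounded_subset bounded_closed_interval closed_closure compact_eq_bounded_closed csupp_def)
qed

lemma test_fun_real_dseq:
  assumes "test_fun (g :: real \<Rightarrow> complex)"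
  obtains G b where "dseq G" "G 0 = g" "b > 0" "\<And>x. \<bar>x\<bar> > b \<Longrightarrow> g x = 0"
proof -
  obtain G where G: "dseq G" "G 0 = g" using assms smooth_real_iff unfolding test_fun_def by blast
  have "bounded (csupp g)" using assms compact_imp_bounded unfolding test_fun_def by blast
  then obtain b where b: "b > 0" "\<And>x. x \<in> csupp g \<Longrightarrow> \<bar>x\<bar> \<le> b"
    using bounded_pos[of "csupp g"] by auto
  have "g x = 0" if "\<bar>x\<bar> > b" for x
    using b(2)[of x] that unfolding csupp_def using closure_subset[of "{x. g x \<noteq> 0}"] by fastforce
  with G b(1) that show ?thesis by blast
qed

lemma dseq_vanishing_open:
  assumes "dseq G" "open S" "\<And>x. x \<in> S \<Longrightarrow> G 0 x = 0" "x \<in> S"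
  shows "G k x = 0"
  using assms(4)
proof (induction k arbitrary: x)
  case (Suc k)
  have "(G k has_vector_derivative 0) (at x) \<longleftrightarrow> ((\<lambda>_. 0) has_vector_derivative (0::complex)) (at x)"
    using Suc by (intro has_vector_derivative_cong_ev eventually_mono[OF eventually_nhds_in_open[OF assms(2)]]) auto
  then have "(G k has_vector_derivative 0) (at x)" by simp
  then show ?case using dseqD[OF assms(1), of k x] vector_derivative_unique_at by blast
qed (use assms in auto)

lemma dseq_vanishing:
  assumes "dseq G" "\<And>x. \<bar>x\<bar> > b \<Longrightarrow> G 0 x = 0" "\<bar>x\<bar> > b"
  shows "G k x = 0"
proof (rule dseq_vanishing_open[OF assms(1), of "{x. b < \<bar>x\<bar>}"])
  show "open {x::real. b < \<bar>x\<bar>}" by (intro open_Collect_less continuous_intros)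
qed (use assms in auto)

lemma compact_support_bounded:
  assumes "continuous_on UNIV g" "\<And>x::real. \<bar>x\<bar> > b \<Longrightarrow> g x = (0::complex)"
  obtains M where "M > 0" "\<And>x. norm (g x) \<le> M"
proof -
  have "compact (g ` {-b..b})"
    by (intro compact_continuous_image continuous_on_subset[OF assms(1)]) auto
  then have "bounded (g ` {-b..b})" by (rule compact_imp_bounded)
  then obtain M where M: "M > 0" "\<And>x. x \<in> {-b..b} \<Longrightarrow> norm (g x) \<le> M"
    unfolding bounded_pos by auto
  have "norm (g x) \<le> M" for x
    using M(2)[of x] M(1) assms(2)[of x] by (cases "\<bar>x\<bar> > b") (auto simp: abs_le_iff not_less)
  with M(1) that show ?thesis by blast
qed

lemma dseq_bounded:
  assumes "dseq G" "\<And>x. \<bar>x\<bar> > b \<Longrightarrow> G 0 x = 0"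
  obtains M where "M > 0" "\<And>x. norm (G k x) \<le> M"
  using compact_support_bounded[of "G k" b] dseq_continuous[OF assms(1)] dseq_vanishing[OF assms] by blast

text \<open>The mean value inequality is used twice, for \<open>G (Suc k)\<close> on the segment and
  then for the linearisation of \<open>G k\<close>. This loses the factor 1/2 of the Taylor formula;
  later only the quadratic order in \<open>h\<close> matters.\<close>

lemma dseq_taylor:
  assumes "dseq G" "\<And>x. norm (G (Suc (Suc k)) x) \<le> M"
  shows "norm (G k (x + h) - G k x - h *\<^sub>R G (Suc k) x) \<le> M * h\<^sup>2"
proof -
  have M: "M \<ge> 0" using assms(2)[of 0] norm_ge_zero order_trans by blast
  let ?S = "closed_segment x (x + h)"
  have 1: "norm (G (Suc k) y - G (Suc k) x) \<le> M * \<bar>h\<bar>" if "y \<in> ?S" for y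
  proof -
    have "norm (G (Suc k) y - G (Suc k) x) \<le> M * norm (y - x)"
    proof (rule differentiable_bound[of UNIV _ "\<lambda>x h. h *\<^sub>R G (Suc (Suc k)) x"])
      show "(G (Suc k) has_derivative (\<lambda>h. h *\<^sub>R G (Suc (Suc k)) z)) (at z within UNIV)" for z
        using dseqD[OF assms(1)] by (simp add: has_vector_derivative_def)
      show "onorm (\<lambda>h. h *\<^sub>R G (Suc (Suc k)) z) \<le> M" for z
        using assms(2)[of z] mult_left_mono[of _ M "\<bar>_\<bar>"] by (intro onorm_le) (simp add: mult.commute[of M])
    qed auto
    also have "norm (y - x) \<le> \<bar>h\<bar>" using segment_bound1[OF that] by simp
    finally show ?thesis using M by (simp add: mult_left_mono)
  qed
  have "norm (G k (x + h) - G k x - (x + h - x) *\<^sub>R G (Suc k) x) \<le> norm (x + h - x) * (M * \<bar>h\<bar>)"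
    using dseqD[OF assms(1)] 1
    by (intro vector_differentiable_bound_linearization[of ?S]) (auto intro: has_vector_derivative_at_within)
  then show ?thesis by (simp add: power2_eq_square algebra_simps abs_mult_self_eq)
qed

text \<open>Each derivative of an affine substitution produces one factor \<open>p\<close>. The
  values \<open>p = -1\<close> and \<open>p = 1 / \<omega>\<close> give the reflections that occur
  in convolutions and the rescalings of mollifiers.\<close>

lemma dseq_affine:
  assumes "dseq G"
  shows "dseq (\<lambda>k x. of_real (c * p ^ k) * G k (p * x + q))"
  unfolding dseq_def
proof (intro allI)
  fix k x
  have "((\<lambda>x. G k (p * x + q)) has_vector_derivative p *\<^sub>R G (Suc k) (p * x + q)) (at x)"
    using vector_diff_chain_at[OF has_vector_derivative_affine dseqD[OF assms]] by (simp add: o_def)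
  from has_vector_derivative_mult_right[OF this, of "of_real (c * p ^ k)"]
  show "((\<lambda>x. of_real (c * p ^ k) * G k (p * x + q)) has_vector_derivative
      of_real (c * p ^ Suc k) * G (Suc k) (p * x + q)) (at x)"
    by (simp add: scaleR_conv_of_real algebra_simps)
qed

lemma dseq_diff: "dseq F \<Longrightarrow> dseq G \<Longrightarrow> dseq (\<lambda>k x. F k x - G k x)"
  unfolding dseq_def by (auto intro!: derivative_intros)

text \<open>\<open>leibniz F G i j k\<close> is the \<open>k\<close>-th derivative of \<open>F i * G j\<close>; the recursion avoids binomial sums.\<close>

fun leibniz :: "(nat \<Rightarrow> real \<Rightarrow> complex) \<Rightarrow> (nat \<Rightarrow> real \<Rightarrow> complex) \<Rightarrow> nat \<Rightarrow> nat \<Rightarrow> nat \<Rightarrow> real \<Rightarrow> complex"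
  where
    "leibniz F G i j 0 = (\<lambda>x. F i x * G j x)"
  | "leibniz F G i j (Suc k) = (\<lambda>x. leibniz F G (Suc i) j k x + leibniz F G i (Suc j) k x)"

lemma dseq_leibniz:
  assumes "dseq F" "dseq G"
  shows "dseq (leibniz F G i j)"
proof -
  have "(leibniz F G i j k has_vector_derivative leibniz F G i j (Suc k) x) (at x)" for k i j x
  proof (induction k arbitrary: i j)
    case 0
    then show ?case using assms[THEN dseqD]
      by (auto intro!: derivative_eq_intros)
  next
    case (Suc k)
    from has_vector_derivative_add[OF Suc[of "Suc i" j] Suc[of i "Suc j"]] show ?case by simp
  qed
  then show ?thesis unfolding dseq_def by blast
qed

lemma smooth_real_mult:
  fixes f g :: "real \<Rightarrow> complex"
  assumes "smooth f" "smooth g"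
  shows "smooth (\<lambda>x. f x * g x)"
proof -
  obtain F G where "dseq F" "F 0 = f" "dseq G" "G 0 = g" using assms smooth_real_iff by blast
  then show ?thesis
    using dseq_leibniz[of F G 0 0] unfolding smooth_real_iff
    by (intro exI[of _ "leibniz F G 0 0"]) auto
qed

section \<open>Primitives of mollifiers, plateau functions and cut-offs\<close>

lemma compactly_supported_primitive:
  fixes g :: "real \<Rightarrow> real"
  assumes "continuous_on UNIV g" "\<And>x. g x \<ge> 0" "\<And>x. \<bar>x\<bar> > b \<Longrightarrow> g x = 0" "b > 0" "(LINT x|lborel. g x) = 1"
  obtains G where "\<And>x. (G has_real_derivative g x) (at x)" "\<And>x. x < -b \<Longrightarrow> G x = 0" "\<And>x. x > b \<Longrightarrow> G x = 1"
    "\<And>x. 0 \<le> G x" "\<And>x. G x \<le> 1"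
proof -
  define G where "G x = integral {-b-1..x} g" for x
  have left: "G x = 0" if "x < -b" for x
  proof -
    have "integral {-b-1..x} g = integral {-b-1..x} (\<lambda>_. 0)"
      by (rule integral_cong) (rule assms(3), use that assms(4) in auto)
    then show ?thesis by (simp add: G_def)
  qed
  have der: "(G has_real_derivative g x) (at x)" for x
  \<comment> \<open>The fundamental theorem differentiates only in the interior of an interval that
    begins at \<open>-b - 1\<close>. Left of the support \<open>G\<close> is locally zero; all
    remaining points lie in that interior.\<close>
  proof (cases "x < -b")
    case True
    then have "(G has_real_derivative 0) (at x) \<longleftrightarrow> ((\<lambda>_. 0) has_real_derivative 0) (at x)"
      using left
      by (intro DERIV_cong_ev eventually_mono[OF eventually_nhds_in_open[of "{..<-b}" x]]) auto
    with True assms(3,4) show ?thesis by simp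
  next
    case False
    have "((\<lambda>u. integral {-b-1..u} g) has_vector_derivative g x) (at x within {-b-1..x+1})"
      using False by (intro integral_has_vector_derivative continuous_on_subset[OF assms(1)]) auto
    moreover have "at x within {-b-1..x+1} = at x"
      using False by (intro at_within_interior) auto
    ultimately show ?thesis
      by (simp add: G_def[abs_def] has_real_derivative_iff_has_vector_derivative)
  qed
  have mono: "G x \<le> G y" if "x \<le> y" for x y
    using DERIV_nonneg_imp_nondecreasing[OF that, of G] der assms(2) by blast
  have right: "G x = 1" if "x > b" for x
  proof -
    have "integrable lborel (\<lambda>y. indicator {-b-1..x} y *\<^sub>R g y)"
      by (intro borel_integrable_compact continuous_on_subset[OF assms(1)]) auto
    then have "set_integrable lborel {-b-1..x} g" by (simp add: set_integrable_def)
    from set_borel_integral_eq_integral(2)[OF this] have "G x = (LINT y:{-b-1..x}|lborel. g y)"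
      by (simp add: G_def)
    also have "\<dots> = (LINT y|lborel. g y)"
      unfolding set_lebesgue_integral_def
    proof (intro Bochner_Integration.integral_cong refl)
      fix y show "indicator {-b-1..x} y *\<^sub>R g y = g y"
        using that assms(4) assms(3)[of y] by (cases "\<bar>y\<bar> > b") (auto simp: indicator_def abs_le_iff not_less)
    qed
    finally show ?thesis using assms(5) by simp
  qed
  have "0 \<le> G x" for x using mono[of "min x (-b-1)" x] left[of "min x (-b-1)"] by auto
  moreover have "G x \<le> 1" for x using mono[of x "max x (b+1)"] right[of "max x (b+1)"] by auto
  ultimately show ?thesis using that der left right by blast
qed

text \<open>The sequence consists of the derivatives of \<psi> with its primitive put in front,
  hence \<open>P 1 = \<psi>\<close>. Translates of this step-like function yield plateau functions,
  and testing a coefficient with it yields a primitive of the regularised coefficient.\<close>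

lemma mollifier1_primitive:
  assumes "mollifier1 (\<psi> :: real \<Rightarrow> complex)"
  obtains P b where "dseq P" "P 1 = \<psi>" "b > 0" "\<And>x. x < -b \<Longrightarrow> P 0 x = 0" "\<And>x. x > b \<Longrightarrow> P 0 x = 1"
    "\<And>x. P 0 x \<in> \<real>" "\<And>x. 0 \<le> Re (P 0 x)" "\<And>x. Re (P 0 x) \<le> 1" "\<And>k x. \<bar>x\<bar> > b \<Longrightarrow> P (Suc k) x = 0"
proof -
  have t: "test_fun \<psi>" and nn: "\<And>x. \<psi> x \<in> \<real>\<^sub>\<ge>\<^sub>0" and I: "(LINT x|lborel. \<psi> x) = 1"
    using assms by (auto simp: mollifier1_def)
  obtain G b where G: "dseq G" "G 0 = \<psi>" "b > 0" "\<And>x. \<bar>x\<bar> > b \<Longrightarrow> \<psi> x = 0"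
    using test_fun_real_dseq[OF t] by blast
  have re: "\<psi> x = of_real (Re (\<psi> x))" "Re (\<psi> x) \<ge> 0" for x
    using nn[of x] by (auto simp: nonneg_Reals_def)
  have c: "continuous_on UNIV \<psi>" using dseq_continuous[OF G(1), of UNIV 0] G(2) by simp
  \<comment> \<open>The Bochner integral of a non-integrable function is 0, so a total of 1 forces
    integrability.\<close>
  have "integrable lborel \<psi>" using I not_integrable_integral_eq by fastforce
  then have "(LINT x|lborel. Re (\<psi> x)) = 1" using I integral_Re[of lborel \<psi>] by simp
  then obtain Q where Q: "\<And>x. (Q has_real_derivative Re (\<psi> x)) (at x)" "\<And>x. x < -b \<Longrightarrow> Q x = 0"
      "\<And>x. x > b \<Longrightarrow> Q x = 1" "\<And>x. 0 \<le> Q x" "\<And>x. Q x \<le> 1"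
    using compactly_supported_primitive[of "\<lambda>x. Re (\<psi> x)" b] c G(3,4) re
    by (metis continuous_on_Re zero_complex.sel(1))
  define P where "P k = (case k of 0 \<Rightarrow> \<lambda>x. complex_of_real (Q x) | Suc k \<Rightarrow> G k)" for k
  have "dseq P" unfolding dseq_def
  proof (intro allI)
    fix k x show "(P k has_vector_derivative P (Suc k) x) (at x)"
    proof (cases k)
      case 0
      have "((\<lambda>x. complex_of_real (Q x)) has_vector_derivative of_real (Re (\<psi> x))) (at x)"
        using Q(1)[of x] by (intro has_vector_derivative_of_real) (simp add: has_real_derivative_iff_has_vector_derivative)
      then show ?thesis using 0 re(1)[of x] G(2) by (simp add: P_def)
    next
      case (Suc m)
      then show ?thesis using dseqD[OF G(1)] by (simp add: P_def)
    qed
  qed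
  moreover have "P (Suc k) x = 0" if "\<bar>x\<bar> > b" for k x
    using dseq_vanishing[OF G(1), of b x k] G(2,4) that by (simp add: P_def)
  ultimately show ?thesis using that[of P b] Q G by (simp add: P_def)
qed

text \<open>Plateau functions are differences of two translates of the primitive.\<close>

lemma plateau_function:
  assumes "mollifier1 (\<psi> :: real \<Rightarrow> complex)" "B \<ge> 0"
  obtains Z b where "dseq Z" "b > 0" "\<And>x. \<bar>x\<bar> > b \<Longrightarrow> Z 0 x = 0" "\<And>x. \<bar>x\<bar> < B \<Longrightarrow> Z 0 x = 1"
    "\<And>x. Z 0 x \<in> \<real>\<^sub>\<ge>\<^sub>0"
proof -
  obtain P b where P: "dseq P" "P 1 = \<psi>" "b > 0" "\<And>x. x < -b \<Longrightarrow> P 0 x = 0" "\<And>x. x > b \<Longrightarrow> P 0 x = 1"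
    "\<And>x. P 0 x \<in> \<real>" "\<And>x. 0 \<le> Re (P 0 x)" "\<And>x. Re (P 0 x) \<le> 1"
    "\<And>k x. \<bar>x\<bar> > b \<Longrightarrow> P (Suc k) x = 0"
    by (rule mollifier1_primitive[OF assms(1)]) (rule that)
  \<comment> \<open>Throughout \<open>\<bar>x\<bar> < B\<close> one translate must have reached 1
    and the other must still be 0. With this shift both hold with a margin \<open>b\<close>, and
    beyond \<open>C + b\<close> the two translates have the same constant value.\<close>
  define C where "C = B + 2 * b"
  have C: "C > 0" using assms(2) P(3) by (simp add: C_def)
  define Z where "Z k x = P k (x + C) - P k (x + (-C))" for k x
  have "dseq (\<lambda>k x. of_real (1 * 1 ^ k) * P k (1 * x + C) - of_real (1 * 1 ^ k) * P k (1 * x + (-C)))"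
    by (intro dseq_diff dseq_affine P)
  then have "dseq Z" by (simp add: Z_def[abs_def])
  moreover have "Z 0 x = 0" if "\<bar>x\<bar> > C + b" for x
  proof (cases "x > 0")
    case True
    then have "x + C > b" "x + (-C) > b" using that C P(3) by linarith+
    then show ?thesis by (simp only: Z_def P(5) diff_self)
  next
    case False
    then have "x + C < -b" "x + (-C) < -b" using that C P(3) by linarith+
    then show ?thesis by (simp only: Z_def P(4) diff_self)
  qed
  moreover have "Z 0 x = 1" if "\<bar>x\<bar> < B" for x
  proof -
    have "x + C > b" "x + (-C) < -b" using that P(3) unfolding C_def by linarith+
    then show ?thesis by (simp only: Z_def P(4,5) diff_zero)
  qed
  moreover have "Z 0 x \<in> \<real>\<^sub>\<ge>\<^sub>0" for x
  proof -
    have "Re (P 0 (x + (-C))) \<le> Re (P 0 (x + C))"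
    proof (cases "x > 0")
      case True
      then have "x + C > b" using P(3) assms(2) unfolding C_def by linarith
      then show ?thesis using P(8)[of "x + (-C)"] by (simp only: P(5) one_complex.sel)
    next
      case False
      then have "x + (-C) < -b" using P(3) assms(2) unfolding C_def by linarith
      then show ?thesis using P(7)[of "x + C"] by (simp only: P(4) zero_complex.sel)
    qed
    then show ?thesis using P(6) by (simp add: Z_def complex_nonneg_Reals_iff complex_is_Real_iff)
  qed
  moreover have "C + b > 0" using C P(3) by simp
  ultimately show ?thesis using that by blast
qed

text \<open>\<open>dist_pair\<close> takes its cut-off by \<open>SOME\<close>, which is meaningful
  only once a cut-off exists. The plateau reaches to \<bar>T\<bar> + 1, so that its flat part
  contains an open neighbourhood of the interval whatever the sign of \<open>T\<close>.\<close>

lemma exists_cutoff: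
  assumes "mollifier1 (\<psi> :: real \<Rightarrow> complex)"
  shows "\<exists>\<zeta>. cutoff {0..T::real} \<zeta>"
proof -
  have "0 \<le> \<bar>T\<bar> + 1" by simp
  obtain Z b where Z: "dseq Z" "b > 0" "\<And>x. \<bar>x\<bar> > b \<Longrightarrow> Z 0 x = 0" "\<And>x. \<bar>x\<bar> < \<bar>T\<bar> + 1 \<Longrightarrow> Z 0 x = 1"
    by (rule plateau_function[OF assms \<open>0 \<le> \<bar>T\<bar> + 1\<close>]) (rule that)
  have "cutoff {0..T} (Z 0)"
    unfolding cutoff_def
  proof (intro conjI exI[of _ "{-(\<bar>T\<bar> + 1)<..<\<bar>T\<bar> + 1}"] ballI)
    show "test_fun (Z 0)" using Z(1,3) by (rule test_fun_dseq)
    show "{0..T} \<subseteq> {-(\<bar>T\<bar> + 1)<..<\<bar>T\<bar> + 1}" by auto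
    show "Z 0 x = 1" if "x \<in> {-(\<bar>T\<bar> + 1)<..<\<bar>T\<bar> + 1}" for x
      using that by (intro Z(4)) (simp add: abs_less_iff)
  qed auto
  then show ?thesis by blast
qed

section \<open>Regularised coefficients\<close>

text \<open>Only the remainder on the unit ball matters. Derivatives of functions defined through a
  distribution, or by superposition and iteration in \<open>x\<close>, are obtained from this
  criterion: a bound on the remainder passes through such constructions, where a limit would have to
  be interchanged.\<close>

lemma has_derivative_quadratic_remainder:
  fixes f :: "'a::real_normed_vector \<Rightarrow> 'b::real_normed_vector"
  assumes "bounded_linear D" "\<And>h. norm h \<le> 1 \<Longrightarrow> norm (f (x + h) - f x - D h) \<le> c * (norm h)\<^sup>2"
  shows "(f has_derivative D) (at x)"
  unfolding has_derivative_at
proof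
  have "eventually (\<lambda>h::'a. norm h \<le> 1) (at 0)"
    using eventually_at_ball[of 1 "0::'a" UNIV] by (auto elim!: eventually_mono)
  then have ev: "\<forall>\<^sub>F h in at 0. norm (f (x + h) - f x - D h) / norm h \<le> c * norm h"
  proof (rule eventually_mono)
    fix h :: 'a assume "norm h \<le> 1"
    from assms(2)[OF this] show "norm (f (x + h) - f x - D h) / norm h \<le> c * norm h"
      by (cases "h = 0") (auto simp: field_simps power2_eq_square)
  qed
  have "((\<lambda>h::'a. c * norm h) \<longlongrightarrow> 0) (at 0)"
    by (auto intro!: tendsto_eq_intros)
  from tendsto_sandwich[OF _ ev tendsto_const this]
  show "(\<lambda>h. norm (f (x + h) - f x - D h) / norm h) \<midarrow>0\<rightarrow> 0" by simp
qed (rule assms)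

section \<open>Distributions acting on curves of test functions\<close>

lemma distribution_diff:
  assumes "distribution w" "test_fun f" "test_fun g" "test_fun (\<lambda>x. f x - g x)"
  shows "w (\<lambda>x. f x - g x) = w f - w g"
proof -
  have "w (\<lambda>x. (f x - g x) + g x) = w (\<lambda>x. f x - g x) + w g"
    using assms unfolding distribution_def by blast
  then show ?thesis by simp
qed

lemma distribution_cmult:
  assumes "distribution w" "test_fun f"
  shows "w (\<lambda>x. z * f x) = z * w f"
  using assms unfolding distribution_def by blast

lemma test_fun_cong_zero: "test_fun f \<Longrightarrow> (\<And>x. f x = 0 \<Longrightarrow> g x = 0) \<Longrightarrow> smooth g \<Longrightarrow> test_fun g"
proof -
  assume f: "test_fun f" and z: "\<And>x. f x = 0 \<Longrightarrow> g x = 0" and g: "smooth g"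
  have "csupp g \<subseteq> csupp f" unfolding csupp_def using z by (intro closure_mono) auto
  then have "compact (csupp g)"
    using f unfolding test_fun_def csupp_def by (metis closed_closure compact_Int_closed inf.absorb_iff2)
  with g show ?thesis by (simp add: test_fun_def)
qed

lemma smooth_real_diff:
  fixes f g :: "real \<Rightarrow> complex"
  shows "smooth f \<Longrightarrow> smooth g \<Longrightarrow> smooth (\<lambda>x. f x - g x)"
  unfolding smooth_real_iff using dseq_diff by fastforce

text \<open>The cut-off equals 1 on a neighbourhood \<open>U\<close> of \<open>S\<close>, so
  \<open>\<zeta> * g - g\<close> is a test function supported in the closed complement of
  \<open>U\<close>, which does not meet \<open>S\<close>; on such functions \<open>w\<close>
  vanishes.\<close>

lemma dist_pair_test_fun:
  fixes g :: "real \<Rightarrow> complex"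
  assumes w: "distribution w" "dist_supp_in w S" and g: "test_fun g" and ex: "\<exists>\<zeta>. cutoff S \<zeta>"
  shows "dist_pair S w g = w g"
proof -
  define \<zeta> where "\<zeta> = (SOME \<zeta>. cutoff S \<zeta>)"
  have "cutoff S \<zeta>" unfolding \<zeta>_def using ex by (rule someI_ex)
  then obtain U where \<zeta>: "test_fun \<zeta>" and U: "open U" "S \<subseteq> U" "\<And>x. x \<in> U \<Longrightarrow> \<zeta> x = 1"
    unfolding cutoff_def by blast
  have s: "smooth (\<lambda>x. \<zeta> x * g x)"
    using \<zeta> g by (intro smooth_real_mult) (auto simp: test_fun_def)
  have t: "test_fun (\<lambda>x. \<zeta> x * g x)" using test_fun_cong_zero[OF g _ s] by simp
  have t2: "test_fun (\<lambda>x. \<zeta> x * g x - g x)"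
    using g smooth_real_diff[OF s] by (rule_tac test_fun_cong_zero[of g]) (auto simp: test_fun_def)
  have "csupp (\<lambda>x. \<zeta> x * g x - g x) \<subseteq> - U"
    using U by (intro csupp_subset) auto
  then have "w (\<lambda>x. \<zeta> x * g x - g x) = 0"
    using w(2) t2 U(2) unfolding dist_supp_in_def by blast
  then have "w (\<lambda>x. \<zeta> x * g x) = w g"
    using distribution_diff[OF w(1) t g t2] by simp
  then show ?thesis by (simp add: dist_pair_def \<zeta>_def)
qed

lemma dseq_reflect: "dseq G \<Longrightarrow> dseq (\<lambda>k y. (-1) ^ k * G k (t - y))"
  using dseq_affine[of G 1 "-1" t] by simp

lemma distribution_bound:
  assumes "distribution (w :: (real \<Rightarrow> complex) \<Rightarrow> complex)"
  obtains C N where "C \<ge> 0"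
    "\<And>G M. dseq G \<Longrightarrow> (\<And>x. \<bar>x\<bar> > b \<Longrightarrow> G 0 x = 0) \<Longrightarrow> (\<And>k x. k \<le> N \<Longrightarrow> norm (G k x) \<le> M)
      \<Longrightarrow> norm (w (G 0)) \<le> C * M"
proof -
  have "compact {-b..b}" by simp
  then obtain C N where CN: "\<And>\<phi> M. test_fun \<phi> \<and> csupp \<phi> \<subseteq> {-b..b} \<and>
       (\<forall>\<alpha> x. mlen \<alpha> \<le> N \<longrightarrow> norm (mdiff \<alpha> \<phi> x) \<le> M) \<longrightarrow> norm (w \<phi>) \<le> C * M"
    using assms unfolding distribution_def by metis
  have "norm (w (G 0)) \<le> max C 0 * M"
    if G: "dseq G" "\<And>x. \<bar>x\<bar> > b \<Longrightarrow> G 0 x = 0" "\<And>k x. k \<le> N \<Longrightarrow> norm (G k x) \<le> M" for G M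
  proof -
    have "norm (w (G 0)) \<le> C * M"
      using CN[of "G 0" M] test_fun_dseq[OF G(1,2)] csupp_subset_interval[of b "G 0"] G
      by (auto simp: mdiff_dseq mlen_real)
    moreover have "M \<ge> 0" using G(3)[of 0 0] norm_ge_zero order_trans by blast
    ultimately show ?thesis by (meson max.cobounded1 mult_right_mono order_trans)
  qed
  then show ?thesis using that[of "max C 0" N] by simp
qed

text \<open>The first-order Taylor remainder of \<open>Q m\<close> under translation is a test
  function whose derivatives up to the order of \<open>w\<close> are quadratically small in
  \<open>h\<close>; by continuity of \<open>w\<close>, differentiation in \<open>t\<close> falls on
  the test function. The offset \<open>q\<close>, which cancels in differences, admits a
  \<open>Q m\<close> that is merely constant towards either end, such as the primitive of a
  mollifier, whose single translates are not test functions.\<close>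

lemma distribution_curve_derivative:
  fixes w :: "(real \<Rightarrow> complex) \<Rightarrow> complex"
  assumes w: "distribution w" and Q: "dseq Q" and bd: "\<And>k. \<exists>M. \<forall>x. norm (Q k x) \<le> M"
    and const: "\<And>x y. x > b \<Longrightarrow> y > b \<Longrightarrow> Q m x = Q m y" "\<And>x y. x < -b \<Longrightarrow> y < -b \<Longrightarrow> Q m x = Q m y"
    and b: "b > 0" and vanish: "\<And>x. \<bar>x\<bar> > b \<Longrightarrow> Q (Suc m) x = 0"
    and \<phi>: "\<And>t. test_fun (\<lambda>y. Q m (t - y) - q y)"
  shows "((\<lambda>t. w (\<lambda>y. Q m (t - y) - q y)) has_vector_derivative w (\<lambda>y. Q (Suc m) (t - y))) (at t)"
proof -
  \<comment> \<open>For increments \<open>\<bar>h\<bar> \<le> 1\<close> the remainder and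
    \<open>D\<close> vanish outside \<open>{-B..B}\<close>, so one constant and one order of
    \<open>w\<close> serve for all of them.\<close>
  define B where "B = \<bar>t\<bar> + 1 + b"
  obtain C N where CN: "C \<ge> 0" "\<And>G M. dseq G \<Longrightarrow> (\<And>x. \<bar>x\<bar> > B \<Longrightarrow> G 0 x = 0) \<Longrightarrow>
      (\<And>k x. k \<le> N \<Longrightarrow> norm (G k x) \<le> M) \<Longrightarrow> norm (w (G 0)) \<le> C * M"
    using distribution_bound[OF w, of B] by blast
  obtain M where M: "\<And>k x. norm (Q k x) \<le> M k" using bd by metis
  define MM where "MM = (\<Sum>k\<le>N. M (Suc (Suc (m + k))))"
  have Mnn: "M k \<ge> 0" for k using M[of k 0] norm_ge_zero order_trans by blast
  have MM: "M (Suc (Suc (m + k))) \<le> MM" if "k \<le> N" for k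
    unfolding MM_def using that Mnn by (intro member_le_sum) auto
  define D where "D = (\<lambda>y. Q (Suc m) (t - y))"
  have Qs: "dseq (\<lambda>k. Q (k + j))" for j using Q by (simp add: dseq_def)
  have tD: "test_fun D"
    using test_fun_dseq[OF dseq_reflect[OF Qs[of "Suc m"], of t], of B] vanish
    by (simp add: D_def B_def)
  have "norm (w (\<lambda>y. Q m (t + h - y) - q y) - w (\<lambda>y. Q m (t - y) - q y) - h *\<^sub>R w D) \<le> (C * MM) * (norm h)\<^sup>2"
    if h: "norm h \<le> 1" for h
  proof -
    \<comment> \<open>The sequence of \<open>y\<close>-derivatives of that remainder; the sign
      \<open>(-1) ^ k\<close> comes from the reflection \<open>t - y\<close>.\<close>
    define R where "R k y = (-1) ^ k * Q (k + m) (t + h - y) - (-1) ^ k * Q (k + m) (t - y)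
        - of_real h * ((-1) ^ k * Q (k + Suc m) (t - y))" for k y
    have dR: "dseq R"
    proof -
      have "dseq (\<lambda>k y. of_real h * ((-1) ^ k * Q (k + Suc m) (t - y)))"
        using dseq_affine[OF Qs[of "Suc m"], of h "-1" t] by (simp add: mult.assoc)
      then show ?thesis unfolding R_def[abs_def]
        by (intro dseq_diff dseq_reflect Qs)
    qed
    have R0: "R 0 y = 0" if "\<bar>y\<bar> > B" for y
    proof -
      have v: "Q (Suc m) (t - y) = 0" using that b by (intro vanish) (auto simp: B_def)
      show ?thesis
      proof (cases "y > 0")
        case True
        then have "t + h - y < - b" "t - y < - b" using that h b by (auto simp: B_def)
        then show ?thesis using const(2)[of "t + h - y" "t - y"] v by (simp add: R_def)
      next
        case False
        then have "t + h - y > b" "t - y > b" using that h b by (auto simp: B_def)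
        then show ?thesis using const(1)[of "t + h - y" "t - y"] v by (simp add: R_def)
      qed
    qed
    have "norm (R k y) \<le> MM * h\<^sup>2" if "k \<le> N" for k y
    proof -
      have "R k y = (-1) ^ k * (Q (k + m) ((t - y) + h) - Q (k + m) (t - y) - h *\<^sub>R Q (Suc (k + m)) (t - y))"
        by (simp add: R_def algebra_simps scaleR_conv_of_real)
      then have "norm (R k y) = norm (Q (k + m) ((t - y) + h) - Q (k + m) (t - y) - h *\<^sub>R Q (Suc (k + m)) (t - y))"
        by (simp add: norm_mult norm_power)
      also have "\<dots> \<le> M (Suc (Suc (k + m))) * h\<^sup>2" by (rule dseq_taylor[OF Q M])
      also have "\<dots> \<le> MM * h\<^sup>2" using MM[OF that] by (simp add: mult_right_mono add.commute)
      finally show ?thesis .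
    qed
    then have "norm (w (R 0)) \<le> C * (MM * h\<^sup>2)" using dR R0 by (intro CN(2)) auto
    moreover have "w (R 0) = w (\<lambda>y. Q m (t + h - y) - q y) - w (\<lambda>y. Q m (t - y) - q y) - h *\<^sub>R w D"
    proof -
      \<comment> \<open>\<open>w\<close> is additive on test functions only, so the parts have to be
        recognised as such. The difference of the two translates is the remainder plus a multiple of
        \<open>D\<close>.\<close>
      have sub: "test_fun (\<lambda>y. (Q m (t + h - y) - q y) - (Q m (t - y) - q y))"
      proof -
        have "test_fun (\<lambda>y. R 0 y - (- of_real h * D y))"
        proof -
          have "dseq (\<lambda>k y. R k y - of_real (- h) * ((-1) ^ k * Q (k + Suc m) (t - y)))"
            using dseq_affine[OF Qs[of "Suc m"], of "-h" "-1" t] by (intro dseq_diff dR) (simp add: mult.assoc)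
          from test_fun_dseq[OF this, of B] show ?thesis
            using R0 vanish by (simp add: D_def B_def)
        qed
        then show ?thesis by (simp add: R_def D_def)
      qed
      have thD: "test_fun (\<lambda>y. of_real h * D y)"
      proof -
        have "dseq (\<lambda>k y. of_real h * ((-1) ^ k * Q (k + Suc m) (t - y)))"
          using dseq_affine[OF Qs[of "Suc m"], of h "-1" t] by (simp add: mult.assoc)
        from test_fun_dseq[OF this, of B] show ?thesis using vanish by (simp add: D_def B_def)
      qed
      have tR: "test_fun (R 0)" using dR R0 by (rule test_fun_dseq)
      have R0_eq: "R 0 = (\<lambda>y. ((Q m (t + h - y) - q y) - (Q m (t - y) - q y)) - of_real h * D y)"
        by (simp add: R_def[abs_def] D_def)
      have "w (R 0) = w (\<lambda>y. (Q m (t + h - y) - q y) - (Q m (t - y) - q y)) - w (\<lambda>y. of_real h * D y)"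
        unfolding R0_eq using distribution_diff[OF w sub thD] tR[unfolded R0_eq] by blast
      then show ?thesis
        using distribution_diff[OF w \<phi> \<phi> sub] distribution_cmult[OF w tD, of "of_real h"]
        by (simp add: scaleR_conv_of_real)
    qed
    ultimately show ?thesis by (simp add: mult.assoc)
  qed
  then have "((\<lambda>t. w (\<lambda>y. Q m (t - y) - q y)) has_derivative (\<lambda>h. h *\<^sub>R w D)) (at t)"
    by (intro has_derivative_quadratic_remainder) (auto intro: bounded_linear_scaleR_left)
  then show ?thesis by (simp add: has_vector_derivative_def D_def)
qed

text \<open>One primitive for each scale, with \<open>b\<close> and the constants of the derivative
  bounds independent of \<omega>. This uniformity yields one constant for a whole net: a bound by
  \<open>(1 / \<omega>) ^ k\<close> is moderate as soon as \<open>1 / \<omega>\<close> is.\<close>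

definition scaled_primitive :: "(real \<Rightarrow> complex) \<Rightarrow> real \<Rightarrow> (real \<Rightarrow> nat \<Rightarrow> real \<Rightarrow> complex) \<Rightarrow> bool"
  where "scaled_primitive \<psi> b P \<longleftrightarrow> b > 0 \<and>
    (\<forall>\<omega>>0. dseq (P \<omega>) \<and> P \<omega> 1 = rescale \<omega> \<psi> \<and>
      (\<forall>x < -(b * \<omega>). P \<omega> 0 x = 0) \<and> (\<forall>x > b * \<omega>. P \<omega> 0 x = 1) \<and>
      (\<forall>k x. \<bar>x\<bar> > b * \<omega> \<longrightarrow> P \<omega> (Suc k) x = 0) \<and> (\<forall>x y. x \<le> y \<longrightarrow> Re (P \<omega> 0 x) \<le> Re (P \<omega> 0 y))) \<and>
    (\<forall>\<omega> x. P \<omega> 0 x \<in> \<real> \<and> 0 \<le> Re (P \<omega> 0 x) \<and> Re (P \<omega> 0 x) \<le> 1) \<and>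
    (\<forall>k. \<exists>M>0. \<forall>\<omega>>0. \<forall>x. norm (P \<omega> k x) \<le> M * (1 / \<omega>) ^ k)"

lemma scaled_primitiveD:
  assumes "scaled_primitive \<psi> b P"
  shows "b > 0" "\<And>\<omega>. \<omega> > 0 \<Longrightarrow> dseq (P \<omega>)" "\<And>\<omega>. \<omega> > 0 \<Longrightarrow> P \<omega> 1 = rescale \<omega> \<psi>"
    "\<And>\<omega> x. \<omega> > 0 \<Longrightarrow> x < -(b * \<omega>) \<Longrightarrow> P \<omega> 0 x = 0" "\<And>\<omega> x. \<omega> > 0 \<Longrightarrow> x > b * \<omega> \<Longrightarrow> P \<omega> 0 x = 1"
    "\<And>\<omega> k x. \<omega> > 0 \<Longrightarrow> \<bar>x\<bar> > b * \<omega> \<Longrightarrow> P \<omega> (Suc k) x = 0"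
    "\<And>\<omega> x. P \<omega> 0 x \<in> \<real>" "\<And>\<omega> x. 0 \<le> Re (P \<omega> 0 x)" "\<And>\<omega> x. Re (P \<omega> 0 x) \<le> 1"
    "\<And>\<omega> x y. \<omega> > 0 \<Longrightarrow> x \<le> y \<Longrightarrow> Re (P \<omega> 0 x) \<le> Re (P \<omega> 0 y)"
    "\<And>k. \<exists>M>0. \<forall>\<omega>>0. \<forall>x. norm (P \<omega> k x) \<le> M * (1 / \<omega>) ^ k"
  using assms unfolding scaled_primitive_def by simp_all

text \<open>Substituting \<open>x / \<omega>\<close> in the primitive of \<psi> is enough: its first
  derivative then carries the normalising factor \<open>1 / \<omega>\<close> of
  \<open>rescale\<close>.\<close>

lemma exists_scaled_primitive:
  assumes "mollifier1 (\<psi> :: real \<Rightarrow> complex)"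
  shows "\<exists>b P. scaled_primitive \<psi> b P"
proof -
  obtain P b where P: "dseq P" "P 1 = \<psi>" "b > 0" "\<And>x. x < -b \<Longrightarrow> P 0 x = 0" "\<And>x. x > b \<Longrightarrow> P 0 x = 1"
    "\<And>x. P 0 x \<in> \<real>" "\<And>x. 0 \<le> Re (P 0 x)" "\<And>x. Re (P 0 x) \<le> 1"
    "\<And>k x. \<bar>x\<bar> > b \<Longrightarrow> P (Suc k) x = 0"
    by (rule mollifier1_primitive[OF assms(1)]) (rule that)
  define S where "S \<omega> k x = of_real ((1 / \<omega>) ^ k) * P k (x / \<omega>)" for \<omega> k x
  have d: "dseq (S \<omega>)" if "\<omega> > 0" for \<omega>
    using dseq_affine[OF P(1), of 1 "1 / \<omega>" 0] by (simp add: S_def[abs_def] field_simps)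
  have psi: "0 \<le> Re (\<psi> x)" for x
    using assms by (simp add: mollifier1_def complex_nonneg_Reals_iff)
  have r: "S \<omega> 1 = rescale \<omega> \<psi>" for \<omega>
    using P(2) by (simp add: S_def[abs_def] rescale_def[abs_def] divide_inverse mult.commute)
  have mono: "Re (S \<omega> 0 x) \<le> Re (S \<omega> 0 y)" if "\<omega> > 0" "x \<le> y" for \<omega> x y
  proof (rule DERIV_nonneg_imp_nondecreasing[OF that(2)])
    fix z
    have "((\<lambda>z. Re (S \<omega> 0 z)) has_vector_derivative Re (S \<omega> 1 z)) (at z)"
      using bounded_linear.has_vector_derivative[OF bounded_linear_Re dseqD[OF d[OF that(1)], of 0]] by simp
    moreover have "Re (S \<omega> 1 z) \<ge> 0"
      unfolding r rescale_def using psi that(1) by simp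
    ultimately show "\<exists>d. ((\<lambda>z. Re (S \<omega> 0 z)) has_real_derivative d) (at z) \<and> 0 \<le> d"
      by (auto simp: has_real_derivative_iff_has_vector_derivative)
  qed
  have bd: "\<exists>M>0. \<forall>\<omega>>0. \<forall>x. norm (S \<omega> k x) \<le> M * (1 / \<omega>) ^ k" for k
  proof -
    have "\<exists>M>0. \<forall>x. norm (P k x) \<le> M"
    proof (cases k)
      case 0
      have "norm (P 0 x) = Re (P 0 x)" for x using P(6,7)[of x] by (simp add: in_Reals_norm)
      then show ?thesis using P(8) 0 by (intro exI[of _ 1]) auto
    next
      case (Suc j)
      have "dseq (\<lambda>k. P (Suc k))" using P(1) by (simp add: dseq_def)
      then show ?thesis using dseq_bounded[of "\<lambda>k. P (Suc k)" b j] P(9) Suc by metis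
    qed
    then obtain M where "M > 0" "\<And>x. norm (P k x) \<le> M" by blast
    then show ?thesis
      by (intro exI[of _ M]) (auto simp: S_def norm_mult norm_power norm_divide mult.commute mult_right_mono divide_right_mono power_one_over)
  qed
  have "scaled_primitive \<psi> b S" unfolding scaled_primitive_def
  proof (intro conjI allI impI)
    fix \<omega> x :: real
    show "S \<omega> 0 x \<in> \<real>" "0 \<le> Re (S \<omega> 0 x)" "Re (S \<omega> 0 x) \<le> 1" using P(6-8) by (simp_all add: S_def)
    assume w: "\<omega> > 0"
    show "S \<omega> 0 x = 0" if "x < -(b * \<omega>)" using that P(4)[of "x / \<omega>"] w by (simp add: S_def field_simps)
    show "S \<omega> 0 x = 1" if "x > b * \<omega>" using that P(5)[of "x / \<omega>"] w by (simp add: S_def field_simps)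
    show "S \<omega> (Suc k) x = 0" if "\<bar>x\<bar> > b * \<omega>" for k
      using that P(9)[of "x / \<omega>" k] w by (simp add: S_def field_simps)
  qed (use P(3) d r mono bd in \<open>simp_all\<close>)
  then show ?thesis by blast
qed

section \<open>Moderate nets of real numbers\<close>

definition moderate :: "(real \<Rightarrow> real) \<Rightarrow> bool"
  where "moderate m \<longleftrightarrow> (\<exists>C>0. \<exists>N. \<forall>\<epsilon>\<in>{0<..1}. \<bar>m \<epsilon>\<bar> \<le> C * (1 / \<epsilon>) ^ N)"

lemma moderateI:
  assumes "C > 0" "\<And>\<epsilon>. \<epsilon> \<in> {0<..1} \<Longrightarrow> \<bar>m \<epsilon>\<bar> \<le> C * (1 / \<epsilon>) ^ N"
  shows "moderate m"
  using assms unfolding moderate_def by blast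

lemma moderate_mono:
  assumes "moderate m" "\<And>\<epsilon>. \<epsilon> \<in> {0<..1} \<Longrightarrow> \<bar>m' \<epsilon>\<bar> \<le> m \<epsilon>"
  shows "moderate m'"
proof -
  obtain C N where C: "C > 0" "\<And>\<epsilon>. \<epsilon> \<in> {0<..1} \<Longrightarrow> \<bar>m \<epsilon>\<bar> \<le> C * (1 / \<epsilon>) ^ N"
    using assms(1) unfolding moderate_def by blast
  show ?thesis by (rule moderateI[OF C(1), of _ N]) (use C(2) assms(2) in fastforce)
qed

lemma moderate_const [simp]: "moderate (\<lambda>_. c)"
  by (rule moderateI[of "\<bar>c\<bar> + 1" _ 0]) auto

lemma moderate_inverse [simp]: "moderate (\<lambda>\<epsilon>. 1 / \<epsilon>)"
  by (rule moderateI[of 1 _ 1]) auto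

lemma moderate_mult:
  assumes "moderate m" "moderate n"
  shows "moderate (\<lambda>\<epsilon>. m \<epsilon> * n \<epsilon>)"
proof -
  obtain C N where C: "C > 0" "\<And>\<epsilon>. \<epsilon> \<in> {0<..1} \<Longrightarrow> \<bar>m \<epsilon>\<bar> \<le> C * (1 / \<epsilon>) ^ N"
    using assms(1) unfolding moderate_def by blast
  obtain D L where D: "D > 0" "\<And>\<epsilon>. \<epsilon> \<in> {0<..1} \<Longrightarrow> \<bar>n \<epsilon>\<bar> \<le> D * (1 / \<epsilon>) ^ L"
    using assms(2) unfolding moderate_def by blast
  show ?thesis
  proof (rule moderateI[of "C * D" _ "N + L"])
    fix \<epsilon> :: real assume e: "\<epsilon> \<in> {0<..1}"
    have "\<bar>m \<epsilon>\<bar> * \<bar>n \<epsilon>\<bar> \<le> (C * (1 / \<epsilon>) ^ N) * (D * (1 / \<epsilon>) ^ L)"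
      using C D e by (intro mult_mono) auto
    then show "\<bar>m \<epsilon> * n \<epsilon>\<bar> \<le> C * D * (1 / \<epsilon>) ^ (N + L)"
      by (simp add: abs_mult power_add mult_ac)
  qed (use C D in auto)
qed

lemma moderate_add:
  assumes "moderate m" "moderate n"
  shows "moderate (\<lambda>\<epsilon>. m \<epsilon> + n \<epsilon>)"
proof -
  obtain C N where C: "C > 0" "\<And>\<epsilon>. \<epsilon> \<in> {0<..1} \<Longrightarrow> \<bar>m \<epsilon>\<bar> \<le> C * (1 / \<epsilon>) ^ N"
    using assms(1) unfolding moderate_def by blast
  obtain D L where D: "D > 0" "\<And>\<epsilon>. \<epsilon> \<in> {0<..1} \<Longrightarrow> \<bar>n \<epsilon>\<bar> \<le> D * (1 / \<epsilon>) ^ L"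
    using assms(2) unfolding moderate_def by blast
  show ?thesis
  proof (rule moderateI[of "C + D" _ "N + L"])
    fix \<epsilon> :: real assume e: "\<epsilon> \<in> {0<..1}"
    have "C * (1 / \<epsilon>) ^ N \<le> C * (1 / \<epsilon>) ^ (N + L)" "D * (1 / \<epsilon>) ^ L \<le> D * (1 / \<epsilon>) ^ (N + L)"
      using C D e by (auto intro!: mult_left_mono power_increasing)
    then show "\<bar>m \<epsilon> + n \<epsilon>\<bar> \<le> (C + D) * (1 / \<epsilon>) ^ (N + L)"
      using C(2)[OF e] D(2)[OF e] by (simp add: distrib_right)
  qed (use C D in auto)
qed

lemma moderate_power: "moderate m \<Longrightarrow> moderate (\<lambda>\<epsilon>. m \<epsilon> ^ k)"
  by (induction k) (auto intro: moderate_mult)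

lemma moderate_sum: "(\<And>i. i \<in> I \<Longrightarrow> moderate (m i)) \<Longrightarrow> moderate (\<lambda>\<epsilon>. \<Sum>i\<in>I. m i \<epsilon>)"
  by (induction I rule: infinite_finite_induct) (auto intro: moderate_add)

text \<open>A translate of a compactly supported mollifier is itself a test function, so the cut-off
  in \<open>dist_pair\<close> has no effect.\<close>

lemma dist_conv_mollifier1:
  fixes \<psi> :: "real \<Rightarrow> complex"
  assumes w: "distribution w" "dist_supp_in w {0..T}" and \<psi>: "mollifier1 \<psi>"
    and P: "dseq P" "P (1::nat) = \<theta>" "\<And>x. \<bar>x\<bar> > b \<Longrightarrow> P 1 x = 0"
  shows "dist_conv {0..T} w \<theta> t = w (\<lambda>y. P 1 (t - y))"
proof -
  have "dseq (\<lambda>k. P (Suc k))" using P(1) by (simp add: dseq_def)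
  from test_fun_dseq[OF dseq_reflect[OF this, of t], of "\<bar>t\<bar> + b"]
  have "test_fun (\<lambda>y. P 1 (t - y))" using P(3) by simp
  from dist_pair_test_fun[OF w this exists_cutoff[OF \<psi>]] show ?thesis
    unfolding dist_conv_def P(2) .
qed

text \<open>Differentiating in \<open>t\<close> puts the derivatives on the mollifier, at the cost
  of one factor \<open>1 / \<omega> \<epsilon>\<close> each; the finite order of \<open>w\<close> on
  a compact set adds finitely many more. A moderate \<open>1 / \<omega> \<epsilon>\<close> therefore
  gives moderate bounds for every derivative.\<close>

lemma regularised_coefficient_family:
  fixes w :: "(real \<Rightarrow> complex) \<Rightarrow> complex"
  assumes w: "distribution w" "dist_supp_in w {0..T}" and \<psi>: "mollifier1 \<psi>"
    and \<omega>: "\<And>\<epsilon>. \<epsilon> \<in> {0<..1} \<Longrightarrow> 0 < \<omega> \<epsilon> \<and> \<omega> \<epsilon> \<le> \<omega>max" and mod: "moderate (\<lambda>\<epsilon>. 1 / \<omega> \<epsilon>)"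
  obtains H where "\<And>\<epsilon>. \<epsilon> \<in> {0<..1} \<Longrightarrow> dseq (H \<epsilon>)"
    "\<And>\<epsilon>. \<epsilon> \<in> {0<..1} \<Longrightarrow> H \<epsilon> 0 = dist_conv {0..T} w (rescale (\<omega> \<epsilon>) \<psi>)"
    "\<And>k \<tau>. \<exists>m. moderate m \<and> (\<forall>\<epsilon>\<in>{0<..1}. \<forall>t. \<bar>t\<bar> \<le> \<tau> \<longrightarrow> norm (H \<epsilon> k t) \<le> m \<epsilon>)"
proof -
  obtain b P where "scaled_primitive \<psi> b P" using exists_scaled_primitive[OF \<psi>] by blast
  note P = scaled_primitiveD[OF this]
  obtain M where M: "\<And>k. M k > 0" "\<And>k \<omega> x. \<omega> > 0 \<Longrightarrow> norm (P \<omega> k x) \<le> M k * (1 / \<omega>) ^ k"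
    using P(11) by metis
  define H where "H \<epsilon> k t = w (\<lambda>y. P (\<omega> \<epsilon>) (Suc k) (t - y))" for \<epsilon> k t
  have sh: "dseq (\<lambda>j. P \<omega> (j + k))" if "\<omega> > 0" for \<omega> k
    using P(2)[OF that] by (simp add: dseq_def)
  show ?thesis
  proof (rule that[of H])
    fix \<epsilon> :: real assume e: "\<epsilon> \<in> {0<..1}"
    note pos = conjunct1[OF \<omega>[OF e]]
    show "dseq (H \<epsilon>)" unfolding dseq_def H_def
    proof (intro allI)
      fix k t
      have "((\<lambda>t. w (\<lambda>y. P (\<omega> \<epsilon>) (Suc k) (t - y) - 0)) has_vector_derivative
          w (\<lambda>y. P (\<omega> \<epsilon>) (Suc (Suc k)) (t - y))) (at t)"
      proof (rule distribution_curve_derivative[OF w(1) P(2)[OF pos], where b="b * \<omega> \<epsilon>"])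
        show "\<exists>M. \<forall>x. norm (P (\<omega> \<epsilon>) k x) \<le> M" for k using M(2) pos by blast
        show "test_fun (\<lambda>y. P (\<omega> \<epsilon>) (Suc k) (t - y) - 0)" for t
          using test_fun_dseq[OF dseq_reflect[OF sh[OF pos, of "Suc k"], of t], of "\<bar>t\<bar> + b * \<omega> \<epsilon>"] P(6)[OF pos] by simp
      qed (use P(1,6) pos in auto)
      then show "((\<lambda>t. w (\<lambda>y. P (\<omega> \<epsilon>) (Suc k) (t - y))) has_vector_derivative
          w (\<lambda>y. P (\<omega> \<epsilon>) (Suc (Suc k)) (t - y))) (at t)" by simp
    qed
    show "H \<epsilon> 0 = dist_conv {0..T} w (rescale (\<omega> \<epsilon>) \<psi>)"
      using dist_conv_mollifier1[OF w \<psi> P(2)[OF pos] P(3)[OF pos], of "b * \<omega> \<epsilon>"] P(6)[OF pos, of _ 0]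
      by (auto simp: H_def)
  next
    fix k :: nat and \<tau> :: real
    \<comment> \<open>All translates with \<open>\<bar>t\<bar> \<le> \<tau>\<close>, at all scales
      up to \<open>\<omega>max\<close>, are supported in \<open>{-B..B}\<close>, so the constant and
      the order of the distribution do not depend on \<epsilon>.\<close>
    define B where "B = \<tau> + b * \<omega>max"
    obtain C N where CN: "C \<ge> 0" "\<And>G M. dseq G \<Longrightarrow> (\<And>x. \<bar>x\<bar> > B \<Longrightarrow> G 0 x = 0) \<Longrightarrow>
        (\<And>k x. k \<le> N \<Longrightarrow> norm (G k x) \<le> M) \<Longrightarrow> norm (w (G 0)) \<le> C * M"
      using distribution_bound[OF w(1), of B] by blast
    define m where "m \<epsilon> = C * (\<Sum>j\<le>N. M (j + Suc k) * (1 / \<omega> \<epsilon>) ^ (j + Suc k))" for \<epsilon>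
    have "moderate m" unfolding m_def
      by (intro moderate_mult moderate_sum moderate_const moderate_power mod)
    moreover have "norm (H \<epsilon> k t) \<le> m \<epsilon>" if e: "\<epsilon> \<in> {0<..1}" and t: "\<bar>t\<bar> \<le> \<tau>" for \<epsilon> t
    proof -
      have pos: "\<omega> \<epsilon> > 0" and le: "\<omega> \<epsilon> \<le> \<omega>max" using \<omega>[OF e] by auto
      let ?G = "\<lambda>j y. (-1) ^ j * P (\<omega> \<epsilon>) (j + Suc k) (t - y)"
      have "norm (w (?G 0)) \<le> C * (\<Sum>j\<le>N. M (j + Suc k) * (1 / \<omega> \<epsilon>) ^ (j + Suc k))"
      proof (rule CN(2))
        show "dseq ?G" by (intro dseq_reflect sh pos)
        show "?G 0 y = 0" if "\<bar>y\<bar> > B" for y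
        proof -
          have "b * \<omega> \<epsilon> \<le> b * \<omega>max" using P(1) le by simp
          then have "\<bar>t - y\<bar> > b * \<omega> \<epsilon>" using that t unfolding B_def by linarith
          then show ?thesis using P(6)[OF pos] by simp
        qed
        show "norm (?G j y) \<le> (\<Sum>j\<le>N. M (j + Suc k) * (1 / \<omega> \<epsilon>) ^ (j + Suc k))" if "j \<le> N" for j y
        proof -
          have "norm (?G j y) \<le> M (j + Suc k) * (1 / \<omega> \<epsilon>) ^ (j + Suc k)"
            using M(2)[OF pos, of "j + Suc k" "t - y"] by (simp add: norm_mult norm_power)
          also have "\<dots> \<le> (\<Sum>j\<le>N. M (j + Suc k) * (1 / \<omega> \<epsilon>) ^ (j + Suc k))"
            using that pos M(1) by (intro member_le_sum) (auto intro!: mult_nonneg_nonneg less_imp_le)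
          finally show ?thesis .
        qed
      qed
      then show ?thesis by (simp add: H_def m_def)
    qed
    ultimately show "\<exists>m. moderate m \<and> (\<forall>\<epsilon>\<in>{0<..1}. \<forall>t. \<bar>t\<bar> \<le> \<tau> \<longrightarrow> norm (H \<epsilon> k t) \<le> m \<epsilon>)" by blast
  qed
qed

text \<open>A nonnegative distribution is a measure, so its regularisations are bounded in \<open>L\<^sup>1\<close>; the
  bound is expressed through a primitive.\<close>

lemma nonneg_regularisation_primitive:
  fixes w :: "(real \<Rightarrow> complex) \<Rightarrow> complex"
  assumes w: "distribution w" "dist_supp_in w {0..T}" "dist_nonneg w" and \<psi>: "mollifier1 \<psi>"
    and T: "T > 0"
  obtains M where "M \<ge> 0"
    "\<And>\<omega>. 0 < \<omega> \<Longrightarrow> \<omega> \<le> \<omega>max \<Longrightarrow> (\<forall>t. dist_conv {0..T} w (rescale \<omega> \<psi>) t \<in> \<real>\<^sub>\<ge>\<^sub>0) \<and>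
      (\<exists>A. \<forall>t\<in>{0..T}. (A has_real_derivative Re (dist_conv {0..T} w (rescale \<omega> \<psi>) t)) (at t)
         \<and> 0 \<le> A t \<and> A t \<le> M)"
proof -
  obtain b P where "scaled_primitive \<psi> b P" using exists_scaled_primitive[OF \<psi>] by blast
  note P = scaled_primitiveD[OF this]
  \<comment> \<open>A plateau of this width dominates every kernel used below; the summand 1 makes
    the inequality at its edge strict.\<close>
  define B where "B = T + b * \<bar>\<omega>max\<bar> + 1"
  have B: "B \<ge> 0" using P(1) T by (simp add: B_def)
  obtain Z c where Z: "dseq Z" "c > 0" "\<And>x. \<bar>x\<bar> > c \<Longrightarrow> Z 0 x = 0" "\<And>x. \<bar>x\<bar> < B \<Longrightarrow> Z 0 x = 1"
    "\<And>x. Z 0 x \<in> \<real>\<^sub>\<ge>\<^sub>0"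
    by (rule plateau_function[OF \<psi> B]) (rule that)
  have tZ: "test_fun (Z 0)" using Z(1,3) by (rule test_fun_dseq)
  define M where "M = Re (w (Z 0))"
  have nn: "w \<phi> \<in> \<real>\<^sub>\<ge>\<^sub>0" if "test_fun \<phi>" "\<And>x. \<phi> x \<in> \<real>\<^sub>\<ge>\<^sub>0" for \<phi>
    using w(3) that unfolding dist_nonneg_def by blast
  have M: "M \<ge> 0" using nn[OF tZ Z(5)] by (simp add: M_def complex_nonneg_Reals_iff)
  show ?thesis
  proof (rule that[OF M])
    fix \<omega> :: real assume pos: "0 < \<omega>" and le: "\<omega> \<le> \<omega>max"
    have conv: "dist_conv {0..T} w (rescale \<omega> \<psi>) t = w (\<lambda>y. P \<omega> 1 (t - y))" for t
      using dist_conv_mollifier1[OF w(1,2) \<psi> P(2)[OF pos] P(3)[OF pos], of "b * \<omega>"] P(6)[OF pos, of _ 0] by auto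
    have sh: "dseq (\<lambda>j. P \<omega> (j + k))" for k
      using P(2)[OF pos] by (simp add: dseq_def)
    have "dist_conv {0..T} w (rescale \<omega> \<psi>) t \<in> \<real>\<^sub>\<ge>\<^sub>0" for t
      unfolding conv
    proof (rule nn)
      show "test_fun (\<lambda>y. P \<omega> 1 (t - y))"
        using test_fun_dseq[OF dseq_reflect[OF sh[of 1], of t], of "\<bar>t\<bar> + b * \<omega>"] P(6)[OF pos, of _ 0] by simp
      show "P \<omega> 1 (t - y) \<in> \<real>\<^sub>\<ge>\<^sub>0" for y
        unfolding P(3)[OF pos] rescale_def using pos \<psi>
        by (auto simp: mollifier1_def complex_nonneg_Reals_iff)
    qed
    moreover have "\<exists>A. \<forall>t\<in>{0..T}. (A has_real_derivative Re (dist_conv {0..T} w (rescale \<omega> \<psi>) t)) (at t)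
         \<and> 0 \<le> A t \<and> A t \<le> M"
    proof (intro exI ballI conjI)
      \<comment> \<open>As a function of \<open>y\<close> this is the integral over \<open>s\<close>
        from 0 to \<open>t\<close> of the mollifier at \<open>s - y\<close>. It lies between 0 and 1
        and below the plateau, so testing the positive distribution with it gives a primitive in
        \<open>t\<close> between 0 and \<open>M\<close>, whatever the scale.\<close>
      define Hf where "Hf t y = P \<omega> 0 (t - y) - P \<omega> 0 (0 - y)" for t y
      have Hd: "dseq (\<lambda>k y. (-1) ^ k * P \<omega> k (t - y) - (-1) ^ k * P \<omega> k (0 - y))" for t
        by (intro dseq_diff dseq_reflect P(2) pos)
      have Hz: "Hf t y = 0" if "\<bar>y\<bar> > \<bar>t\<bar> + b * \<omega>" for t y
      proof (cases "y > 0")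
        case True
        then have "t - y < -(b * \<omega>)" "0 - y < -(b * \<omega>)" using that by auto
        then show ?thesis unfolding Hf_def by (simp only: P(4)[OF pos] diff_self)
      next
        case False
        then have "t - y > b * \<omega>" "0 - y > b * \<omega>" using that by auto
        then show ?thesis unfolding Hf_def by (simp only: P(5)[OF pos] diff_self)
      qed
      have tH: "test_fun (Hf t)" for t
        using test_fun_dseq[OF Hd[of t], of "\<bar>t\<bar> + b * \<omega>"] Hz[of t] by (simp add: Hf_def[abs_def])
      fix t assume t: "t \<in> {0..T}"
      have "((\<lambda>t. w (\<lambda>y. P \<omega> 0 (t - y) - P \<omega> 0 (0 - y))) has_vector_derivative w (\<lambda>y. P \<omega> (Suc 0) (t - y))) (at t)"
      proof (rule distribution_curve_derivative[OF w(1) P(2)[OF pos], where b="b * \<omega>"])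
        show "\<exists>M. \<forall>x. norm (P \<omega> k x) \<le> M" for k using P(11) pos by blast
        show "test_fun (\<lambda>y. P \<omega> 0 (t - y) - P \<omega> 0 (0 - y))" for t
          using tH[of t] by (simp add: Hf_def[abs_def])
      qed (use P(1,4,5,6) pos in auto)
      from bounded_linear.has_vector_derivative[OF bounded_linear_Re this]
      show "((\<lambda>t. Re (w (Hf t))) has_real_derivative Re (dist_conv {0..T} w (rescale \<omega> \<psi>) t)) (at t)"
        by (simp add: conv Hf_def[abs_def] has_real_derivative_iff_has_vector_derivative)
      have Hpos: "Hf t y \<in> \<real>\<^sub>\<ge>\<^sub>0" for y
        using P(7) P(10)[OF pos, of "0 - y" "t - y"] t
        by (simp add: Hf_def complex_nonneg_Reals_iff complex_is_Real_iff)
      show "0 \<le> Re (w (Hf t))" using nn[OF tH Hpos] by (simp add: complex_nonneg_Reals_iff)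
      have "dseq (\<lambda>k y. Z k y - ((-1) ^ k * P \<omega> k (t - y) - (-1) ^ k * P \<omega> k (0 - y)))"
        by (intro dseq_diff Z Hd)
      note tst = test_fun_dseq[OF this, of "c + (\<bar>t\<bar> + b * \<omega>)"]
      have tD: "test_fun (\<lambda>y. Z 0 y - Hf t y)"
      proof -
        have "Z 0 y - Hf t y = 0" if "\<bar>y\<bar> > c + (\<bar>t\<bar> + b * \<omega>)" for y
        proof -
          have "b * \<omega> > 0" using P(1) pos by simp
          then have "\<bar>y\<bar> > c" "\<bar>y\<bar> > \<bar>t\<bar> + b * \<omega>" using that Z(2) by auto
          then show ?thesis using Z(3) Hz by simp
        qed
        then show ?thesis
          using tst by (simp add: Hf_def[abs_def])
      qed
      have "Z 0 y - Hf t y \<in> \<real>\<^sub>\<ge>\<^sub>0" for y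
      proof (cases "\<bar>y\<bar> < B")
        case True
        have "Re (Hf t y) \<le> 1" using P(8)[of \<omega> "0 - y"] P(9)[of \<omega> "t - y"] by (simp add: Hf_def)
        then show ?thesis using True Hpos[of y] by (simp add: Z(4) complex_nonneg_Reals_iff)
      next
        case False
        have "b * \<omega> \<le> b * \<bar>\<omega>max\<bar>" using P(1) le by (intro mult_left_mono) auto
        then have "\<bar>y\<bar> > \<bar>t\<bar> + b * \<omega>" using False t unfolding B_def by auto
        then show ?thesis using Hz Z(5) by simp
      qed
      from nn[OF tD this] show "Re (w (Hf t)) \<le> M"
        using distribution_diff[OF w(1) tZ tH tD] by (simp add: M_def complex_nonneg_Reals_iff)
    qed
    ultimately show "(\<forall>t. dist_conv {0..T} w (rescale \<omega> \<psi>) t \<in> \<real>\<^sub>\<ge>\<^sub>0) \<and>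
      (\<exists>A. \<forall>t\<in>{0..T}. (A has_real_derivative Re (dist_conv {0..T} w (rescale \<omega> \<psi>) t)) (at t)
         \<and> 0 \<le> A t \<and> A t \<le> M)" by blast
  qed
qed

section \<open>Picard iteration in weighted sequence spaces\<close>

text \<open>The bound of the integrand is the derivative of
  \<open>c * (K t ^ Suc j / fact (Suc j))\<close>, so integration raises the index by one; the
  contribution at 0 enters with a favourable sign and is dropped. Existence and uniqueness both
  iterate this step.\<close>

lemma integral_norm_bound_power:
  fixes f :: "real \<Rightarrow> complex"
  assumes K: "\<And>t. t \<in> {0..T} \<Longrightarrow> (K has_real_derivative k t) (at t)" "\<And>t. t \<in> {0..T} \<Longrightarrow> 0 \<le> K t"
    and f: "continuous_on {0..T} f" and c: "c \<ge> 0" and t: "t \<in> {0..T}"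
    and bd: "\<And>t. t \<in> {0..T} \<Longrightarrow> norm (f t) \<le> k t * (c * (K t ^ j / fact j))"
  shows "norm (integral {0..t} f) \<le> c * (K t ^ Suc j / fact (Suc j))"
proof -
  let ?g = "\<lambda>s. k s * (c * (K s ^ j / fact j))"
  have "(?g has_integral c * (K t ^ Suc j / fact (Suc j)) - c * (K 0 ^ Suc j / fact (Suc j))) {0..t}"
  proof (rule fundamental_theorem_of_calculus)
    fix s assume s: "s \<in> {0..t}"
    then have "(K has_real_derivative k s) (at s)" using K(1) t by auto
    from DERIV_cmult[OF DERIV_cdivide[OF DERIV_power[OF this, of "Suc j"], of "fact (Suc j)"], of c]
    have "((\<lambda>s. c * (K s ^ Suc j / fact (Suc j))) has_real_derivative
        c * ((real (Suc j) * (k s * K s ^ j)) / fact (Suc j))) (at s)"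
      by (simp only: One_nat_def diff_Suc_Suc diff_zero)
    moreover have "c * ((real (Suc j) * (k s * K s ^ j)) / fact (Suc j)) = ?g s"
      by (simp add: fact_Suc del: of_nat_Suc)
    ultimately show "((\<lambda>s. c * (K s ^ Suc j / fact (Suc j))) has_vector_derivative ?g s) (at s within {0..t})"
      by (simp only: has_real_derivative_iff_has_vector_derivative has_vector_derivative_at_within)
  qed (use t in auto)
  moreover have "norm (integral {0..t} f) \<le> integral {0..t} ?g"
  proof (rule integral_norm_bound_integral)
    show "f integrable_on {0..t}"
      using t by (intro integrable_continuous_interval continuous_on_subset[OF f]) auto
    show "?g integrable_on {0..t}" using calculation by blast
  qed (use bd t in auto)
  moreover have "c * (K 0 ^ Suc j / fact (Suc j)) \<ge> 0" using K(2)[of 0] t c by simp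
  ultimately show ?thesis
    using integral_unique[OF \<open>(?g has_integral _) _\<close>] by linarith
qed

text \<open>The solution is the series of Picard increments; the \<open>j\<close>-th one is bounded
  by \<open>C * w i * (K t ^ j / fact j)\<close>, and summation gives the factor
  \<open>exp (K t)\<close>. The growth is governed by the primitive \<open>K\<close> alone, while
  \<open>kmax\<close> serves the uniform convergence of the derivatives and does not enter the
  bound. The inhomogeneity sits in \<open>V0\<close>, whose derivative is \<open>F\<close>.\<close>

lemma weighted_ode_solution:
  fixes A :: "real \<Rightarrow> ('i \<Rightarrow> complex) \<Rightarrow> 'i \<Rightarrow> complex"
  assumes T: "T > 0" and w: "\<And>i. w i \<ge> 0" and C: "C \<ge> 0"
    and add: "\<And>t V W i. A t (\<lambda>i. V i + W i) i = A t V i + A t W i"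
    and cont: "\<And>V i. (\<And>i. continuous_on {0..T} (\<lambda>t. V t i)) \<Longrightarrow> continuous_on {0..T} (\<lambda>t. A t (V t) i)"
    and bd: "\<And>t V M i. t \<in> {0..T} \<Longrightarrow> (\<And>i. norm (V i) \<le> M * w i) \<Longrightarrow> norm (A t V i) \<le> k t * (M * w i)"
    and K: "\<And>t. t \<in> {0..T} \<Longrightarrow> (K has_real_derivative k t) (at t)" "\<And>t. t \<in> {0..T} \<Longrightarrow> 0 \<le> K t"
    and k: "\<And>t. t \<in> {0..T} \<Longrightarrow> 0 \<le> k t" "\<And>t. t \<in> {0..T} \<Longrightarrow> k t \<le> kmax"
    and F: "\<And>t i. t \<in> {0..T} \<Longrightarrow> ((\<lambda>t. V0 t i) has_vector_derivative F t i) (at t within {0..T})"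
    and V0: "\<And>t i. t \<in> {0..T} \<Longrightarrow> norm (V0 t i) \<le> C * w i"
  obtains V where "\<And>i. V 0 i = V0 0 i"
    "\<And>t i. t \<in> {0..T} \<Longrightarrow> ((\<lambda>t. V t i) has_vector_derivative F t i + A t (V t) i) (at t within {0..T})"
    "\<And>t i. t \<in> {0..T} \<Longrightarrow> norm (V t i) \<le> C * exp (K t) * w i"
proof -
  \<comment> \<open>These are the increments; the Picard iterates are their partial sums.\<close>
  define U where "U = rec_nat V0 (\<lambda>_ U t i. integral {0..t} (\<lambda>s. A s (U s) i))"
  have U0: "U 0 = V0" and US: "U (Suc j) = (\<lambda>t i. integral {0..t} (\<lambda>s. A s (U j s) i))" for j
    by (simp_all add: U_def)
  have Ucont: "continuous_on {0..T} (\<lambda>t. U j t i)" for j i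
  proof (induction j arbitrary: i)
    case 0
    then show ?case unfolding U0
      by (rule continuous_on_vector_derivative[where f' = "\<lambda>t. F t i"]) (rule F)
  next
    case (Suc j)
    have "continuous_on {0..T} (\<lambda>s. A s (U j s) i)" by (rule cont) (rule Suc)
    then show ?case unfolding US
      by (intro indefinite_integral_continuous_1 integrable_continuous_interval)
  qed
  have Uder: "((\<lambda>t. U (Suc j) t i) has_vector_derivative A t (U j t) i) (at t within {0..T})" if "t \<in> {0..T}" for j t i
    unfolding US
  proof (rule integral_has_vector_derivative[OF _ that])
    show "continuous_on {0..T} (\<lambda>s. A s (U j s) i)" by (rule cont) (rule Ucont)
  qed
  have Ubd: "norm (U j t i) \<le> C * w i * (K t ^ j / fact j)" if "t \<in> {0..T}" for j t i
    using that
  proof (induction j arbitrary: t i)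
    case (Suc j)
    show ?case unfolding US
    proof (rule integral_norm_bound_power[OF K _ _ Suc.prems])
      show "continuous_on {0..T} (\<lambda>s. A s (U j s) i)" by (rule cont) (rule Ucont)
      fix s assume s: "s \<in> {0..T}"
      have "norm (A s (U j s) i) \<le> k s * (C * (K s ^ j / fact j) * w i)"
        using Suc.IH[OF s] by (intro bd s) (simp add: mult_ac)
      then show "norm (A s (U j s) i) \<le> k s * (C * w i * (K s ^ j / fact j))" by (simp add: mult_ac)
    qed (use C w in auto)
  next
    case 0
    then show ?case using V0[of t i] by (simp add: U0)
  qed
  have Kmono: "K s \<le> K t" if "s \<in> {0..T}" "t \<in> {0..T}" "s \<le> t" for s t
  proof (rule DERIV_nonneg_imp_nondecreasing[OF that(3)])
    fix x assume "s \<le> x" "x \<le> t"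
    then have "x \<in> {0..T}" using that by auto
    then show "\<exists>y. (K has_real_derivative y) (at x) \<and> 0 \<le> y" using K(1) k(1) by blast
  qed
  define \<kappa> where "\<kappa> = K T"
  have \<kappa>: "\<kappa> \<ge> 0" "\<And>t. t \<in> {0..T} \<Longrightarrow> K t \<le> \<kappa>"
    using K(2)[of T] Kmono[of _ T] T by (auto simp: \<kappa>_def)
  have expsum: "(\<lambda>j. x ^ j / fact j) sums exp x" for x :: real
    using exp_converges[of x] by (simp add: divide_inverse mult.commute)
  have Usum: "summable (\<lambda>j. U j t i)" if "t \<in> {0..T}" for t i
  proof -
    have "summable (\<lambda>j. C * w i * (K t ^ j / fact j))"
      by (intro summable_mult sums_summable[OF expsum])
    then show ?thesis by (rule summable_comparison_test'[where N = 0]) (rule Ubd[OF that])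
  qed
  define V where "V t i = (\<Sum>j. U j t i)" for t i
  \<comment> \<open>Remainder of the exponential series at the largest exponent \<kappa>, the value
    of \<open>K\<close> at \<open>T\<close>, hence uniform in \<open>t\<close>.\<close>
  define tail where "tail n = C * (exp \<kappa> - (\<Sum>j<n. \<kappa> ^ j / fact j))" for n
  have tail0: "tail \<longlonglongrightarrow> 0"
    unfolding tail_def using expsum[of \<kappa>] unfolding sums_def
    by (auto intro!: tendsto_eq_intros)
  have Vtail: "norm (V t i - (\<Sum>j<n. U j t i)) \<le> tail n * w i" if t: "t \<in> {0..T}" for t i n
  proof -
    have "V t i - (\<Sum>j<n. U j t i) = (\<Sum>j. U (j + n) t i)"
      unfolding V_def using suminf_minus_initial_segment[OF Usum[OF t]] by simp
    also have "norm \<dots> \<le> (\<Sum>j. C * w i * (\<kappa> ^ (j + n) / fact (j + n)))"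
    proof (rule norm_suminf_le)
      fix j
      have "norm (U (j + n) t i) \<le> C * w i * (K t ^ (j + n) / fact (j + n))" by (rule Ubd[OF t])
      also have "\<dots> \<le> C * w i * (\<kappa> ^ (j + n) / fact (j + n))"
        using C w \<kappa>(2)[OF t] K(2)[OF t]
        by (intro mult_left_mono divide_right_mono power_mono) auto
      finally show "norm (U (j + n) t i) \<le> C * w i * (\<kappa> ^ (j + n) / fact (j + n))" .
    next
      show "summable (\<lambda>j. C * w i * (\<kappa> ^ (j + n) / fact (j + n)))"
        using sums_summable[OF expsum[of \<kappa>]] by (intro summable_mult summable_ignore_initial_segment)
    qed
    also have "\<dots> = C * w i * (\<Sum>j. \<kappa> ^ (j + n) / fact (j + n))"
      using sums_summable[OF expsum[of \<kappa>]] by (intro suminf_mult summable_ignore_initial_segment)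
    also have "(\<Sum>j. \<kappa> ^ (j + n) / fact (j + n)) = exp \<kappa> - (\<Sum>j<n. \<kappa> ^ j / fact j)"
      using suminf_minus_initial_segment[OF sums_summable[OF expsum[of \<kappa>]], of n] sums_unique[OF expsum[of \<kappa>]] by simp
    finally show ?thesis by (simp add: tail_def mult_ac)
  qed
  have Asub: "A t (\<lambda>i. X i - Y i) i = A t X i - A t Y i" for t X Y i
    using add[of t "\<lambda>i. X i - Y i" Y i] by simp
  have Azero: "A t (\<lambda>i. 0) i = 0" for t i using Asub[of t "\<lambda>_. 0" "\<lambda>_. 0" i] by simp
  have Asum: "A t (\<lambda>i. \<Sum>j<n. U j t i) i = (\<Sum>j<n. A t (U j t) i)" for t i and n :: nat
    by (induction n) (simp_all add: Azero add)
  have kmax: "kmax \<ge> 0" using k[of 0] T by force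
  define f' where "f' j t i = (case j of 0 \<Rightarrow> F t i | Suc j \<Rightarrow> A t (U j t) i)" for j t i
  have f': "((\<lambda>t. U j t i) has_vector_derivative f' j t i) (at t within {0..T})" if "t \<in> {0..T}" for j t i
    using Uder[OF that] F[OF that] by (cases j) (auto simp: f'_def U0)
  have Vder: "((\<lambda>t. V t i) has_vector_derivative F t i + A t (V t) i) (at t within {0..T})" if t: "t \<in> {0..T}" for t i
  proof -
    have "\<exists>g. \<forall>x\<in>{0..T}. (\<lambda>j. U j x i) sums g x \<and>
        (g has_derivative (\<lambda>h. h *\<^sub>R (F x i + A x (V x) i))) (at x within {0..T})"
    proof (rule has_derivative_series[where f' = "\<lambda>j x h. h *\<^sub>R f' j x i"])
      show "((\<lambda>x. U j x i) has_derivative (\<lambda>h. h *\<^sub>R f' j x i)) (at x within {0..T})" if "x \<in> {0..T}" for j x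
        using f'[OF that] by (simp add: has_vector_derivative_def)
      show "0 \<in> {0..T}" using T by simp
      then show "(\<lambda>j. U j 0 i) sums (\<Sum>j. U j 0 i)" using Usum by blast
      fix e :: real assume e: "e > 0"
      have "(\<lambda>n. kmax * (tail n * w i)) \<longlonglongrightarrow> 0" using tail0 by (auto intro!: tendsto_eq_intros)
      then have "\<forall>\<^sub>F n in sequentially. kmax * (tail n * w i) < e" using e by (rule order_tendstoD)
      \<comment> \<open>The \<open>n\<close>-th partial sum of the derivatives is \<open>F\<close>
        together with \<open>A\<close> applied to only \<open>n - 1\<close> increments, because
        differentiation lowers the index by one.\<close>
      then have "\<forall>\<^sub>F n in sequentially. kmax * (tail (n - 1) * w i) < e \<and> n > 0"
        by (subst eventually_sequentially_Suc[symmetric]) simp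
      then show "\<forall>\<^sub>F n in sequentially. \<forall>x\<in>{0..T}. \<forall>h.
          norm ((\<Sum>j<n. h *\<^sub>R f' j x i) - h *\<^sub>R (F x i + A x (V x) i)) \<le> e * norm h"
      proof (rule eventually_mono, intro ballI allI)
        fix n :: nat and x h :: real assume n: "kmax * (tail (n - 1) * w i) < e \<and> n > 0" and x: "x \<in> {0..T}"
        then obtain m where m: "n = Suc m" by (cases n) auto
        have "(\<Sum>j<n. h *\<^sub>R f' j x i) - h *\<^sub>R (F x i + A x (V x) i) =
            - h *\<^sub>R (A x (V x) i - (\<Sum>j<m. A x (U j x) i))"
          unfolding m sum.lessThan_Suc_shift
          by (simp add: f'_def scaleR_sum_right[symmetric] algebra_simps)
        also have "A x (V x) i - (\<Sum>j<m. A x (U j x) i) = A x (\<lambda>i. V x i - (\<Sum>j<m. U j x i)) i"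
          by (simp add: Asub Asum)
        also have "norm (- h *\<^sub>R A x (\<lambda>i. V x i - (\<Sum>j<m. U j x i)) i) \<le> \<bar>h\<bar> * (k x * (tail m * w i))"
          using bd[OF x Vtail[OF x]] by (simp add: mult_left_mono)
        also have "\<dots> \<le> \<bar>h\<bar> * (kmax * (tail m * w i))"
        proof -
          have "0 \<le> tail m * w i" using Vtail[OF x] norm_ge_zero order_trans by blast
          then show ?thesis using k(2)[OF x] by (intro mult_left_mono mult_right_mono) auto
        qed
        also have "\<dots> \<le> \<bar>h\<bar> * e" using n m by (intro mult_left_mono) simp_all
        also have "\<bar>h\<bar> * e = e * norm h" by simp
        finally show "norm ((\<Sum>j<n. h *\<^sub>R f' j x i) - h *\<^sub>R (F x i + A x (V x) i)) \<le> e * norm h" .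
      qed
    qed auto
    then obtain g where g: "\<And>x. x \<in> {0..T} \<Longrightarrow> (\<lambda>j. U j x i) sums g x"
       "\<And>x. x \<in> {0..T} \<Longrightarrow> (g has_derivative (\<lambda>h. h *\<^sub>R (F x i + A x (V x) i))) (at x within {0..T})"
      by blast
    have eq: "V x i = g x" if "x \<in> {0..T}" for x
      unfolding V_def using sums_unique[OF g(1)[OF that]] by (rule sym)
    show ?thesis unfolding has_vector_derivative_def
      by (rule has_derivative_transform[OF t _ g(2)[OF t]]) (rule eq)
  qed
  have Vbd: "norm (V t i) \<le> C * exp (K t) * w i" if t: "t \<in> {0..T}" for t i
  proof -
    have "norm (V t i) \<le> (\<Sum>j. C * w i * (K t ^ j / fact j))"
      unfolding V_def
    proof (rule norm_suminf_le)
      show "norm (U j t i) \<le> C * w i * (K t ^ j / fact j)" for j by (rule Ubd[OF t])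
      show "summable (\<lambda>j. C * w i * (K t ^ j / fact j))"
        by (intro summable_mult sums_summable[OF expsum])
    qed
    also have "\<dots> = C * w i * exp (K t)"
      using sums_mult[OF expsum, of "C * w i" "K t"] by (simp add: sums_iff)
    finally show ?thesis by (simp add: mult_ac)
  qed
  have "V 0 i = V0 0 i" for i
  proof -
    have "(\<lambda>j. U j 0 i) sums U 0 0 i"
    proof -
      have "U j 0 i = 0" if "j \<notin> {0}" for j
        using that by (cases j) (simp_all add: US)
      from sums_finite[of "{0}", OF _ this] show ?thesis by simp
    qed
    then show ?thesis by (simp add: V_def sums_iff U0)
  qed
  then show ?thesis using that Vder Vbd by blast
qed

text \<open>Inserting the bound of \<open>D\<close> into its own integral equation improves it by
  one factor of the exponential series; repeated indefinitely, the bound tends to 0. Any weight in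
  which \<open>D\<close> is bounded will do, and a larger one than for existence is used
  later.\<close>

lemma weighted_ode_unique:
  fixes A :: "real \<Rightarrow> ('i \<Rightarrow> complex) \<Rightarrow> 'i \<Rightarrow> complex"
  assumes T: "T > 0" and w: "\<And>i. w i \<ge> 0" and C: "C \<ge> 0"
    and cont: "\<And>V i. (\<And>i. continuous_on {0..T} (\<lambda>t. V t i)) \<Longrightarrow> continuous_on {0..T} (\<lambda>t. A t (V t) i)"
    and bd: "\<And>t V M i. t \<in> {0..T} \<Longrightarrow> (\<And>i. norm (V i) \<le> M * w i) \<Longrightarrow> norm (A t V i) \<le> k t * (M * w i)"
    and K: "\<And>t. t \<in> {0..T} \<Longrightarrow> (K has_real_derivative k t) (at t)" "\<And>t. t \<in> {0..T} \<Longrightarrow> 0 \<le> K t"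
    and D: "\<And>t i. t \<in> {0..T} \<Longrightarrow> ((\<lambda>t. D t i) has_vector_derivative A t (D t) i) (at t within {0..T})"
    and D0: "\<And>i. D 0 i = 0" and Dbd: "\<And>t i. t \<in> {0..T} \<Longrightarrow> norm (D t i) \<le> C * w i"
    and t: "t \<in> {0..T}"
  shows "D t i = 0"
proof -
  have Dcont: "continuous_on {0..T} (\<lambda>t. D t i)" for i
    by (rule continuous_on_vector_derivative[where f' = "\<lambda>t. A t (D t) i"]) (rule D)
  have Dj: "norm (D t i) \<le> C * w i * (K t ^ j / fact j)" if "t \<in> {0..T}" for j t i
    using that
  proof (induction j arbitrary: t i)
    case (Suc j)
    have "((\<lambda>s. A s (D s) i) has_integral D t i - D 0 i) {0..t}"
    proof (rule fundamental_theorem_of_calculus)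
      fix s assume "s \<in> {0..t}"
      then show "((\<lambda>t. D t i) has_vector_derivative A s (D s) i) (at s within {0..t})"
        using Suc.prems by (intro has_vector_derivative_within_subset[OF D[of s i]]) auto
    qed (use Suc.prems in auto)
    then have "D t i = integral {0..t} (\<lambda>s. A s (D s) i)" by (simp add: D0 integral_unique)
    also have "norm \<dots> \<le> C * w i * (K t ^ Suc j / fact (Suc j))"
    proof (rule integral_norm_bound_power[OF K _ _ Suc.prems])
      show "continuous_on {0..T} (\<lambda>s. A s (D s) i)" by (rule cont) (rule Dcont)
      fix s assume s: "s \<in> {0..T}"
      have "norm (A s (D s) i) \<le> k s * (C * (K s ^ j / fact j) * w i)"
        using Suc.IH[OF s] by (intro bd s) (simp add: mult_ac)
      then show "norm (A s (D s) i) \<le> k s * (C * w i * (K s ^ j / fact j))" by (simp add: mult_ac)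
    qed (use C w in auto)
    finally show ?case .
  qed (use Dbd in auto)
  have "summable (\<lambda>j. C * w i * (K t ^ j / fact j))"
    using summable_exp[of "K t"] by (intro summable_mult) (simp add: divide_inverse mult.commute)
  then have "(\<lambda>j. C * w i * (K t ^ j / fact j)) \<longlonglongrightarrow> 0" by (rule summable_LIMSEQ_zero)
  then have "norm (D t i) \<le> 0"
    using Dj[OF t] by (intro LIMSEQ_le_const) auto
  then show ?thesis by simp
qed

section \<open>A band-limited mollifier with vanishing moments\<close>

lemma dseq_locally_one:
  assumes "dseq G" "open S" "\<And>x. x \<in> S \<Longrightarrow> G 0 x = 1" "x \<in> S"
  shows "G (Suc k) x = 0"
proof -
  have "dseq (\<lambda>k x. if k = 0 then 1 else 0)" unfolding dseq_def by auto
  from dseq_vanishing_open[OF dseq_diff[OF assms(1) this] assms(2) _ assms(4), of "Suc k"] assms(3)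
  show ?thesis by simp
qed

text \<open>The inverse Fourier integral of \<open>h\<close> over a compact band, without the factor
  \<open>1 / (2 * pi)\<close>. Compactness makes differentiation under the integral and the
  interchange of integrals elementary.\<close>

definition fourier_int :: "real \<Rightarrow> (real \<Rightarrow> complex) \<Rightarrow> real \<Rightarrow> complex"
  where "fourier_int c h x = integral {-c..c} (\<lambda>\<xi>. h \<xi> * cis (x * \<xi>))"

lemma has_vector_derivative_cis:
  "((\<lambda>x. cis (a * x)) has_vector_derivative \<i> * of_real a * cis (a * x)) (at x within S)"
proof -
  have "((\<lambda>z. exp (\<i> * of_real a * z)) has_field_derivative \<i> * of_real a * exp (\<i> * of_real a * of_real x)) (at (of_real x))"
    by (auto intro!: derivative_eq_intros)
  from has_vector_derivative_real_field[OF this] show ?thesis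
    by (simp add: cis_conv_exp mult.assoc)
qed

lemma continuous_on_cis_mult [continuous_intros]:
  fixes f :: "'a::topological_space \<Rightarrow> real"
  shows "continuous_on S f \<Longrightarrow> continuous_on S (\<lambda>x. cis (f x))"
  unfolding cis_conv_exp by (intro continuous_intros)

lemma fourier_int_derivative:
  assumes h: "continuous_on UNIV h"
  shows "(fourier_int c h has_vector_derivative fourier_int c (\<lambda>\<xi>. \<i> * of_real \<xi> * h \<xi>) x) (at x)"
proof -
  have "((\<lambda>x. integral (cbox (-c) c) (\<lambda>\<xi>. h \<xi> * cis (x * \<xi>))) has_vector_derivative
      integral (cbox (-c) c) (\<lambda>\<xi>. h \<xi> * (\<i> * of_real \<xi> * cis (x * \<xi>)))) (at x within UNIV)"
  proof (rule leibniz_rule_vector_derivative)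
    show "((\<lambda>x. h t * cis (x * t)) has_vector_derivative h t * (\<i> * of_real t * cis (x * t))) (at x within UNIV)" for x t
      using has_vector_derivative_cis[of t x UNIV] by (auto simp: mult.commute[of t] intro!: derivative_intros)
    show "(\<lambda>\<xi>. h \<xi> * cis (x * \<xi>)) integrable_on cbox (-c) c" for x
      by (intro integrable_continuous continuous_intros continuous_on_subset[OF h]) auto
    show "continuous_on (UNIV \<times> cbox (-c) c) (\<lambda>(x, t). h t * (\<i> * of_real t * cis (x * t)))"
      unfolding split_beta by (intro continuous_intros continuous_on_compose2[OF h]) auto
  qed auto
  then show ?thesis by (simp add: fourier_int_def[abs_def] mult_ac)
qed

lemma fourier_int_bound:
  assumes "continuous_on UNIV h" "\<And>\<xi>. \<bar>\<xi>\<bar> \<le> c \<Longrightarrow> norm (h \<xi>) \<le> M" "c \<ge> 0"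
  shows "norm (fourier_int c h x) \<le> 2 * c * M"
proof -
  have "norm (integral {-c..c} (\<lambda>\<xi>. h \<xi> * cis (x * \<xi>))) \<le> M * (c - (-c))"
    using assms
    by (intro integral_bound continuous_intros continuous_on_subset[OF assms(1)]) (auto simp: norm_mult abs_le_iff)
  then show ?thesis by (simp add: fourier_int_def mult_ac)
qed

lemma fourier_int_by_parts:
  assumes G: "dseq G" and v: "\<And>\<xi>. \<bar>\<xi>\<bar> \<ge> c \<Longrightarrow> G 0 \<xi> = 0" and c: "c > 0"
  shows "\<i> * of_real x * fourier_int c (G 0) x = - fourier_int c (G 1) x"
proof -
  have cont: "continuous_on S (G k)" for S k by (rule dseq_continuous[OF G])
  have "((\<lambda>\<xi>. G 0 \<xi> * (\<i> * of_real x * cis (x * \<xi>)) + G 1 \<xi> * cis (x * \<xi>)) has_integral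
      G 0 c * cis (x * c) - G 0 (-c) * cis (x * (-c))) {-c..c}"
  proof (rule fundamental_theorem_of_calculus)
    fix \<xi>
    show "((\<lambda>\<xi>. G 0 \<xi> * cis (x * \<xi>)) has_vector_derivative
        G 0 \<xi> * (\<i> * of_real x * cis (x * \<xi>)) + G 1 \<xi> * cis (x * \<xi>)) (at \<xi> within {-c..c})"
      using has_vector_derivative_at_within[OF dseqD[OF G, of 0 \<xi>]] has_vector_derivative_cis[of x \<xi>]
      by (intro has_vector_derivative_mult) auto
  qed (use c in auto)
  then have "integral {-c..c} (\<lambda>\<xi>. G 0 \<xi> * (\<i> * of_real x * cis (x * \<xi>)) + G 1 \<xi> * cis (x * \<xi>)) = 0"
    using v c by (simp add: integral_unique)
  also have "integral {-c..c} (\<lambda>\<xi>. G 0 \<xi> * (\<i> * of_real x * cis (x * \<xi>)) + G 1 \<xi> * cis (x * \<xi>)) =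
      integral {-c..c} (\<lambda>\<xi>. (\<i> * of_real x) * (G 0 \<xi> * cis (x * \<xi>))) + integral {-c..c} (\<lambda>\<xi>. G 1 \<xi> * cis (x * \<xi>))"
    by (subst integral_add[symmetric])
       (auto intro!: integrable_continuous_interval continuous_intros cont integral_cong simp: mult_ac)
  finally show ?thesis by (simp add: fourier_int_def eq_neg_iff_add_eq_0)
qed

text \<open>There are no boundary terms, because \<open>G\<close> vanishes at the ends of the band
  together with its derivatives. Taken in norm the identity gives decay in \<open>x\<close>; taken
  as it stands it gives the moments.\<close>

lemma fourier_int_by_parts_power:
  assumes G: "dseq G" and v: "\<And>\<xi>. \<bar>\<xi>\<bar> > b \<Longrightarrow> G 0 \<xi> = 0" and c: "c > b" "b > 0"
  shows "(\<i> * of_real x) ^ m * fourier_int c (G 0) x = (-1) ^ m * fourier_int c (G m) x"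
proof (induction m)
  case (Suc m)
  have "dseq (\<lambda>j. G (j + m))" using G by (simp add: dseq_def)
  note parts = fourier_int_by_parts[OF this, of c x]
  have "\<i> * of_real x * fourier_int c (G m) x = - fourier_int c (G (Suc m)) x"
  proof -
    have "G m \<xi> = 0" if "\<bar>\<xi>\<bar> \<ge> c" for \<xi>
      using that c by (intro dseq_vanishing[OF G v]) auto
    then show ?thesis using parts c by simp
  qed
  then have "(-1) ^ m * (\<i> * of_real x * fourier_int c (G m) x) = (-1) ^ Suc m * fourier_int c (G (Suc m)) x"
    by simp
  then show ?case using Suc by (simp only: power_Suc mult.assoc mult.left_commute)
qed simp

lemma fourier_int_decay:
  assumes G: "dseq G" and v: "\<And>\<xi>. \<bar>\<xi>\<bar> > b \<Longrightarrow> G 0 \<xi> = 0" and c: "c > b" "b > 0"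
  shows "\<exists>C. \<forall>x. (1 + \<bar>x\<bar>) ^ m * norm (fourier_int c (G 0) x) \<le> C"
proof -
  have bd: "\<exists>C. \<forall>x. \<bar>x\<bar> ^ m * norm (fourier_int c (G 0) x) \<le> C" for m
  proof -
    obtain M where M: "\<And>x. norm (G m x) \<le> M"
      using dseq_bounded[OF G, of b m] v by metis
    have "\<bar>x\<bar> ^ m * norm (fourier_int c (G 0) x) = norm (fourier_int c (G m) x)" for x
      using arg_cong[OF fourier_int_by_parts_power[OF assms, of x m], of norm]
      by (simp add: norm_mult norm_power)
    then show ?thesis
      using fourier_int_bound[OF dseq_continuous[OF G], of c m M] M c by (intro exI[of _ "2 * c * M"]) simp
  qed
  obtain C0 where C0: "\<And>x. norm (fourier_int c (G 0) x) \<le> C0" using bd[of 0] by auto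
  obtain C1 where C1: "\<And>x. \<bar>x\<bar> ^ m * norm (fourier_int c (G 0) x) \<le> C1" using bd by blast
  have "(1 + \<bar>x\<bar>) ^ m * norm (fourier_int c (G 0) x) \<le> 2 ^ m * (C0 + C1)" for x
  proof -
    have nn: "0 \<le> norm (fourier_int c (G 0) x)" "0 \<le> \<bar>x\<bar> ^ m * norm (fourier_int c (G 0) x)" by auto
    have "(1 + \<bar>x\<bar>) ^ m \<le> (2 * max 1 \<bar>x\<bar>) ^ m" by (intro power_mono) auto
    also have "\<dots> \<le> 2 ^ m * (1 + \<bar>x\<bar> ^ m)" by (simp add: power_mult_distrib max_def)
    finally have "(1 + \<bar>x\<bar>) ^ m * norm (fourier_int c (G 0) x) \<le> 2 ^ m * (1 + \<bar>x\<bar> ^ m) * norm (fourier_int c (G 0) x)"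
      by (rule mult_right_mono) simp
    also have "\<dots> = 2 ^ m * (norm (fourier_int c (G 0) x) + \<bar>x\<bar> ^ m * norm (fourier_int c (G 0) x))"
      by (simp add: algebra_simps)
    also have "\<dots> \<le> 2 ^ m * (C0 + C1)" using C0[of x] C1[of x] by (intro mult_left_mono add_mono) auto
    finally show ?thesis .
  qed
  then show ?thesis by blast
qed

lemma integrable_decay2:
  fixes f :: "real \<Rightarrow> complex"
  assumes "continuous_on UNIV f" "\<And>x. (1 + \<bar>x\<bar>) ^ 2 * norm (f x) \<le> C"
  shows "integrable lborel f"
proof (rule Bochner_Integration.integrable_bound)
  show "integrable lborel (\<lambda>x. C * inverse (1 + x\<^sup>2))"
  proof -
    have "set_integrable lborel (einterval (-\<infinity>) \<infinity>) (\<lambda>x. inverse (1 + x\<^sup>2))"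
      by (rule integrable_inverse_1_plus_square)
    then show ?thesis by (simp add: set_integrable_def)
  qed
  show "f \<in> borel_measurable lborel" using assms(1) by (simp add: borel_measurable_continuous_onI)
  show "AE x in lborel. norm (f x) \<le> norm (C * inverse (1 + x\<^sup>2))"
  proof (intro AE_I2)
    fix x :: real
    have C: "C \<ge> 0" using order_trans[OF norm_ge_zero, of "f 0" C] assms(2)[of 0] by simp
    have "(1 + x\<^sup>2) * norm (f x) \<le> (1 + \<bar>x\<bar>) ^ 2 * norm (f x)"
      by (intro mult_right_mono) (simp_all add: power2_sum)
    also have "\<dots> \<le> C" by (rule assms)
    finally have "norm (f x) \<le> C / (1 + x\<^sup>2)"
      using pos_le_divide_eq[of "1 + x\<^sup>2" "norm (f x)" C] by (simp add: add_pos_nonneg mult.commute)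
    then have "norm (f x) \<le> C * inverse (1 + x\<^sup>2)" by (simp only: divide_inverse)
    then show "norm (f x) \<le> norm (C * inverse (1 + x\<^sup>2))" using C by simp
  qed
qed

text \<open>The Dirichlet kernel. Written with \<open>sinc\<close> it includes the frequency
  0.\<close>

lemma integral_cis:
  assumes "A > 0"
  shows "integral {-A..A} (\<lambda>x. cis (x * \<xi>)) = of_real (2 * A * sinc (A * \<xi>))"
proof (cases "\<xi> = 0")
  case True
  then show ?thesis using assms by (simp add: scaleR_conv_of_real)
next
  case False
  have "((\<lambda>x. cis (x * \<xi>)) has_integral cis (\<xi> * A) / (\<i> * of_real \<xi>) - cis (\<xi> * (-A)) / (\<i> * of_real \<xi>)) {-A..A}"
  proof (rule fundamental_theorem_of_calculus)
    fix x
    show "((\<lambda>x. cis (\<xi> * x) / (\<i> * of_real \<xi>)) has_vector_derivative cis (x * \<xi>)) (at x within {-A..A})"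
      using has_vector_derivative_divide[OF has_vector_derivative_cis[of \<xi> x], of "\<i> * of_real \<xi>"] False
      by (simp add: mult.commute)
  qed (use assms in auto)
  then have "integral {-A..A} (\<lambda>x. cis (x * \<xi>)) = (cis (\<xi> * A) - cis (- (\<xi> * A))) / (\<i> * of_real \<xi>)"
    by (simp add: integral_unique diff_divide_distrib)
  also have "cis (\<xi> * A) - cis (- (\<xi> * A)) = 2 * \<i> * of_real (sin (\<xi> * A))"
    by (simp add: complex_eq_iff)
  also have "2 * \<i> * of_real (sin (\<xi> * A)) / (\<i> * of_real \<xi>) = of_real (2 * A * sinc (A * \<xi>))"
    using False assms by (simp add: mult.commute[of A])
  finally show ?thesis .
qed

lemma Si_scaled_tendsto: "(\<lambda>n. Si (real (Suc n) * \<xi>)) \<longlonglongrightarrow> sgn \<xi> * (pi / 2)"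
proof -
  have pos: "(\<lambda>n. Si (real (Suc n) * \<xi>)) \<longlonglongrightarrow> pi / 2" if "\<xi> > 0" for \<xi>
    using that
    by (intro filterlim_compose[OF Si_at_top] filterlim_at_top_mult_tendsto_pos[OF tendsto_const]
        filterlim_compose[OF filterlim_real_sequentially filterlim_Suc]) auto
  consider "\<xi> > 0" | "\<xi> = 0" | "\<xi> < 0" by linarith
  then show ?thesis
  proof cases
    case 3
    have "Si (real (Suc n) * \<xi>) = - Si (real (Suc n) * (-\<xi>))" for n
    proof -
      have "0 \<le> real (Suc n) * (-\<xi>)" using 3 by (intro mult_nonneg_nonneg) auto
      from Si_neg[OF this] show ?thesis by simp
    qed
    then show ?thesis using tendsto_minus[OF pos[of "-\<xi>"]] 3 by simp
  next
    case 2
    have "Si 0 = 0" using Si_neg[of 0] by simp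
    then show ?thesis using 2 by simp
  qed (use pos in simp)
qed

text \<open>Fourier inversion at the origin, through the Dirichlet integral.\<close>

lemma integral_fourier_int:
  assumes G: "dseq G" and v: "\<And>\<xi>. \<bar>\<xi>\<bar> > b \<Longrightarrow> G 0 \<xi> = 0" and c: "c > b" "b > 0"
  shows "integrable lborel (fourier_int c (G 0))" "(LINT x|lborel. fourier_int c (G 0) x) = 2 * of_real pi * G 0 0"
proof -
  let ?E = "fourier_int c (G 0)"
  have cont: "continuous_on S (G k)" for S k by (rule dseq_continuous[OF G])
  have Econt: "continuous_on S ?E" for S
    by (rule continuous_on_subset[of UNIV]) (auto intro!: continuous_on_vector_derivative fourier_int_derivative cont)
  obtain C where C: "\<And>x. (1 + \<bar>x\<bar>) ^ 2 * norm (?E x) \<le> C" using fourier_int_decay[OF assms, of 2] by blast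
  show int: "integrable lborel ?E" using Econt C by (rule integrable_decay2)
  define I where "I n = integral {-real (Suc n)..real (Suc n)} ?E" for n
  have "(\<lambda>n. LINT x|lborel. indicator {-real (Suc n)..real (Suc n)} x *\<^sub>R ?E x) \<longlonglongrightarrow> (LINT x|lborel. ?E x)"
  proof (rule integral_dominated_convergence[where w = "\<lambda>x. norm (?E x)"])
    show "AE x in lborel. (\<lambda>n. indicator {-real (Suc n)..real (Suc n)} x *\<^sub>R ?E x) \<longlonglongrightarrow> ?E x"
    proof (intro AE_I2 tendsto_eventually)
      fix x :: real
      obtain N :: nat where N: "\<bar>x\<bar> \<le> real N" using real_arch_simple by blast
      show "\<forall>\<^sub>F n in sequentially. indicator {-real (Suc n)..real (Suc n)} x *\<^sub>R ?E x = ?E x"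
        using eventually_ge_at_top[of N] by eventually_elim (use N in \<open>auto simp: indicator_def\<close>)
    qed
  qed (use int in \<open>auto simp: indicator_def\<close>)
  moreover have "(LINT x|lborel. indicator {-real (Suc n)..real (Suc n)} x *\<^sub>R ?E x) = I n" for n
  proof -
    have "set_integrable lborel {-real (Suc n)..real (Suc n)} ?E"
      unfolding set_integrable_def by (intro borel_integrable_compact Econt) auto
    from set_borel_integral_eq_integral(2)[OF this] show ?thesis
      by (simp add: I_def set_lebesgue_integral_def)
  qed
  ultimately have lim1: "I \<longlonglongrightarrow> (LINT x|lborel. ?E x)" by simp
  \<comment> \<open>After the interchange of the integrals the inner one is the Dirichlet kernel,
    which is not bounded in \<open>n\<close>. Integration by parts replaces it by its primitive
    \<open>Si\<close>, which is bounded, so that dominated convergence applies.\<close>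
  have I_eq: "I n = -2 * integral {-c..c} (\<lambda>\<xi>. G 1 \<xi> * of_real (Si (real (Suc n) * \<xi>)))" for n
  proof -
    define A where "A = real (Suc n)"
    have A: "A > 0" by (simp add: A_def)
    have "I n = integral (cbox (-A) A) (\<lambda>x. integral (cbox (-c) c) (\<lambda>\<xi>. G 0 \<xi> * cis (x * \<xi>)))"
      by (simp add: I_def A_def fourier_int_def[abs_def])
    also have "\<dots> = integral (cbox (-c) c) (\<lambda>\<xi>. integral (cbox (-A) A) (\<lambda>x. G 0 \<xi> * cis (x * \<xi>)))"
      by (rule integral_swap_continuous) (auto simp: split_beta intro!: continuous_intros continuous_on_compose2[OF cont])
    also have "\<dots> = integral {-c..c} (\<lambda>\<xi>. 2 * (G 0 \<xi> * of_real (A * sinc (A * \<xi>))))"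
    proof -
      have "integral {-A..A} (\<lambda>x. G 0 \<xi> * cis (x * \<xi>)) = 2 * (G 0 \<xi> * of_real (A * sinc (A * \<xi>)))" for \<xi>
        unfolding Henstock_Kurzweil_Integration.integral_mult_right integral_cis[OF A]
        by (simp only: of_real_mult of_real_numeral mult_ac)
      then show ?thesis by (simp only: box_real)
    qed
    also have "\<dots> = 2 * integral {-c..c} (\<lambda>\<xi>. G 0 \<xi> * of_real (A * sinc (A * \<xi>)))" by simp
    also have "integral {-c..c} (\<lambda>\<xi>. G 0 \<xi> * of_real (A * sinc (A * \<xi>))) =
        - integral {-c..c} (\<lambda>\<xi>. G 1 \<xi> * of_real (Si (A * \<xi>)))"
    proof -
      have Sd: "((\<lambda>\<xi>. complex_of_real (Si (A * \<xi>))) has_vector_derivative of_real (A * sinc (A * \<xi>))) (at \<xi> within S)" for \<xi> S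
      proof -
        have "((\<lambda>\<xi>. Si (A * \<xi>)) has_real_derivative sinc (A * \<xi>) * A) (at \<xi> within S)"
          by (rule DERIV_chain2[OF DERIV_Si]) (auto intro!: derivative_eq_intros)
        then show ?thesis
          by (intro has_vector_derivative_of_real) (simp add: has_real_derivative_iff_has_vector_derivative mult.commute)
      qed
      have Sc: "continuous_on S (\<lambda>\<xi>. complex_of_real (Si (A * \<xi>)))" for S
        by (rule continuous_on_vector_derivative) (rule Sd)
      have "((\<lambda>\<xi>. G 0 \<xi> * of_real (A * sinc (A * \<xi>)) + G 1 \<xi> * of_real (Si (A * \<xi>))) has_integral
          G 0 c * of_real (Si (A * c)) - G 0 (-c) * of_real (Si (A * (-c)))) {-c..c}"
      proof (rule fundamental_theorem_of_calculus)
        fix \<xi>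
        show "((\<lambda>\<xi>. G 0 \<xi> * of_real (Si (A * \<xi>))) has_vector_derivative
            G 0 \<xi> * of_real (A * sinc (A * \<xi>)) + G 1 \<xi> * of_real (Si (A * \<xi>))) (at \<xi> within {-c..c})"
          using has_vector_derivative_at_within[OF dseqD[OF G, of 0 \<xi>]] Sd
          by (intro has_vector_derivative_mult) auto
      qed (use c in auto)
      then have "integral {-c..c} (\<lambda>\<xi>. G 0 \<xi> * of_real (A * sinc (A * \<xi>)) + G 1 \<xi> * of_real (Si (A * \<xi>))) = 0"
        using v c by (simp add: integral_unique)
      also have "integral {-c..c} (\<lambda>\<xi>. G 0 \<xi> * of_real (A * sinc (A * \<xi>)) + G 1 \<xi> * of_real (Si (A * \<xi>))) =
          integral {-c..c} (\<lambda>\<xi>. G 0 \<xi> * of_real (A * sinc (A * \<xi>))) + integral {-c..c} (\<lambda>\<xi>. G 1 \<xi> * of_real (Si (A * \<xi>)))"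
      proof (rule Henstock_Kurzweil_Integration.integral_add)
        show "(\<lambda>\<xi>. G 0 \<xi> * of_real (A * sinc (A * \<xi>))) integrable_on {-c..c}"
        proof (intro integrable_continuous_interval continuous_on_mult cont continuous_on_of_real continuous_on_const)
          show "continuous_on {-c..c} (\<lambda>\<xi>. sinc (A * \<xi>))"
            by (rule continuous_on_compose2[of UNIV sinc]) (auto intro!: continuous_intros continuous_at_imp_continuous_on isCont_sinc)
        qed
        show "(\<lambda>\<xi>. G 1 \<xi> * of_real (Si (A * \<xi>))) integrable_on {-c..c}"
          by (intro integrable_continuous_interval continuous_on_mult cont Sc)
      qed
      finally show ?thesis by (simp add: eq_neg_iff_add_eq_0)
    qed
    finally show ?thesis by (simp add: A_def)
  qed
  obtain B where B: "\<And>T. \<bar>Si T\<bar> \<le> B" using bounded_Si by blast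
  obtain M where M: "\<And>x. norm (G 1 x) \<le> M"
    using dseq_bounded[OF G, of b 1] v by metis
  have lim2: "(\<lambda>n. integral {-c..c} (\<lambda>\<xi>. G 1 \<xi> * of_real (Si (real (Suc n) * \<xi>)))) \<longlonglongrightarrow>
      integral {-c..c} (\<lambda>\<xi>. G 1 \<xi> * of_real (sgn \<xi> * (pi / 2)))"
  proof (rule dominated_convergence(2))
    show "(\<lambda>\<xi>. G 1 \<xi> * of_real (Si (real (Suc n) * \<xi>))) integrable_on {-c..c}" for n
    proof (intro integrable_continuous_interval continuous_intros cont)
      have "continuous_on UNIV Si" by (simp add: continuous_at_imp_continuous_on isCont_Si)
      then show "continuous_on {-c..c} (\<lambda>\<xi>. Si (real (Suc n) * \<xi>))"
        by (rule continuous_on_compose2) (auto intro!: continuous_intros)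
    qed
    show "(\<lambda>\<xi>. M * B) integrable_on {-c..c}"
      by (intro integrable_continuous_interval continuous_intros)
    show "norm (G 1 \<xi> * of_real (Si (real (Suc n) * \<xi>))) \<le> M * B" for n \<xi>
      using mult_mono[OF M[of \<xi>] B[of "real (Suc n) * \<xi>"] order_trans[OF norm_ge_zero M[of \<xi>]]] by (simp add: norm_mult)
    show "(\<lambda>n. G 1 \<xi> * of_real (Si (real (Suc n) * \<xi>))) \<longlonglongrightarrow> G 1 \<xi> * of_real (sgn \<xi> * (pi / 2))" for \<xi>
      by (intro tendsto_intros Si_scaled_tendsto)
  qed
  \<comment> \<open>The limit of \<open>Si\<close> is a multiple of the sign function, so the
    integral splits at 0. Each half reduces to values of \<open>G 0\<close> at 0 and at an end of
    the band, where it vanishes.\<close>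
  have half: "(G 1 has_integral G 0 q - G 0 p) {p..q}" if "p \<le> q" for p q
    using that dseqD[OF G, of 0] by (intro fundamental_theorem_of_calculus) (auto intro: has_vector_derivative_at_within)
  have "((\<lambda>\<xi>. G 1 \<xi> * of_real (sgn \<xi> * (pi / 2))) has_integral
      (G 0 0 - G 0 (-c)) * of_real (- (pi / 2)) + (G 0 c - G 0 0) * of_real (pi / 2)) {-c..c}"
  proof (rule has_integral_combine[of "-c" 0 c])
    show "((\<lambda>\<xi>. G 1 \<xi> * of_real (sgn \<xi> * (pi / 2))) has_integral (G 0 0 - G 0 (-c)) * of_real (- (pi / 2))) {-c..0}"
      by (rule has_integral_spike_finite[of "{0}" _ _ "\<lambda>\<xi>. G 1 \<xi> * of_real (- (pi / 2))"])
         (use has_integral_mult_left[OF half[of "-c" 0], of "of_real (- (pi / 2))"] c in \<open>simp_all add: sgn_if\<close>)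
    show "((\<lambda>\<xi>. G 1 \<xi> * of_real (sgn \<xi> * (pi / 2))) has_integral (G 0 c - G 0 0) * of_real (pi / 2)) {0..c}"
      by (rule has_integral_spike_finite[of "{0}" _ _ "\<lambda>\<xi>. G 1 \<xi> * of_real (pi / 2)"])
         (use has_integral_mult_left[OF half[of 0 c], of "of_real (pi / 2)"] c in \<open>simp_all add: sgn_if\<close>)
  qed (use c in auto)
  from integral_unique[OF this]
  have "integral {-c..c} (\<lambda>\<xi>. G 1 \<xi> * of_real (sgn \<xi> * (pi / 2))) =
      (G 0 0 - G 0 (-c)) * of_real (- (pi / 2)) + (G 0 c - G 0 0) * of_real (pi / 2)" .
  also have "\<dots> = - (of_real pi * G 0 0)"
    using v[of c] v[of "-c"] c by simp
  finally have "integral {-c..c} (\<lambda>\<xi>. G 1 \<xi> * of_real (sgn \<xi> * (pi / 2))) = - (of_real pi * G 0 0)" .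
  then have "I \<longlonglongrightarrow> -2 * (- (of_real pi * G 0 0))"
    using tendsto_mult[OF tendsto_const[of "-2"] lim2] by (simp add: I_eq[abs_def])
  with lim1 have "(LINT x|lborel. ?E x) = -2 * (- (of_real pi * G 0 0))" by (rule LIMSEQ_unique)
  then show "(LINT x|lborel. ?E x) = 2 * of_real pi * G 0 0" by simp
qed

lemma smooth_i_times: "smooth (\<lambda>\<xi>::real. \<i> * of_real \<xi>)"
proof -
  define I where "I k \<xi> = (if k = 0 then \<i> * of_real \<xi> else if k = 1 then \<i> else 0)" for k :: nat and \<xi> :: real
  have "(I k has_vector_derivative I (Suc k) x) (at x)" for k x
  proof (cases "k = 0")
    case True
    have "((\<lambda>\<xi>. \<i> * of_real \<xi>) has_vector_derivative \<i> * of_real 1) (at x)"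
      by (intro has_vector_derivative_mult_right has_vector_derivative_of_real)
         (simp flip: has_real_derivative_iff_has_vector_derivative)
    then show ?thesis using True by (simp add: I_def[abs_def])
  next
    case False
    then show ?thesis by (cases "k = 1") (simp_all add: I_def[abs_def])
  qed
  then have "dseq I" by (simp add: dseq_def)
  then show ?thesis unfolding smooth_real_iff by (intro exI[of _ I]) (simp add: I_def[abs_def])
qed

text \<open>The inverse Fourier transform of a plateau function. Its moments are, up to constants,
  the derivatives of the plateau at the origin: the value there is 1, and all derivatives vanish
  because the plateau is flat near 0. The compact band bounds the \<open>k\<close>-th derivative by
  a constant times \<open>B ^ k\<close>, which no mollifier of compact support can achieve.\<close>

lemma band_limited_mollifier_real:
  assumes "mollifier1 (\<psi> :: real \<Rightarrow> complex)"
  obtains \<Phi> B C where "dseq \<Phi>" "B \<ge> 1" "C > 0" "\<And>k x. norm (\<Phi> k x) \<le> C * B ^ k"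
    "\<And>k m. \<exists>C. \<forall>x. (1 + \<bar>x\<bar>) ^ m * norm (\<Phi> k x) \<le> C"
    "(LINT x|lborel. \<Phi> 0 x) = 1"
    "\<And>k. integrable lborel (\<lambda>x. of_real (x ^ k) * \<Phi> 0 x)"
    "\<And>k. k > 0 \<Longrightarrow> (LINT x|lborel. of_real (x ^ k) * \<Phi> 0 x) = 0"
proof -
  obtain Z b where Z: "dseq Z" "b > 0" "\<And>x. \<bar>x\<bar> > b \<Longrightarrow> Z 0 x = 0" "\<And>x. \<bar>x\<bar> < 1 \<Longrightarrow> Z 0 x = 1"
    "\<And>x. Z 0 x \<in> \<real>\<^sub>\<ge>\<^sub>0"
    by (rule plateau_function[OF assms zero_le_one]) (rule that)
  \<comment> \<open>Strictly larger than \<open>b\<close>, so that everything vanishes at the ends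
    of the band, and at least 1, so that it can serve as \<open>B\<close>.\<close>
  define c where "c = b + 1"
  have c: "c > b" "c \<ge> 1" using Z(2) by (auto simp: c_def)
  define H where "H k \<xi> = (\<i> * of_real \<xi>) ^ k * Z 0 \<xi>" for k \<xi>
  have H0: "H 0 = Z 0" and HS: "H (Suc k) = (\<lambda>\<xi>. \<i> * of_real \<xi> * H k \<xi>)" for k
    by (auto simp: H_def mult_ac)
  have sm: "smooth (H k)" for k
  proof (induction k)
    case 0
    show ?case unfolding H0 smooth_real_iff using Z(1) by (intro exI[of _ Z]) simp
  next
    case (Suc k)
    then show ?case unfolding HS by (intro smooth_real_mult smooth_i_times)
  qed
  have Hv: "H k \<xi> = 0" if "\<bar>\<xi>\<bar> > b" for k \<xi> using Z(3)[OF that] by (simp add: H_def)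
  have Hc: "continuous_on S (H k)" for k S
  proof -
    obtain G where "dseq G" "G 0 = H k" using sm[of k, unfolded smooth_real_iff] by (elim exE conjE)
    with dseq_continuous[of G S 0] show ?thesis by simp
  qed
  define \<Phi> where "\<Phi> k x = of_real (1 / (2 * pi)) * fourier_int c (H k) x" for k x
  have d: "dseq \<Phi>" unfolding dseq_def \<Phi>_def[abs_def]
    using fourier_int_derivative[OF Hc] by (intro allI has_vector_derivative_mult_right) (simp add: HS)
  obtain M where M: "M > 0" "\<And>x. norm (Z 0 x) \<le> M"
    by (rule dseq_bounded[OF Z(1), of b 0]) (rule Z(3), assumption, rule that)
  have bd: "norm (\<Phi> k x) \<le> (2 * c * M) * c ^ k" for k x
  proof -
    have "norm (fourier_int c (H k) x) \<le> 2 * c * (c ^ k * M)"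
    proof (rule fourier_int_bound[OF Hc])
      fix \<xi> :: real assume "\<bar>\<xi>\<bar> \<le> c"
      then show "norm (H k \<xi>) \<le> c ^ k * M"
        using M(2)[of \<xi>] c by (auto simp: H_def norm_mult norm_power intro!: mult_mono power_mono)
    qed (use c in auto)
    moreover have "norm (\<Phi> k x) \<le> norm (fourier_int c (H k) x)"
    proof -
      have "1 / (2 * pi) \<le> 1" using pi_gt3 by simp
      from mult_right_mono[OF this norm_ge_zero] show ?thesis by (simp add: \<Phi>_def norm_mult norm_divide)
    qed
    ultimately show ?thesis by (simp add: mult_ac)
  qed
  have decay: "\<exists>C. \<forall>x. (1 + \<bar>x\<bar>) ^ m * norm (\<Phi> k x) \<le> C" for k m
  proof -
    obtain G where G: "dseq G" "G 0 = H k" using sm[of k, unfolded smooth_real_iff] by (elim exE conjE)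
    have "G 0 \<xi> = 0" if "\<bar>\<xi>\<bar> > b" for \<xi> using Hv[OF that] G(2) by simp
    from fourier_int_decay[OF G(1) this c(1) Z(2), of m]
    obtain C where C: "\<And>x. (1 + \<bar>x\<bar>) ^ m * norm (fourier_int c (G 0) x) \<le> C" by blast
    have "(1 + \<bar>x\<bar>) ^ m * norm (\<Phi> k x) \<le> (1 / (2 * pi)) * C" for x
      using mult_left_mono[OF C[of x], of "1 / (2 * pi)"] G(2)
      by (simp add: \<Phi>_def norm_mult norm_divide mult_ac)
    then show ?thesis by blast
  qed
  \<comment> \<open>Multiplication by \<open>x ^ k\<close> is, up to a constant, differentiation of
    the plateau. The moments thus become integrals of Fourier integrals, which inversion at the
    origin evaluates.\<close>
  have moment: "of_real (x ^ k) * \<Phi> 0 x = (of_real (1 / (2 * pi)) * ((-1) ^ k / \<i> ^ k)) * fourier_int c (Z k) x" for k x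
  proof -
    have "(\<i> * of_real x) ^ k * fourier_int c (Z 0) x = (-1) ^ k * fourier_int c (Z k) x"
      by (rule fourier_int_by_parts_power[OF Z(1) Z(3) c(1) Z(2)])
    then have "of_real (x ^ k) * fourier_int c (Z 0) x = ((-1) ^ k / \<i> ^ k) * fourier_int c (Z k) x"
      by (simp add: power_mult_distrib field_simps)
    then show ?thesis by (simp add: \<Phi>_def H0 mult.left_commute mult.assoc)
  qed
  have Zsh: "dseq (\<lambda>j. Z (j + k))" for k using Z(1) by (simp add: dseq_def)
  have Zv: "Z k x = 0" if "\<bar>x\<bar> > b" for k x using dseq_vanishing[OF Z(1) Z(3) that] by simp
  have Zint: "integrable lborel (fourier_int c (Z k))" "(LINT x|lborel. fourier_int c (Z k) x) = 2 * of_real pi * Z k 0" for k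
    using integral_fourier_int[OF Zsh _ c(1) Z(2), of k] Zv by simp_all
  have Z0: "Z k 0 = (if k = 0 then 1 else 0)" for k
  proof (cases k)
    case (Suc j)
    have "Z (Suc j) 0 = 0"
      by (rule dseq_locally_one[OF Z(1), of "{-1<..<1}"]) (auto intro!: Z(4))
    then show ?thesis using Suc by simp
  qed (simp add: Z(4))
  have mom: "(LINT x|lborel. of_real (x ^ k) * \<Phi> 0 x) = (if k = 0 then 1 else 0)" for k
    unfolding moment by (simp add: Zint Z0)
  show ?thesis
  proof (rule that[of \<Phi> c "2 * c * M"])
    show "integrable lborel (\<lambda>x. of_real (x ^ k) * \<Phi> 0 x)" for k
      unfolding moment by (intro integrable_mult_right Zint)
    show "(LINT x|lborel. \<Phi> 0 x) = 1" using mom[of 0] by simp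
  qed (use d bd decay mom c M in auto)
qed

section \<open>Functions of exponential type\<close>

text \<open>A family indexed by words in the coordinate directions: \<open>D l\<close> is the derivative of \<open>D []\<close>
  along the word \<open>l\<close>.\<close>

definition dfam :: "('n::finite list \<Rightarrow> real ^ 'n \<Rightarrow> complex) \<Rightarrow> bool"
  where "dfam D \<longleftrightarrow> (\<forall>l x. (D l has_derivative (\<lambda>h. \<Sum>i\<in>UNIV. (h $ i) *\<^sub>R D (i # l) x)) (at x))"

lemma dfamD: "dfam D \<Longrightarrow> (D l has_derivative (\<lambda>h. \<Sum>i\<in>UNIV. (h $ i) *\<^sub>R D (i # l) x)) (at x)"
  by (simp add: dfam_def)

lemma sum_axis_scaleR: "(\<Sum>j\<in>UNIV. (axis i (1::real) $ j) *\<^sub>R f j) = (f i :: 'b::real_vector)" for i :: "'n::finite"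
proof -
  have "(\<Sum>j\<in>UNIV. (axis i (1::real) $ j) *\<^sub>R f j) = (\<Sum>j\<in>UNIV. if j = i then f j else 0)"
    by (intro sum.cong) (auto simp: axis_def)
  then show ?thesis by simp
qed

lemma pd_axis_dfam:
  assumes "dfam D"
  shows "pd (axis i 1) (D l) x = D (i # l) x"
proof -
  have "((\<lambda>h. D l (x + h *\<^sub>R axis i 1)) has_derivative (\<lambda>h. \<Sum>j\<in>UNIV. ((h *\<^sub>R axis i 1) $ j) *\<^sub>R D (j # l) (x + 0 *\<^sub>R axis i 1))) (at 0)"
    by (rule has_derivative_compose[of "\<lambda>h. x + h *\<^sub>R axis i 1" "\<lambda>h. h *\<^sub>R axis i 1" 0 UNIV "D l"])
       (use dfamD[OF assms] in \<open>auto intro!: derivative_eq_intros\<close>)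
  moreover have "(\<Sum>j\<in>UNIV. ((h *\<^sub>R axis i 1) $ j) *\<^sub>R D (j # l) x) = h *\<^sub>R D (i # l) x" for h :: real
  proof -
    have "(\<Sum>j\<in>UNIV. ((h *\<^sub>R axis i 1) $ j) *\<^sub>R D (j # l) x) = h *\<^sub>R (\<Sum>j\<in>UNIV. (axis i (1::real) $ j) *\<^sub>R D (j # l) x)"
      by (simp add: scaleR_sum_right)
    then show ?thesis by (simp only: sum_axis_scaleR)
  qed
  ultimately have "((\<lambda>h. D l (x + h *\<^sub>R axis i 1)) has_vector_derivative D (i # l) x) (at 0)"
    by (simp add: has_vector_derivative_def)
  then show ?thesis unfolding pd_def by (rule vector_derivative_at)
qed

lemma foldr_pd_dfam:
  assumes "dfam D"
  shows "foldr pd (map (\<lambda>i. axis i 1) l) (D []) = D l"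
proof (induction l)
  case (Cons i l)
  have "pd (axis i 1) (D l) = D (i # l)" by (rule ext) (rule pd_axis_dfam[OF assms])
  then show ?case by (simp add: Cons)
qed simp

lemma words_from_Basis:
  assumes "set bs \<subseteq> (Basis :: (real ^ 'n::finite) set)"
  shows "bs = map (\<lambda>i. axis i 1) (map axis_index bs)"
proof -
  have "axis (axis_index b) 1 = b" if "b \<in> set bs" for b
    by (rule axis_index[symmetric]) (use assms that in blast)
  then show ?thesis by (simp add: map_idI o_def)
qed

lemma dfam_smooth:
  assumes "dfam D"
  shows "smooth (D [])"
  unfolding smooth_def
proof (intro allI impI)
  fix bs :: "(real ^ 'a) list" assume "set bs \<subseteq> Basis"
  from words_from_Basis[OF this] have "foldr pd bs (D []) = foldr pd (map (\<lambda>i. axis i 1) (map axis_index bs)) (D [])"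
    by (rule arg_cong)
  also have "\<dots> = D (map axis_index bs)" by (rule foldr_pd_dfam[OF assms])
  finally have "foldr pd bs (D []) = D (map axis_index bs)" .
  moreover have "D l differentiable_on UNIV" for l
    using dfamD[OF assms] unfolding differentiable_on_def differentiable_def by auto
  ultimately show "foldr pd bs (D []) differentiable_on UNIV" by simp
qed

text \<open>The coordinates are listed in exactly the order in which \<open>mdiff\<close>
  differentiates, so that \<open>mdiff\<close> of a family is one of its members.\<close>

definition word :: "(real ^ 'n::finite \<Rightarrow> nat) \<Rightarrow> 'n list"
  where "word \<alpha> = map axis_index (concat (map (\<lambda>b. replicate (\<alpha> b) b) basis_list))"

lemma foldr_funpow_replicate:
  "foldr (\<lambda>b. f b ^^ \<alpha> b) bs g = foldr f (concat (map (\<lambda>b. replicate (\<alpha> b) b) bs)) g"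
proof -
  have "foldr f (replicate k b) = f b ^^ k" for k b
    by (induction k) auto
  then show ?thesis by (induction bs) auto
qed

lemma mdiff_dfam:
  assumes "dfam D"
  shows "mdiff \<alpha> (D []) = D (word \<alpha>)"
proof -
  let ?bs = "concat (map (\<lambda>b. replicate (\<alpha> b) b) basis_list)"
  have "set ?bs \<subseteq> set basis_list" by auto
  then have "set ?bs \<subseteq> Basis" using basis_list_works by blast
  from words_from_Basis[OF this] have "foldr pd ?bs (D []) = foldr pd (map (\<lambda>i. axis i 1) (map axis_index ?bs)) (D [])"
    by (rule arg_cong)
  also have "\<dots> = D (word \<alpha>)" unfolding word_def by (rule foldr_pd_dfam[OF assms])
  finally show ?thesis unfolding mdiff_def foldr_funpow_replicate .
qed

lemma length_word: "length (word \<alpha>) = mlen (\<alpha> :: real ^ 'n::finite \<Rightarrow> nat)"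
proof -
  have "length (word \<alpha>) = (\<Sum>b\<leftarrow>basis_list. \<alpha> b)"
    by (simp add: word_def length_concat o_def)
  also have "\<dots> = mlen \<alpha>"
    unfolding mlen_def using basis_list_works[where 'a="real ^ 'n"] by (simp add: sum_list_distinct_conv_sum_set)
  finally show ?thesis .
qed

text \<open>Bounds linear in the family, hence stable under superposition: values and first-order
  Taylor remainders.\<close>

definition etype :: "real \<Rightarrow> real \<Rightarrow> ('n::finite list \<Rightarrow> real ^ 'n \<Rightarrow> complex) \<Rightarrow> bool"
  where "etype M X D \<longleftrightarrow> (\<forall>l x. norm (D l x) \<le> M * X ^ length l) \<and>
    (\<forall>l x h. norm (D l (x + h) - D l x - (\<Sum>i\<in>UNIV. (h $ i) *\<^sub>R D (i # l) x))
       \<le> M * (real CARD('n) ^ 2 * X ^ (length l + 2) * norm h ^ 2))"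

lemma etype_bound: "etype M X D \<Longrightarrow> norm (D l x) \<le> M * X ^ length l"
  by (simp add: etype_def)

lemma etype_remainder:
  "etype M X D \<Longrightarrow> norm (D l (x + h) - D l x - (\<Sum>i\<in>UNIV. (h $ i) *\<^sub>R D (i # l) x))
    \<le> M * (real CARD('n) ^ 2 * X ^ (length l + 2) * norm h ^ 2)"
  for D :: "'n::finite list \<Rightarrow> real ^ 'n \<Rightarrow> complex"
  by (simp add: etype_def)

lemma bounded_linear_sum_component: "bounded_linear (\<lambda>h :: real ^ 'n. \<Sum>i\<in>UNIV. (h $ i) *\<^sub>R (f i :: complex))"
  by (intro bounded_linear_sum bounded_linear_scaleR_left[THEN bounded_linear_compose] bounded_linear_vec_nth)

lemma norm_sum_component_le:
  assumes "\<And>i. norm (f i) \<le> c"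
  shows "norm (\<Sum>i\<in>UNIV. (h $ i) *\<^sub>R (f i :: complex)) \<le> (real CARD('n) * c) * norm (h :: real ^ 'n::finite)"
proof -
  have "norm (\<Sum>i\<in>UNIV. (h $ i) *\<^sub>R f i) \<le> (\<Sum>i\<in>(UNIV :: 'n set). norm h * c)"
    by (rule order_trans[OF norm_sum sum_mono]) (auto intro!: mult_mono component_le_norm_cart assms)
  then show ?thesis by (simp add: mult_ac)
qed

text \<open>The remainder estimate alone makes the \<open>D (i # l)\<close> the partial derivatives
  of \<open>D l\<close>; this is why remainders are part of \<open>etype\<close>.\<close>

lemma etype_dfam:
  assumes "etype M X D"
  shows "dfam D"
  unfolding dfam_def
proof (intro allI has_derivative_quadratic_remainder bounded_linear_sum_component)
  fix l x and h :: "real ^ 'a"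
  show "norm (D l (x + h) - D l x - (\<Sum>i\<in>UNIV. (h $ i) *\<^sub>R D (i # l) x))
       \<le> (M * (real CARD('a) ^ 2 * X ^ (length l + 2))) * (norm h)\<^sup>2"
    using etype_remainder[OF assms, of l x h] by (simp add: mult.assoc)
qed

lemma etype_nonneg: "etype M X D \<Longrightarrow> 0 \<le> M"
  using order_trans[OF norm_ge_zero etype_bound[of M X D "[]"]] by simp

text \<open>The mean value inequality is applied to the components of the gradient and then to the
  function itself. Each application sums over the coordinates and costs a factor
  \<open>CARD('n)\<close>, which explains the square in \<open>etype\<close>.\<close>

lemma dfam_etype:
  fixes D :: "'n::finite list \<Rightarrow> real ^ 'n \<Rightarrow> complex"
  assumes D: "dfam D" and bd: "\<And>l x. norm (D l x) \<le> M * X ^ length l"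
  shows "etype M X D"
  unfolding etype_def
proof (intro conjI allI bd)
  fix l :: "'n list" and x h :: "real ^ 'n"
  let ?B = "real CARD('n) * (M * X ^ (length l + 2))"
  have B: "?B \<ge> 0"
    using order_trans[OF norm_ge_zero bd[of "undefined # undefined # l" x]] by simp
  have lip: "norm (D (i # l) y - D (i # l) x) \<le> ?B * norm h" if "y \<in> cball x (norm h)" for i y
  proof -
    have "norm (D (i # l) y - D (i # l) x) \<le> ?B * norm (y - x)"
    proof (rule differentiable_bound[of UNIV _ "\<lambda>y h. \<Sum>j\<in>UNIV. (h $ j) *\<^sub>R D (j # i # l) y"])
      show "onorm (\<lambda>h. \<Sum>j\<in>UNIV. (h $ j) *\<^sub>R D (j # i # l) y) \<le> ?B" for y
        by (intro onorm_le norm_sum_component_le) (use bd[of "_ # i # l" y] in simp)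
    qed (use dfamD[OF D] in auto)
    also have "\<dots> \<le> ?B * norm h" using that B by (intro mult_left_mono) (auto simp: dist_norm norm_minus_commute)
    finally show ?thesis .
  qed
  have "norm (D l (x + h) - D l x - (\<Sum>i\<in>UNIV. ((x + h - x) $ i) *\<^sub>R D (i # l) x))
      \<le> norm (x + h - x) * (real CARD('n) * (?B * norm h))"
  proof (rule differentiable_bound_linearization[of x "x + h" "cball x (norm h)" _ "\<lambda>y h. \<Sum>j\<in>UNIV. (h $ j) *\<^sub>R D (j # l) y"])
    show "x + t *\<^sub>R (x + h - x) \<in> cball x (norm h)" if "t \<in> {0..1}" for t
      using that by (auto simp: dist_norm intro!: mult_left_le_one_le)
    show "(D l has_derivative (\<lambda>h. \<Sum>j\<in>UNIV. (h $ j) *\<^sub>R D (j # l) y)) (at y within cball x (norm h))" for y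
      by (rule has_derivative_at_withinI[OF dfamD[OF D]])
    show "onorm ((\<lambda>v. \<Sum>j\<in>UNIV. (v $ j) *\<^sub>R D (j # l) y) - (\<lambda>v. \<Sum>j\<in>UNIV. (v $ j) *\<^sub>R D (j # l) x)) \<le> real CARD('n) * (?B * norm h)"
      if "y \<in> cball x (norm h)" for y
      unfolding fun_diff_def sum_subtractf[symmetric] scaleR_diff_right[symmetric]
      by (intro onorm_le norm_sum_component_le lip that)
  qed auto
  then show "norm (D l (x + h) - D l x - (\<Sum>i\<in>UNIV. (h $ i) *\<^sub>R D (i # l) x))
       \<le> M * (real CARD('n) ^ 2 * X ^ (length l + 2) * norm h ^ 2)"
    by (simp add: power2_eq_square mult_ac)
qed

section \<open>Tensor powers of a function of one variable\<close>

lemma prod_Basis_cart: "(\<Prod>b\<in>Basis. f (b :: real ^ 'n::finite)) = (\<Prod>i\<in>UNIV. f (axis i 1))"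
proof -
  have "Basis = range (\<lambda>i::'n. axis i (1::real))" by (auto simp: Basis_vec_def)
  moreover have "inj (\<lambda>i::'n. axis i (1::real))" by (auto simp: inj_on_def axis_eq_axis)
  ultimately show ?thesis using prod.reindex[of "\<lambda>i::'n. axis i (1::real)" UNIV f] by (simp add: o_def)
qed

text \<open>The tensor power of \<open>\<Phi> 0\<close> with all its partial derivatives: a
  coordinate is differentiated as often as it occurs in the word.\<close>

definition tensor :: "(nat \<Rightarrow> real \<Rightarrow> complex) \<Rightarrow> 'n::finite list \<Rightarrow> real ^ 'n \<Rightarrow> complex"
  where "tensor \<Phi> l x = (\<Prod>i\<in>UNIV. \<Phi> (count_list l i) (x $ i))"

lemma tensor_dfam:
  assumes "dseq \<Phi>"
  shows "dfam (tensor \<Phi>)"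
  unfolding dfam_def
proof (intro allI)
  fix l and x :: "real ^ 'a"
  have "((\<lambda>x. \<Prod>i\<in>UNIV. \<Phi> (count_list l i) (x $ i)) has_derivative
      (\<lambda>h. \<Sum>i\<in>UNIV. ((h $ i) *\<^sub>R \<Phi> (Suc (count_list l i)) (x $ i)) * (\<Prod>j\<in>UNIV - {i}. \<Phi> (count_list l j) (x $ j)))) (at x)"
  proof (rule has_derivative_prod)
    fix i :: 'a
    show "((\<lambda>x. \<Phi> (count_list l i) (x $ i)) has_derivative (\<lambda>h. (h $ i) *\<^sub>R \<Phi> (Suc (count_list l i)) (x $ i))) (at x)"
      by (rule has_derivative_compose[of "\<lambda>x. x $ i" "\<lambda>h. h $ i" x UNIV "\<Phi> (count_list l i)" "\<lambda>h. h *\<^sub>R \<Phi> (Suc (count_list l i)) (x $ i)"])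
         (use dseqD[OF assms] in \<open>auto simp: has_vector_derivative_def intro: bounded_linear_imp_has_derivative bounded_linear_vec_nth\<close>)
  qed
  moreover have "tensor \<Phi> (i # l) x = \<Phi> (Suc (count_list l i)) (x $ i) * (\<Prod>j\<in>UNIV - {i}. \<Phi> (count_list l j) (x $ j))" for i
  proof -
    have "tensor \<Phi> (i # l) x = \<Phi> (count_list (i # l) i) (x $ i) * (\<Prod>j\<in>UNIV - {i}. \<Phi> (count_list (i # l) j) (x $ j))"
      unfolding tensor_def by (rule prod.remove) auto
    also have "(\<Prod>j\<in>UNIV - {i}. \<Phi> (count_list (i # l) j) (x $ j)) = (\<Prod>j\<in>UNIV - {i}. \<Phi> (count_list l j) (x $ j))"
      by (intro prod.cong) auto
    finally show ?thesis by simp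
  qed
  ultimately show "(tensor \<Phi> l has_derivative (\<lambda>h. \<Sum>i\<in>UNIV. (h $ i) *\<^sub>R tensor \<Phi> (i # l) x)) (at x)"
    by (simp add: tensor_def[of \<Phi> l, abs_def])
qed

lemma tensor_bound:
  assumes "\<And>k x. norm (\<Phi> k x) \<le> C * B ^ k"
  shows "norm (tensor \<Phi> l (x :: real ^ 'n::finite)) \<le> C ^ CARD('n) * B ^ length l"
proof -
  have "norm (tensor \<Phi> l x) = (\<Prod>i\<in>UNIV. norm (\<Phi> (count_list l i) (x $ i)))"
    by (simp add: tensor_def prod_norm)
  also have "\<dots> \<le> (\<Prod>i\<in>(UNIV :: 'n set). C * B ^ count_list l i)"
    by (intro prod_mono conjI assms norm_ge_zero)
  also have "\<dots> = C ^ CARD('n) * B ^ (\<Sum>i\<in>UNIV. count_list l i)"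
    by (simp add: prod.distrib power_sum)
  also have "(\<Sum>i\<in>UNIV. count_list l i) = length l" by (rule sum_count_set) auto
  finally show ?thesis .
qed

text \<open>Serves to dominate \<open>1 + norm x\<close> by a product of one-dimensional weights, so
  that the decay of a tensor product can be checked factor by factor.\<close>

lemma one_plus_sum_le_prod:
  assumes "finite I" "\<And>i. i \<in> I \<Longrightarrow> 0 \<le> f i"
  shows "1 + (\<Sum>i\<in>I. f i) \<le> (\<Prod>i\<in>I. 1 + f i :: real)"
  using assms
proof (induction I rule: finite_induct)
  case (insert i I)
  then have 1: "1 + (\<Sum>i\<in>I. f i) \<le> (\<Prod>i\<in>I. 1 + f i)" and nn: "0 \<le> (\<Sum>i\<in>I. f i)" "0 \<le> f i"
    by (auto intro: sum_nonneg)
  have "1 + (\<Sum>i\<in>insert i I. f i) \<le> (1 + f i) * (1 + (\<Sum>i\<in>I. f i))"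
    using insert.hyps nn by (simp add: algebra_simps)
  also have "\<dots> \<le> (1 + f i) * (\<Prod>i\<in>I. 1 + f i)" using 1 nn by (intro mult_left_mono) auto
  finally show ?case using insert.hyps by simp
qed simp

text \<open>Lebesgue measure on a Euclidean space is the image of a product measure under the
  coordinate representation, so this is Fubini's theorem for products.\<close>

lemma integral_prod_lborel:
  fixes F :: "'a::euclidean_space \<Rightarrow> real \<Rightarrow> complex"
  assumes F: "\<And>b. b \<in> Basis \<Longrightarrow> integrable lborel (F b)"
  shows "(LINT x|lborel. (\<Prod>b\<in>Basis. F b (x \<bullet> b))) = (\<Prod>b\<in>Basis. (LINT y|lborel. F b y))"
proof -
  interpret product_sigma_finite "\<lambda>_::'a. lborel :: real measure" ..
  have [measurable]: "F b \<in> borel_measurable borel" if "b \<in> Basis" for b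
    using borel_measurable_integrable[OF F[OF that]] by simp
  have meas: "(\<lambda>x. \<Prod>b\<in>Basis. F b (x \<bullet> b)) \<in> borel_measurable borel"
    by (intro borel_measurable_prod) measurable
  have "(LINT x|lborel. (\<Prod>b\<in>Basis. F b (x \<bullet> b))) =
      (LINT f|(\<Pi>\<^sub>M b\<in>Basis. lborel). (\<Prod>b\<in>Basis. F b ((\<Sum>c\<in>Basis. f c *\<^sub>R c) \<bullet> b)))"
    unfolding lborel_eq[where 'a='a] by (subst integral_distr) (auto simp: meas)
  also have "\<dots> = (LINT f|(\<Pi>\<^sub>M b\<in>Basis. lborel). (\<Prod>b\<in>Basis. F b (f b)))"
    by (intro Bochner_Integration.integral_cong prod.cong) auto
  also have "\<dots> = (\<Prod>b\<in>Basis. (LINT y|lborel. F b y))"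
    by (rule product_integral_prod) (auto intro: F)
  finally show ?thesis .
qed

text \<open>Decay, normalisation and moments all factor over the coordinates. A nonzero multi-index
  has a positive entry, and the factor belonging to it is a vanishing one-dimensional
  moment.\<close>

lemma tensor_mollifier2:
  assumes d: "dseq \<Phi>" and decay: "\<And>k m. \<exists>C. \<forall>x. (1 + \<bar>x\<bar>) ^ m * norm (\<Phi> k x) \<le> C"
    and int1: "(LINT x|lborel. \<Phi> 0 x) = 1"
    and int: "\<And>k. integrable lborel (\<lambda>x. of_real (x ^ k) * \<Phi> 0 x)"
    and mom: "\<And>k. k > 0 \<Longrightarrow> (LINT x|lborel. of_real (x ^ k) * \<Phi> 0 x) = 0"
  shows "mollifier2 (tensor \<Phi> [] :: real ^ 'n::finite \<Rightarrow> complex)"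
  unfolding mollifier2_def schwartz_def
proof (intro conjI allI impI)
  note D = tensor_dfam[OF d, where 'a = 'n]
  show "smooth (tensor \<Phi> [] :: real ^ 'n \<Rightarrow> complex)" by (rule dfam_smooth[OF D])
  show "\<exists>C. \<forall>x::real ^ 'n. (1 + norm x) ^ m * norm (mdiff \<alpha> (tensor \<Phi> []) x) \<le> C" for \<alpha> m
  proof -
    let ?l = "word \<alpha> :: 'n list"
    obtain C where C: "\<And>k x. (1 + \<bar>x\<bar>) ^ m * norm (\<Phi> k x) \<le> C k"
      using decay[of m] by metis
    have "(1 + norm x) ^ m * norm (tensor \<Phi> ?l x) \<le> (\<Prod>i\<in>UNIV. C (count_list ?l i))" for x :: "real ^ 'n"
    proof -
      have "1 + norm x \<le> 1 + (\<Sum>i\<in>UNIV. \<bar>x $ i\<bar>)" using norm_le_l1_cart[of x] by simp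
      also have "\<dots> \<le> (\<Prod>i\<in>UNIV. 1 + \<bar>x $ i\<bar>)" by (rule one_plus_sum_le_prod) auto
      finally have "(1 + norm x) ^ m \<le> (\<Prod>i\<in>UNIV. 1 + \<bar>x $ i\<bar>) ^ m" by (intro power_mono) auto
      then have "(1 + norm x) ^ m * norm (tensor \<Phi> ?l x) \<le> (\<Prod>i\<in>UNIV. 1 + \<bar>x $ i\<bar>) ^ m * norm (tensor \<Phi> ?l x)"
        by (rule mult_right_mono) simp
      also have "\<dots> = (\<Prod>i\<in>UNIV. (1 + \<bar>x $ i\<bar>) ^ m * norm (\<Phi> (count_list ?l i) (x $ i)))"
        by (simp add: tensor_def prod.distrib prod_power_distrib prod_norm)
      also have "\<dots> \<le> (\<Prod>i\<in>UNIV. C (count_list ?l i))" by (intro prod_mono conjI C) auto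
      finally show ?thesis .
    qed
    then show ?thesis unfolding mdiff_dfam[OF D] by blast
  qed
  have moment: "(LINT x|lborel. of_real (monomial \<alpha> x) * tensor \<Phi> [] (x :: real ^ 'n)) =
      (\<Prod>b\<in>Basis. (LINT y|lborel. of_real (y ^ \<alpha> b) * \<Phi> 0 y))" for \<alpha>
  proof -
    have "of_real (monomial \<alpha> x) * tensor \<Phi> [] x = (\<Prod>b\<in>Basis. of_real ((x \<bullet> b) ^ \<alpha> b) * \<Phi> 0 (x \<bullet> b))" for x :: "real ^ 'n"
      by (simp add: monomial_def tensor_def prod.distrib prod_Basis_cart[of "\<lambda>b. \<Phi> 0 (x \<bullet> b)"] inner_axis of_real_prod)
    then show ?thesis using integral_prod_lborel[of "\<lambda>b y. of_real (y ^ \<alpha> b) * \<Phi> 0 y"] int by simp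
  qed
  show "(LINT x|lborel. tensor \<Phi> [] (x :: real ^ 'n)) = 1"
    using moment[of "\<lambda>_. 0"] int1 by (simp add: monomial_def)
  show "(LINT x|lborel. of_real (monomial \<alpha> x) * tensor \<Phi> [] (x :: real ^ 'n)) = 0" if "mlen \<alpha> \<noteq> 0" for \<alpha>
  proof -
    have "\<exists>b\<in>Basis. \<alpha> b \<noteq> 0"
      by (rule ccontr) (use that in \<open>simp add: mlen_def\<close>)
    then obtain b where "b \<in> Basis" "\<alpha> b > 0" by blast
    then show ?thesis unfolding moment by (intro prod_zero bexI[of _ b] mom) auto
  qed
qed

text \<open>The first power of \<open>1 / \<omega>\<close> normalises the integral, the second is
  the chain rule along the word.\<close>

definition rescaled :: "real \<Rightarrow> ('n::finite list \<Rightarrow> real ^ 'n \<Rightarrow> complex) \<Rightarrow> 'n list \<Rightarrow> real ^ 'n \<Rightarrow> complex"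
  where "rescaled \<omega> D l x = of_real ((1 / \<omega>) ^ CARD('n) * (1 / \<omega>) ^ length l) * D l (x /\<^sub>R \<omega>)"

lemma rescaled_Nil: "rescaled \<omega> D [] = rescale \<omega> (D [])"
  by (simp add: rescaled_def[abs_def] rescale_def[abs_def] power_one_over)

lemma rescaled_etype:
  fixes D :: "'n::finite list \<Rightarrow> real ^ 'n \<Rightarrow> complex"
  assumes D: "dfam D" and bd: "\<And>l x. norm (D l x) \<le> C * B ^ length l" and w: "\<omega> > 0"
  shows "etype (C * (1 / \<omega>) ^ CARD('n)) (B / \<omega>) (rescaled \<omega> D)"
proof (rule dfam_etype)
  show "dfam (rescaled \<omega> D)" unfolding dfam_def
  proof (intro allI)
    fix l :: "'n list" and x
    let ?c = "complex_of_real ((1 / \<omega>) ^ CARD('n) * (1 / \<omega>) ^ length l)"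
    have "((\<lambda>x. D l (x /\<^sub>R \<omega>)) has_derivative (\<lambda>h. \<Sum>i\<in>UNIV. ((h /\<^sub>R \<omega>) $ i) *\<^sub>R D (i # l) (x /\<^sub>R \<omega>))) (at x)"
      by (rule has_derivative_compose[of "\<lambda>x. x /\<^sub>R \<omega>" "\<lambda>h. h /\<^sub>R \<omega>" x UNIV "D l"])
         (use dfamD[OF D] in \<open>auto intro!: derivative_eq_intros\<close>)
    from has_derivative_mult_right[OF this, of ?c]
    have "(rescaled \<omega> D l has_derivative (\<lambda>h. ?c * (\<Sum>i\<in>UNIV. ((h /\<^sub>R \<omega>) $ i) *\<^sub>R D (i # l) (x /\<^sub>R \<omega>)))) (at x)"
      by (simp only: rescaled_def[abs_def])
    moreover have "?c * (\<Sum>i\<in>UNIV. ((h /\<^sub>R \<omega>) $ i) *\<^sub>R D (i # l) (x /\<^sub>R \<omega>)) =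
        (\<Sum>i\<in>UNIV. (h $ i) *\<^sub>R rescaled \<omega> D (i # l) x)" for h
      unfolding sum_distrib_left
      by (intro sum.cong refl) (simp add: rescaled_def scaleR_conv_of_real[where 'a = complex] divide_inverse mult_ac)
    ultimately show "(rescaled \<omega> D l has_derivative (\<lambda>h. \<Sum>i\<in>UNIV. (h $ i) *\<^sub>R rescaled \<omega> D (i # l) x)) (at x)"
      by simp
  qed
  show "norm (rescaled \<omega> D l x) \<le> C * (1 / \<omega>) ^ CARD('n) * (B / \<omega>) ^ length l" for l x
  proof -
    have "norm (rescaled \<omega> D l x) = ((1 / \<omega>) ^ CARD('n) * (1 / \<omega>) ^ length l) * norm (D l (x /\<^sub>R \<omega>))"
      using w by (simp add: rescaled_def norm_mult norm_power norm_divide)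
    also have "\<dots> \<le> ((1 / \<omega>) ^ CARD('n) * (1 / \<omega>) ^ length l) * (C * B ^ length l)"
      using w by (intro mult_left_mono bd) auto
    finally show ?thesis by (simp add: power_divide)
  qed
qed

lemma etype_mono:
  fixes D :: "'n::finite list \<Rightarrow> real ^ 'n \<Rightarrow> complex"
  assumes "etype M X D" "M \<le> M'" "X \<ge> 0"
  shows "etype M' X D"
  unfolding etype_def
proof (intro conjI allI)
  fix l :: "'n list" and x h :: "real ^ 'n"
  show "norm (D l x) \<le> M' * X ^ length l"
    using assms by (intro order_trans[OF etype_bound[OF assms(1)]] mult_right_mono) auto
  show "norm (D l (x + h) - D l x - (\<Sum>i\<in>UNIV. (h $ i) *\<^sub>R D (i # l) x))
       \<le> M' * (real CARD('n) ^ 2 * X ^ (length l + 2) * norm h ^ 2)"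
    using assms by (intro order_trans[OF etype_remainder[OF assms(1)]] mult_right_mono) auto
qed

lemma etype_translate:
  fixes D :: "'n::finite list \<Rightarrow> real ^ 'n \<Rightarrow> complex"
  assumes "etype M X D"
  shows "etype M X (\<lambda>l x. D l (x - y))"
  unfolding etype_def
proof (intro conjI allI)
  fix l :: "'n list" and x h :: "real ^ 'n"
  show "norm (D l (x - y)) \<le> M * X ^ length l" by (rule etype_bound[OF assms])
  show "norm (D l (x + h - y) - D l (x - y) - (\<Sum>i\<in>UNIV. (h $ i) *\<^sub>R D (i # l) (x - y)))
       \<le> M * (real CARD('n) ^ 2 * X ^ (length l + 2) * norm h ^ 2)"
    using etype_remainder[OF assms, of l "x - y" h] by (simp only: diff_add_eq)
qed

lemma etype_continuous:
  assumes "etype M X D"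
  shows "continuous_on S (D l)"
  by (rule continuous_at_imp_continuous_on, rule ballI)
     (rule has_derivative_continuous[OF dfamD[OF etype_dfam[OF assms]]])

text \<open>Values and remainders of the integrated family are integrals of those of the members,
  with bounds uniform in the parameter; the L1 norm of the density becomes the new factor.
  Differentiability of the superposition comes with the remainder bound.\<close>

lemma etype_superposition:
  fixes Y :: "'b::euclidean_space \<Rightarrow> 'n::finite list \<Rightarrow> real ^ 'n \<Rightarrow> complex" and g :: "'b \<Rightarrow> complex"
  assumes g: "integrable N g" and Y: "\<And>y. etype M X (Y y)" and X: "X \<ge> 0"
    and meas: "\<And>l x. (\<lambda>y. Y y l x) \<in> borel_measurable N"
  shows "etype (M * (LINT y|N. norm (g y))) X (\<lambda>l x. LINT y|N. g y * Y y l x)"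
proof -
  have M: "M \<ge> 0" using etype_nonneg[OF Y] .
  have [measurable]: "g \<in> borel_measurable N" using g by (rule borel_measurable_integrable)
  have int: "integrable N (\<lambda>y. g y * Y y l x)" for l x
  proof (rule Bochner_Integration.integrable_bound[of _ "\<lambda>y. (M * X ^ length l) * norm (g y)"])
    show "(\<lambda>y. g y * Y y l x) \<in> borel_measurable N"
      by (intro borel_measurable_times meas) simp
    show "AE y in N. norm (g y * Y y l x) \<le> norm ((M * X ^ length l) * norm (g y))"
    proof (intro AE_I2)
      fix y
      have "norm (Y y l x) * norm (g y) \<le> (M * X ^ length l) * norm (g y)"
        by (intro mult_right_mono etype_bound[OF Y]) auto
      then show "norm (g y * Y y l x) \<le> norm ((M * X ^ length l) * norm (g y))"
        using M X by (simp add: norm_mult mult.commute)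
    qed
  qed (use g in auto)
  have bd: "norm (LINT y|N. g y * r y) \<le> M * (LINT y|N. norm (g y)) * c"
    if r: "\<And>y. norm (r y) \<le> M * c" and i: "integrable N (\<lambda>y. g y * r y)" for r c
  proof -
    have "norm (LINT y|N. g y * r y) \<le> (LINT y|N. norm (g y) * (M * c))"
    proof (rule Bochner_Integration.integral_norm_bound_integral)
      show "integrable N (\<lambda>y. g y * r y)" by (rule i)
      show "integrable N (\<lambda>y. norm (g y) * (M * c))" using g by auto
      show "norm (g y * r y) \<le> norm (g y) * (M * c)" for y
        unfolding norm_mult by (intro mult_left_mono r) simp
    qed
    then show ?thesis by (simp add: mult_ac)
  qed
  show ?thesis unfolding etype_def
  proof (intro conjI allI)
    fix l :: "'n list" and x h :: "real ^ 'n"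
    show "norm (LINT y|N. g y * Y y l x) \<le> M * (LINT y|N. norm (g y)) * X ^ length l"
      by (rule bd[OF etype_bound[OF Y] int])
    let ?r = "\<lambda>y. Y y l (x + h) - Y y l x - (\<Sum>i\<in>UNIV. (h $ i) *\<^sub>R Y y (i # l) x)"
    have eq: "(\<lambda>y. g y * ?r y) = (\<lambda>y. g y * Y y l (x + h) - g y * Y y l x - (\<Sum>i\<in>UNIV. (h $ i) *\<^sub>R (g y * Y y (i # l) x)))"
      by (simp add: right_diff_distrib sum_distrib_left)
    have isum: "integrable N (\<lambda>y. \<Sum>i\<in>UNIV. (h $ i) *\<^sub>R (g y * Y y (i # l) x))"
      by (intro Bochner_Integration.integrable_sum integrable_scaleR_right int)
    have "(LINT y|N. g y * ?r y) = (LINT y|N. g y * Y y l (x + h)) - (LINT y|N. g y * Y y l x)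
        - (\<Sum>i\<in>UNIV. (h $ i) *\<^sub>R (LINT y|N. g y * Y y (i # l) x))"
      unfolding eq using int isum by (simp add: Bochner_Integration.integral_sum)
    moreover have "norm (LINT y|N. g y * ?r y) \<le> M * (LINT y|N. norm (g y)) * (real CARD('n) ^ 2 * X ^ (length l + 2) * norm h ^ 2)"
    proof (rule bd[OF etype_remainder[OF Y]])
      show "integrable N (\<lambda>y. g y * ?r y)"
        unfolding eq by (intro Bochner_Integration.integrable_diff int isum)
    qed
    ultimately show "norm ((LINT y|N. g y * Y y l (x + h)) - (LINT y|N. g y * Y y l x)
        - (\<Sum>i\<in>UNIV. (h $ i) *\<^sub>R (LINT y|N. g y * Y y (i # l) x)))
        \<le> M * (LINT y|N. norm (g y)) * (real CARD('n) ^ 2 * X ^ (length l + 2) * norm h ^ 2)"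
      by simp
  qed
qed

section \<open>Convolution of the data and of the right-hand side\<close>

lemma compact_support_integrable:
  fixes g :: "'a::euclidean_space \<Rightarrow> 'b::{banach, second_countable_topology}"
  assumes "compact K" "continuous_on UNIV g" "\<And>y. y \<notin> K \<Longrightarrow> g y = 0"
  shows "integrable lborel g"
proof -
  have "integrable lborel (\<lambda>x. indicator K x *\<^sub>R g x)"
    by (intro borel_integrable_compact assms continuous_on_subset[OF assms(2)]) auto
  moreover have "(\<lambda>x. indicator K x *\<^sub>R g x) = g" using assms(3) by (auto simp: indicator_def)
  ultimately show ?thesis by simp
qed

lemma convolution_etype:
  fixes D :: "'n::finite list \<Rightarrow> real ^ 'n \<Rightarrow> complex"
  assumes "integrable lborel g" "etype M X D" "X \<ge> 0"
  shows "etype (M * (LINT y|lborel. norm (g y))) X (\<lambda>l x. LINT y|lborel. g y * D l (x - y))"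
proof (rule etype_superposition[OF assms(1) etype_translate[OF assms(2)] assms(3)])
  fix l and x :: "real ^ 'n"
  have "continuous_on UNIV (\<lambda>y. D l (x - y))"
    by (rule continuous_on_compose2[OF etype_continuous[OF assms(2), of UNIV]]) (auto intro!: continuous_intros)
  then show "(\<lambda>y. D l (x - y)) \<in> borel_measurable lborel"
    by (simp add: borel_measurable_continuous_onI)
qed

text \<open>The supports lie in one compact set and \<open>f t\<close> depends on \<open>t\<close>
  uniformly in \<open>y\<close>, so the integrals differ by at most \<delta> times \<open>c\<close>
  times the measure of that set.\<close>

lemma continuous_on_integral_param:
  fixes f :: "real \<Rightarrow> 'a::euclidean_space \<Rightarrow> complex"
  assumes K: "compact K" "\<And>t y. t \<in> S \<Longrightarrow> y \<notin> K \<Longrightarrow> f t y = 0"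
    and f: "\<And>t. t \<in> S \<Longrightarrow> continuous_on UNIV (f t)"
    and uc: "\<And>t0 \<delta>. t0 \<in> S \<Longrightarrow> \<delta> > 0 \<Longrightarrow> \<exists>\<rho>>0. \<forall>t\<in>S. \<bar>t - t0\<bar> < \<rho> \<longrightarrow> (\<forall>y. norm (f t y - f t0 y) \<le> \<delta>)"
    and q: "continuous_on UNIV q" "\<And>y. norm (q y) \<le> c"
  shows "continuous_on S (\<lambda>t. LINT y|lborel. f t y * q y)"
  unfolding continuous_on_iff
proof (intro ballI allI impI)
  fix t0 e :: real assume t0: "t0 \<in> S" and e: "e > 0"
  have c: "c \<ge> 0" using order_trans[OF norm_ge_zero q(2)] .
  have int: "integrable lborel (\<lambda>y. f t y * q y)" if "t \<in> S" for t
    using that K by (intro compact_support_integrable[of K] continuous_on_mult f q) auto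
  have fin: "integrable lborel (indicator K :: _ \<Rightarrow> real)"
    using K(1) emeasure_bounded_finite[OF compact_imp_bounded[OF K(1)]]
    by (intro integrable_real_indicator) (auto simp: compact_imp_closed borel_closed)
  define \<mu> where "\<mu> = measure lborel K"
  \<comment> \<open>The summand 1 keeps the denominator positive when the bound or the measure is 0;
    the factor 2 makes the final inequality strict.\<close>
  define \<delta> where "\<delta> = e / (2 * (c * \<mu> + 1))"
  have \<mu>: "\<mu> \<ge> 0" by (simp add: \<mu>_def)
  have cm: "c * \<mu> + 1 > 0" using c \<mu> by (simp add: add_nonneg_pos)
  have \<delta>: "\<delta> > 0" using e cm by (simp add: \<delta>_def)
  obtain \<rho> where \<rho>: "\<rho> > 0" "\<forall>t\<in>S. \<bar>t - t0\<bar> < \<rho> \<longrightarrow> (\<forall>y. norm (f t y - f t0 y) \<le> \<delta>)"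
    using uc[OF t0 \<delta>] by blast
  have "dist (LINT y|lborel. f t y * q y) (LINT y|lborel. f t0 y * q y) < e" if t: "t \<in> S" "dist t t0 < \<rho>" for t
  proof -
    have "\<bar>t - t0\<bar> < \<rho>" using t(2) by (simp only: dist_norm real_norm_def)
    with \<rho>(2) t(1) have fd: "norm (f t y - f t0 y) \<le> \<delta>" for y by blast
    have "(LINT y|lborel. f t y * q y) - (LINT y|lborel. f t0 y * q y) = (LINT y|lborel. f t y * q y - f t0 y * q y)"
      using int t(1) t0 by simp
    also have "norm \<dots> \<le> (LINT y|lborel. (\<delta> * c) * indicator K y)"
    proof (rule Bochner_Integration.integral_norm_bound_integral)
      show "integrable lborel (\<lambda>y. f t y * q y - f t0 y * q y)" using int t(1) t0 by auto
      show "integrable lborel (\<lambda>y. (\<delta> * c) * indicator K y)" using fin by auto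
      show "norm (f t y * q y - f t0 y * q y) \<le> (\<delta> * c) * indicator K y" for y
      proof (cases "y \<in> K")
        case True
        have "norm ((f t y - f t0 y) * q y) \<le> \<delta> * c"
          unfolding norm_mult using fd[of y] q(2)[of y] \<delta>
          by (intro mult_mono) auto
        then show ?thesis using True by (simp add: left_diff_distrib)
      next
        case False
        then show ?thesis using K(2)[OF t(1)] K(2)[OF t0] by simp
      qed
    qed
    also have "\<dots> = \<delta> * c * \<mu>" using fin by (simp add: \<mu>_def)
    also have "\<dots> \<le> \<delta> * (c * \<mu> + 1)" using \<delta> by (simp add: algebra_simps)
    also have "\<dots> = e / 2" using cm by (simp add: \<delta>_def field_simps)
    also have "\<dots> < e" using e by simp
    finally show ?thesis by (simp add: dist_norm)
  qed
  then show "\<exists>d>0. \<forall>x'\<in>S. dist x' t0 < d \<longrightarrow> dist (LINT y|lborel. f x' y * q y) (LINT y|lborel. f t0 y * q y) < e"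
    using \<rho>(1) by blast
qed

lemma smooth_continuous:
  assumes "smooth g"
  shows "continuous_on UNIV g"
proof -
  from assms[unfolded smooth_def, rule_format, of "[]"] have "g differentiable_on UNIV" by simp
  then show ?thesis by (rule differentiable_imp_continuous_on)
qed

lemma zero_off_csupp: "y \<notin> csupp g \<Longrightarrow> g y = 0"
  unfolding csupp_def using closure_subset[of "{x. g x \<noteq> 0}"] by auto

lemma gevrey_c_integrable: "g \<in> gevrey_c s \<Longrightarrow> integrable lborel g"
  by (rule compact_support_integrable[of "csupp g"])
     (auto simp: gevrey_c_def gevrey_def intro: smooth_continuous zero_off_csupp)

text \<open>The multi-index 0 carries the weight 1, so continuity into the Gevrey space contains
  continuity of \<open>f\<close> in the supremum norm.\<close>

lemma cont_gevrey_cD: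
  fixes f :: "real \<Rightarrow> 'a::euclidean_space \<Rightarrow> complex"
  assumes "cont_gevrey_c T s f"
  obtains K where "compact K" "\<And>t y. t \<in> {0..T} \<Longrightarrow> y \<notin> K \<Longrightarrow> f t y = 0"
    "\<And>t. t \<in> {0..T} \<Longrightarrow> continuous_on UNIV (f t)"
    "\<And>t0 \<delta>. t0 \<in> {0..T} \<Longrightarrow> \<delta> > 0 \<Longrightarrow> \<exists>\<rho>>0. \<forall>t\<in>{0..T}. \<bar>t - t0\<bar> < \<rho> \<longrightarrow> (\<forall>y. norm (f t y - f t0 y) \<le> \<delta>)"
proof -
  have g: "f t \<in> gevrey_c s" if "t \<in> {0..T}" for t
    using assms[unfolded cont_gevrey_c_def, THEN conjunct1] that by (rule bspec)
  from assms[unfolded cont_gevrey_c_def, THEN conjunct2]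
  obtain K C where KC: "compact K \<and> C > 0 \<and>
      (\<forall>t\<in>{0..T}. csupp (f t) \<subseteq> K \<and>
        (\<exists>M. \<forall>\<alpha> x. norm (mdiff \<alpha> (f t) x) \<le> M * (C ^ mlen \<alpha> * mfact \<alpha> powr s))) \<and>
      (\<forall>t0\<in>{0..T}. \<forall>\<delta>>0. \<exists>\<rho>>0. \<forall>t\<in>{0..T}. \<bar>t - t0\<bar> < \<rho> \<longrightarrow>
        (\<forall>\<alpha> x. norm (mdiff \<alpha> (f t) x - mdiff \<alpha> (f t0) x)
                 \<le> \<delta> * (C ^ mlen \<alpha> * mfact \<alpha> powr s)))"
    by (elim exE) (rule that)
  note K = KC[THEN conjunct1]
  note sup = KC[THEN conjunct2, THEN conjunct2, THEN conjunct1, rule_format, THEN conjunct1]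
  note uc = KC[THEN conjunct2, THEN conjunct2, THEN conjunct2, THEN bspec, THEN spec, THEN mp]
  have m0: "mdiff (\<lambda>_. 0) h = h" for h :: "'a \<Rightarrow> complex"
  proof -
    have "foldr (\<lambda>b. pd b ^^ 0) bs h = h" for bs by (induction bs) auto
    then show ?thesis by (simp add: mdiff_def)
  qed
  show ?thesis
  proof (rule that[OF K])
    show "f t y = 0" if "t \<in> {0..T}" "y \<notin> K" for t y
      using sup[OF that(1)] that(2) by (intro zero_off_csupp) auto
    show "continuous_on UNIV (f t)" if "t \<in> {0..T}" for t
      using g[OF that] by (intro smooth_continuous) (simp add: gevrey_c_def gevrey_def)
    fix t0 \<delta> :: real assume "t0 \<in> {0..T}" "\<delta> > 0"
    from uc[OF this] obtain \<rho> where \<rho>: "\<rho> > 0" "\<forall>t\<in>{0..T}. \<bar>t - t0\<bar> < \<rho> \<longrightarrow> (\<forall>\<alpha> x.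
        norm (mdiff \<alpha> (f t) x - mdiff \<alpha> (f t0) x) \<le> \<delta> * (C ^ mlen \<alpha> * mfact \<alpha> powr s))"
      by (elim exE conjE) (rule that)
    have "norm (f t y - f t0 y) \<le> \<delta>" if "t \<in> {0..T}" "\<bar>t - t0\<bar> < \<rho>" for t y
      using \<rho>(2)[rule_format, OF that, of "\<lambda>_. 0" y] by (simp add: m0 mlen_def mfact_def)
    then show "\<exists>\<rho>>0. \<forall>t\<in>{0..T}. \<bar>t - t0\<bar> < \<rho> \<longrightarrow> (\<forall>y. norm (f t y - f t0 y) \<le> \<delta>)"
      using \<rho>(1) by blast
  qed
qed

text \<open>Convolution in \<open>x\<close> turns each \<open>f \<tau>\<close> into a function of
  exponential type, and convolution in \<open>t\<close> superposes these with the mollifier as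
  density. Time derivatives fall on the mollifier, so they are again such superpositions, with one
  more factor \<open>1 / \<omega> \<epsilon>\<close> each.\<close>

lemma regularised_rhs_family:
  fixes f :: "real \<Rightarrow> real ^ 'n::finite \<Rightarrow> complex" and D :: "'n list \<Rightarrow> real ^ 'n \<Rightarrow> complex"
  assumes T: "T > 0" and f: "cont_gevrey_c T s f" and \<psi>: "mollifier1 \<psi>"
    and D: "dfam D" and bd: "\<And>l x. norm (D l x) \<le> C * B ^ length l" and B: "B \<ge> 0"
    and \<omega>: "\<And>\<epsilon>. \<epsilon> \<in> {0<..1} \<Longrightarrow> 0 < \<omega> \<epsilon>" and mod: "moderate (\<lambda>\<epsilon>. 1 / \<omega> \<epsilon>)"
  obtains F where
    "\<And>\<epsilon> k t l x. \<epsilon> \<in> {0<..1} \<Longrightarrow> ((\<lambda>t. F \<epsilon> k t l x) has_vector_derivative F \<epsilon> (Suc k) t l x) (at t)"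
    "\<And>k. \<exists>m. moderate m \<and> (\<forall>\<epsilon>\<in>{0<..1}. \<forall>t. etype (m \<epsilon>) (B / \<omega> \<epsilon>) (F \<epsilon> k t))"
    "\<And>\<epsilon> t x. \<epsilon> \<in> {0<..1} \<Longrightarrow> F \<epsilon> 0 t [] x =
       fun_conv (\<lambda>\<tau>. if \<tau> \<in> {0..T} then fun_conv (f \<tau>) (rescale (\<omega> \<epsilon>) (D [])) x else 0) (rescale (\<omega> \<epsilon>) \<psi>) t"
proof -
  obtain K where K: "compact K" "\<And>t y. t \<in> {0..T} \<Longrightarrow> y \<notin> K \<Longrightarrow> f t y = 0"
    "\<And>t. t \<in> {0..T} \<Longrightarrow> continuous_on UNIV (f t)"
    "\<And>t0 \<delta>. t0 \<in> {0..T} \<Longrightarrow> \<delta> > 0 \<Longrightarrow> \<exists>\<rho>>0. \<forall>t\<in>{0..T}. \<bar>t - t0\<bar> < \<rho> \<longrightarrow> (\<forall>y. norm (f t y - f t0 y) \<le> \<delta>)"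
    by (rule cont_gevrey_cD[OF f]) (rule that)
  obtain b P where "scaled_primitive \<psi> b P" using exists_scaled_primitive[OF \<psi>] by blast
  note P = scaled_primitiveD[OF this]
  have "\<forall>k. \<exists>M. M > 0 \<and> (\<forall>\<omega>>0. \<forall>x. norm (P \<omega> k x) \<le> M * (1 / \<omega>) ^ k)" using P(11) by blast
  then obtain MP where MP: "\<And>k. MP k > 0" "\<And>k \<omega> x. \<omega> > 0 \<Longrightarrow> norm (P \<omega> k x) \<le> MP k * (1 / \<omega>) ^ k"
    by (auto dest!: choice)
  define f' where "f' \<tau> y = (if \<tau> \<in> {0..T} then f \<tau> y else 0)" for \<tau> y
  have fint: "integrable lborel (f' \<tau>)" for \<tau>
  proof (cases "\<tau> \<in> {0..T}")
    case True
    then have "f' \<tau> = f \<tau>" by (auto simp: f'_def)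
    then show ?thesis using compact_support_integrable[OF K(1) K(3)[OF True] K(2)[OF True]] by simp
  next
    case False
    then have "f' \<tau> = (\<lambda>_. 0)" by (auto simp: f'_def)
    then show ?thesis by simp
  qed
  \<comment> \<open>The L1 norms of the \<open>f t\<close> are continuous in \<open>t\<close>, hence
    bounded on \<open>{0..T}\<close>. The norm is read as a complex function times the constant 1 so
    that \<open>continuous_on_integral_param\<close> applies.\<close>
  have nc: "continuous_on {0..T} (\<lambda>t. LINT y|lborel. of_real (norm (f t y)) * (1 :: complex))"
  proof (rule continuous_on_integral_param[OF K(1)])
    show "continuous_on UNIV (\<lambda>y. complex_of_real (norm (f t y)))" if "t \<in> {0..T}" for t
      by (intro continuous_intros K(3)[OF that])
    fix t0 \<delta> :: real assume "t0 \<in> {0..T}" "\<delta> > 0"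
    from K(4)[OF this] obtain \<rho> where \<rho>: "\<rho> > 0" "\<forall>t\<in>{0..T}. \<bar>t - t0\<bar> < \<rho> \<longrightarrow> (\<forall>y. norm (f t y - f t0 y) \<le> \<delta>)"
      by (elim exE conjE) (rule that)
    have "norm (complex_of_real (norm (f t y)) - of_real (norm (f t0 y))) \<le> \<delta>"
      if "t \<in> {0..T}" "\<bar>t - t0\<bar> < \<rho>" for t y
    proof -
      have "norm (complex_of_real (norm (f t y)) - of_real (norm (f t0 y))) \<le> norm (f t y - f t0 y)"
        using norm_triangle_ineq3[of "f t y" "f t0 y"] by (simp flip: of_real_diff)
      also have "\<dots> \<le> \<delta>" using \<rho>(2)[rule_format, OF that] .
      finally show ?thesis .
    qed
    then show "\<exists>\<rho>>0. \<forall>t\<in>{0..T}. \<bar>t - t0\<bar> < \<rho> \<longrightarrow>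
        (\<forall>y. norm (complex_of_real (norm (f t y)) - of_real (norm (f t0 y))) \<le> \<delta>)"
      using \<rho>(1) by blast
  qed (use K(2) in auto)
  have "bounded ((\<lambda>t. LINT y|lborel. of_real (norm (f t y)) * (1 :: complex)) ` {0..T})"
    by (intro compact_imp_bounded compact_continuous_image nc) auto
  then obtain Q where Q: "Q > 0" "\<And>t. t \<in> {0..T} \<Longrightarrow> norm (LINT y|lborel. of_real (norm (f t y)) * (1 :: complex)) \<le> Q"
    unfolding bounded_pos by auto
  have Qf: "(LINT y|lborel. norm (f' \<tau> y)) \<le> Q" for \<tau>
  proof (cases "\<tau> \<in> {0..T}")
    case True
    then show ?thesis using Q(2)[OF True] by (simp add: f'_def)
  next
    case False
    then have "f' \<tau> = (\<lambda>_. 0)" by (auto simp: f'_def)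
    then show ?thesis using Q(1) by simp
  qed
  define G where "G \<epsilon> \<tau> l x = (LINT y|lborel. f' \<tau> y * rescaled (\<omega> \<epsilon>) D l (x - y))" for \<epsilon> \<tau> l x
  define mG where "mG \<epsilon> = C * (1 / \<omega> \<epsilon>) ^ CARD('n) * Q" for \<epsilon>
  have resc: "etype (C * (1 / \<omega> \<epsilon>) ^ CARD('n)) (B / \<omega> \<epsilon>) (rescaled (\<omega> \<epsilon>) D)" if "\<epsilon> \<in> {0<..1}" for \<epsilon>
    by (rule rescaled_etype[OF D bd \<omega>[OF that]])
  have X: "B / \<omega> \<epsilon> \<ge> 0" if "\<epsilon> \<in> {0<..1}" for \<epsilon> using \<omega>[OF that] B by simp
  have Get: "etype (mG \<epsilon>) (B / \<omega> \<epsilon>) (G \<epsilon> \<tau>)" if e: "\<epsilon> \<in> {0<..1}" for \<epsilon> \<tau>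
  proof (rule etype_mono[OF _ _ X[OF e]])
    show "etype (C * (1 / \<omega> \<epsilon>) ^ CARD('n) * (LINT y|lborel. norm (f' \<tau> y))) (B / \<omega> \<epsilon>) (G \<epsilon> \<tau>)"
      unfolding G_def[abs_def] by (rule convolution_etype[OF fint resc[OF e] X[OF e]])
    show "C * (1 / \<omega> \<epsilon>) ^ CARD('n) * (LINT y|lborel. norm (f' \<tau> y)) \<le> mG \<epsilon>"
      unfolding mG_def by (intro mult_left_mono Qf etype_nonneg[OF resc[OF e]])
  qed
  have Gc: "continuous_on {0..T} (\<lambda>\<tau>. G \<epsilon> \<tau> l x)" if e: "\<epsilon> \<in> {0<..1}" for \<epsilon> l x
  proof -
    have "continuous_on {0..T} (\<lambda>t. LINT y|lborel. f t y * rescaled (\<omega> \<epsilon>) D l (x - y))"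
    proof (rule continuous_on_integral_param[OF K(1) K(2) K(3) K(4)])
      show "continuous_on UNIV (\<lambda>y. rescaled (\<omega> \<epsilon>) D l (x - y))"
        by (rule continuous_on_compose2[OF etype_continuous[OF resc[OF e], of UNIV]]) (auto intro!: continuous_intros)
      show "norm (rescaled (\<omega> \<epsilon>) D l (x - y)) \<le> C * (1 / \<omega> \<epsilon>) ^ CARD('n) * (B / \<omega> \<epsilon>) ^ length l" for y
        by (rule etype_bound[OF resc[OF e]])
    qed
    then show ?thesis
      by (rule continuous_on_eq) (simp add: G_def f'_def)
  qed
  \<comment> \<open>Density of the superposition in time. The indicator realises the extension by
    zero; the index is \<open>Suc k\<close> because \<open>P\<close> has the primitive of the
    mollifier at index 0.\<close>
  define W where "W \<epsilon> k t \<tau> = indicat_real {0..T} \<tau> *\<^sub>R P (\<omega> \<epsilon>) (Suc k) (t - \<tau>)" for \<epsilon> k t \<tau>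
  define F where "F \<epsilon> k t l x = (LINT \<tau>|lborel. W \<epsilon> k t \<tau> * G \<epsilon> \<tau> l x)" for \<epsilon> k t l x
  have Pc: "continuous_on S (\<lambda>\<tau>. P (\<omega> \<epsilon>) k (t - \<tau>))" if e: "\<epsilon> \<in> {0<..1}" for \<epsilon> k t S
    by (rule continuous_on_compose2[OF dseq_continuous[OF P(2)[OF \<omega>[OF e]], of UNIV]]) (auto intro!: continuous_intros)
  have F_int: "F \<epsilon> k t l x = integral {0..T} (\<lambda>\<tau>. P (\<omega> \<epsilon>) (Suc k) (t - \<tau>) * G \<epsilon> \<tau> l x)"
    if e: "\<epsilon> \<in> {0<..1}" for \<epsilon> k t l x
  proof -
    have "set_integrable lborel {0..T} (\<lambda>\<tau>. P (\<omega> \<epsilon>) (Suc k) (t - \<tau>) * G \<epsilon> \<tau> l x)"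
      unfolding set_integrable_def by (intro borel_integrable_compact continuous_on_mult Pc[OF e] Gc[OF e]) auto
    from set_borel_integral_eq_integral(2)[OF this] show ?thesis
      by (simp add: F_def W_def set_lebesgue_integral_def)
  qed
  show ?thesis
  proof (rule that[of F])
    fix \<epsilon> :: real and k t l x assume e: "\<epsilon> \<in> {0<..1}"
    have "((\<lambda>t. integral (cbox 0 T) (\<lambda>\<tau>. P (\<omega> \<epsilon>) (Suc k) (t - \<tau>) * G \<epsilon> \<tau> l x)) has_vector_derivative
        integral (cbox 0 T) (\<lambda>\<tau>. P (\<omega> \<epsilon>) (Suc (Suc k)) (t - \<tau>) * G \<epsilon> \<tau> l x)) (at t within UNIV)"
    proof (rule leibniz_rule_vector_derivative)
      show "((\<lambda>t. P (\<omega> \<epsilon>) (Suc k) (t - \<tau>) * G \<epsilon> \<tau> l x) has_vector_derivative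
          P (\<omega> \<epsilon>) (Suc (Suc k)) (t - \<tau>) * G \<epsilon> \<tau> l x) (at t within UNIV)" for t \<tau>
      proof -
        have "((\<lambda>t. P (\<omega> \<epsilon>) (Suc k) (t - \<tau>)) has_vector_derivative P (\<omega> \<epsilon>) (Suc (Suc k)) (t - \<tau>)) (at t)"
          using vector_diff_chain_at[OF has_vector_derivative_affine[of 1 "-\<tau>" t] dseqD[OF P(2)[OF \<omega>[OF e]]]]
          by (simp add: o_def)
        then show ?thesis by (rule has_vector_derivative_mult_left)
      qed
      show "(\<lambda>\<tau>. P (\<omega> \<epsilon>) (Suc k) (t - \<tau>) * G \<epsilon> \<tau> l x) integrable_on cbox 0 T" for t
        unfolding box_real by (intro integrable_continuous_interval continuous_on_mult Pc[OF e] Gc[OF e])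
      show "continuous_on (UNIV \<times> cbox 0 T) (\<lambda>(t, \<tau>). P (\<omega> \<epsilon>) (Suc (Suc k)) (t - \<tau>) * G \<epsilon> \<tau> l x)"
        unfolding split_beta
        by (intro continuous_on_mult continuous_on_compose2[OF dseq_continuous[OF P(2)[OF \<omega>[OF e]], of UNIV]]
            continuous_on_compose2[OF Gc[OF e]] continuous_intros) auto
    qed auto
    then show "((\<lambda>t. F \<epsilon> k t l x) has_vector_derivative F \<epsilon> (Suc k) t l x) (at t)"
      by (simp add: F_int[OF e])
  next
    fix k
    \<comment> \<open>The L1 norm of the density is at most \<open>T\<close> times the supremum of
      the kernel.\<close>
    define m where "m \<epsilon> = mG \<epsilon> * (T * (MP (Suc k) * (1 / \<omega> \<epsilon>) ^ Suc k))" for \<epsilon>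
    have "moderate m" unfolding m_def mG_def
      by (intro moderate_mult moderate_const moderate_power mod)
    moreover have "etype (m \<epsilon>) (B / \<omega> \<epsilon>) (F \<epsilon> k t)" if e: "\<epsilon> \<in> {0<..1}" for \<epsilon> t
    proof (rule etype_mono[OF _ _ X[OF e]])
      have Wint: "integrable lborel (W \<epsilon> k t)"
        unfolding W_def[abs_def] by (intro borel_integrable_compact Pc[OF e]) auto
      have Gm: "(\<lambda>\<tau>. G \<epsilon> \<tau> l x) \<in> borel_measurable lborel" for l x
      proof -
        have "(\<lambda>\<tau>. indicat_real {0..T} \<tau> *\<^sub>R G \<epsilon> \<tau> l x) \<in> borel_measurable borel"
          by (intro borel_measurable_continuous_on_indicator Gc[OF e]) auto
        moreover have "(\<lambda>\<tau>. indicat_real {0..T} \<tau> *\<^sub>R G \<epsilon> \<tau> l x) = (\<lambda>\<tau>. G \<epsilon> \<tau> l x)"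
          by (auto simp: fun_eq_iff indicator_def G_def f'_def)
        ultimately show ?thesis by simp
      qed
      show "etype (mG \<epsilon> * (LINT \<tau>|lborel. norm (W \<epsilon> k t \<tau>))) (B / \<omega> \<epsilon>) (F \<epsilon> k t)"
        unfolding F_def[abs_def] by (rule etype_superposition[OF Wint Get[OF e] X[OF e] Gm])
      have finite_measure_interval: "integrable lborel (indicat_real {0..T})"
        by (intro integrable_real_indicator) (auto simp: emeasure_lborel_Icc_eq)
      have "(LINT \<tau>|lborel. norm (W \<epsilon> k t \<tau>)) \<le> (LINT \<tau>|lborel. (MP (Suc k) * (1 / \<omega> \<epsilon>) ^ Suc k) * indicat_real {0..T} \<tau>)"
      proof (rule integral_mono)
        show "integrable lborel (\<lambda>\<tau>. norm (W \<epsilon> k t \<tau>))" using Wint by (rule integrable_norm)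
        show "integrable lborel (\<lambda>\<tau>. (MP (Suc k) * (1 / \<omega> \<epsilon>) ^ Suc k) * indicat_real {0..T} \<tau>)"
          using finite_measure_interval by (intro integrable_mult_right)
        show "norm (W \<epsilon> k t \<tau>) \<le> (MP (Suc k) * (1 / \<omega> \<epsilon>) ^ Suc k) * indicat_real {0..T} \<tau>" for \<tau>
          using MP(2)[OF \<omega>[OF e], of "Suc k" "t - \<tau>"] by (simp add: W_def indicator_def)
      qed
      also have "\<dots> = T * (MP (Suc k) * (1 / \<omega> \<epsilon>) ^ Suc k)" using T by simp
      finally show "mG \<epsilon> * (LINT \<tau>|lborel. norm (W \<epsilon> k t \<tau>)) \<le> m \<epsilon>"
        unfolding m_def by (rule mult_left_mono) (rule etype_nonneg[OF Get[OF e]])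
    qed
    ultimately show "\<exists>m. moderate m \<and> (\<forall>\<epsilon>\<in>{0<..1}. \<forall>t. etype (m \<epsilon>) (B / \<omega> \<epsilon>) (F \<epsilon> k t))" by blast
  next
    fix \<epsilon> :: real and t x assume e: "\<epsilon> \<in> {0<..1}"
    show "F \<epsilon> 0 t [] x =
       fun_conv (\<lambda>\<tau>. if \<tau> \<in> {0..T} then fun_conv (f \<tau>) (rescale (\<omega> \<epsilon>) (D [])) x else 0) (rescale (\<omega> \<epsilon>) \<psi>) t"
      unfolding F_def fun_conv_def
    proof (intro Bochner_Integration.integral_cong refl)
      fix \<tau>
      have "P (\<omega> \<epsilon>) (Suc 0) (t - \<tau>) = rescale (\<omega> \<epsilon>) \<psi> (t - \<tau>)" using P(3)[OF \<omega>[OF e]] by simp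
      then show "W \<epsilon> 0 t \<tau> * G \<epsilon> \<tau> [] x =
          (if \<tau> \<in> {0..T} then LINT y|lborel. f \<tau> y * rescale (\<omega> \<epsilon>) (D []) (x - y) else 0) * rescale (\<omega> \<epsilon>) \<psi> (t - \<tau>)"
        by (simp add: W_def G_def f'_def rescaled_Nil)
    qed
  qed
qed

section \<open>The regularised Cauchy problem\<close>

type_synonym 'n coord = "bool \<times> 'n list \<times> (real ^ 'n) \<times> (real ^ 'n) option"

text \<open>
  The unknowns are the values (\<open>None\<close>) and the first-order Taylor remainders (\<open>Some h\<close>) of all
  space derivatives of the solution (\<open>False\<close>) and of its time derivative (\<open>True\<close>). Space
  derivatives act by appending to the word, so that they commute with taking remainders.
\<close>

fun coordinate :: "('n::finite list \<Rightarrow> real ^ 'n \<Rightarrow> complex) \<Rightarrow> 'n list \<Rightarrow> real ^ 'n \<Rightarrow> (real ^ 'n) option \<Rightarrow> complex"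
  where
    "coordinate D l x None = D l x"
  | "coordinate D l x (Some h) = D l (x + h) - D l x - (\<Sum>i\<in>UNIV. (h $ i) *\<^sub>R D (i # l) x)"

text \<open>Chosen such that the two estimates of \<open>etype\<close> become one weighted supremum
  bound over all coordinates, which is the norm of the Picard iteration.\<close>

definition remainder_weight :: "real \<Rightarrow> (real ^ 'n::finite) option \<Rightarrow> real"
  where "remainder_weight X r = (case r of None \<Rightarrow> 1 | Some h \<Rightarrow> real CARD('n) ^ 2 * X ^ 2 * norm h ^ 2)"

lemma etype_iff_coordinate:
  fixes D :: "'n::finite list \<Rightarrow> real ^ 'n \<Rightarrow> complex"
  shows "etype M X D \<longleftrightarrow> (\<forall>l x r. norm (coordinate D l x r) \<le> M * (X ^ length l * remainder_weight X r))"
proof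
  assume e: "etype M X D"
  show "\<forall>l x r. norm (coordinate D l x r) \<le> M * (X ^ length l * remainder_weight X r)"
  proof (intro allI)
    fix l x r
    show "norm (coordinate D l x r) \<le> M * (X ^ length l * remainder_weight X r)"
    proof (cases r)
      case None
      then show ?thesis using etype_bound[OF e] by (simp add: remainder_weight_def)
    next
      case (Some h)
      have "norm (coordinate D l x r) \<le> M * (real CARD('n) ^ 2 * X ^ (length l + 2) * norm h ^ 2)"
        using etype_remainder[OF e, of l x h] Some by simp
      also have "real CARD('n) ^ 2 * X ^ (length l + 2) * norm h ^ 2 = X ^ length l * remainder_weight X r"
        using Some by (simp add: remainder_weight_def power_add power2_eq_square mult_ac)
      finally show ?thesis .
    qed
  qed
next
  assume c: "\<forall>l x r. norm (coordinate D l x r) \<le> M * (X ^ length l * remainder_weight X r)"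
  show "etype M X D" unfolding etype_def
  proof (intro conjI allI)
    fix l :: "'n list" and x h :: "real ^ 'n"
    show "norm (D l x) \<le> M * X ^ length l"
      using c[rule_format, of l x None] by (simp add: remainder_weight_def)
    have "X ^ length l * remainder_weight X (Some h) = real CARD('n) ^ 2 * X ^ (length l + 2) * norm h ^ 2"
      by (simp add: remainder_weight_def power_add power2_eq_square mult_ac)
    with c[rule_format, of l x "Some h"]
    show "norm (D l (x + h) - D l x - (\<Sum>i\<in>UNIV. (h $ i) *\<^sub>R D (i # l) x))
       \<le> M * (real CARD('n) ^ 2 * X ^ (length l + 2) * norm h ^ 2)"
      by (simp only: coordinate.simps)
  qed
qed

text \<open>The equation as a first-order system in time, apart from its right-hand side, which
  enters through the zeroth Picard term. \<open>x\<close> and \<open>r\<close> are mere parameters,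
  so values and remainders obey the same equations.\<close>

definition wave_op :: "('n::finite \<Rightarrow> real \<Rightarrow> complex) \<Rightarrow> ('n \<Rightarrow> real \<Rightarrow> complex) \<Rightarrow> (real \<Rightarrow> complex)
    \<Rightarrow> (real \<Rightarrow> complex) \<Rightarrow> real \<Rightarrow> ('n coord \<Rightarrow> complex) \<Rightarrow> 'n coord \<Rightarrow> complex"
  where "wave_op a c d e t V = (\<lambda>(b, l, x, r). if b
    then (\<Sum>i\<in>UNIV. a i t * V (False, l @ [i, i], x, r)) - (\<Sum>i\<in>UNIV. c i t * V (False, l @ [i], x, r))
      - d t * V (True, l, x, r) - e t * V (False, l, x, r)
    else V (True, l, x, r))"

lemma wave_op_add: "wave_op a c d e t (\<lambda>i. V i + W i) i = wave_op a c d e t V i + wave_op a c d e t W i"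
  by (cases i) (simp add: wave_op_def sum.distrib ring_distribs)

lemma wave_op_continuous:
  assumes "\<And>i. continuous_on S (a i)" "\<And>i. continuous_on S (c i)" "continuous_on S d" "continuous_on S e"
    and "\<And>i. continuous_on S (\<lambda>t. V t i)"
  shows "continuous_on S (\<lambda>t. wave_op a c d e t (V t) i)"
proof -
  obtain b l x r where i: "i = (b, l, x, r)" by (cases i)
  show ?thesis
  proof (cases b)
    case True
    have "continuous_on S (\<lambda>t. (\<Sum>i\<in>UNIV. a i t * V t (False, l @ [i, i], x, r)) - (\<Sum>i\<in>UNIV. c i t * V t (False, l @ [i], x, r))
        - d t * V t (True, l, x, r) - e t * V t (False, l, x, r))"
    proof (intro continuous_on_diff)
      show "continuous_on S (\<lambda>t. \<Sum>i\<in>UNIV. a i t * V t (False, l @ [i, i], x, r))"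
        by (rule continuous_on_sum, rule continuous_on_mult) (rule assms(1), rule assms(5))
      show "continuous_on S (\<lambda>t. \<Sum>i\<in>UNIV. c i t * V t (False, l @ [i], x, r))"
        by (rule continuous_on_sum, rule continuous_on_mult) (rule assms(2), rule assms(5))
      show "continuous_on S (\<lambda>t. d t * V t (True, l, x, r))"
        by (rule continuous_on_mult) (rule assms(3), rule assms(5))
      show "continuous_on S (\<lambda>t. e t * V t (False, l, x, r))"
        by (rule continuous_on_mult) (rule assms(4), rule assms(5))
    qed
    then show ?thesis using True by (simp add: wave_op_def i)
  next
    case False
    then show ?thesis using assms(5)[of "(True, l, x, r)"] by (simp add: wave_op_def i)
  qed
qed

text \<open>The time derivative is measured in units of \<kappa>. Relative to these weights the row
  \<open>u' = v\<close> costs \<kappa>, the terms with \<open>u\<close> in the other row are divided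
  by \<kappa>, and each space derivative costs \<open>X\<close>. The weight \<rho> of the remainder
  index stays free, because existence and uniqueness use different ones.\<close>

lemma wave_op_bound:
  fixes V :: "'n::finite coord \<Rightarrow> complex"
  assumes V: "\<And>b l x r. norm (V (b, l, x, r)) \<le> M * ((if b then \<kappa> else 1) * X ^ length l * \<rho> r)"
    and \<kappa>: "\<kappa> > 0" "\<kappa> \<le> k"
    and k: "((\<Sum>i\<in>UNIV. norm (a i t)) * X ^ 2 + (\<Sum>i\<in>UNIV. norm (c i t)) * X + norm (e t)) / \<kappa> + norm (d t) \<le> k"
  shows "norm (wave_op a c d e t V (b, l, x, r)) \<le> k * (M * ((if b then \<kappa> else 1) * X ^ length l * \<rho> r))"
proof -
  define m where "m = M * (X ^ length l * \<rho> r)"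
  have m: "m \<ge> 0" using order_trans[OF norm_ge_zero V[of False l x r]] by (simp add: m_def)
  have V0: "norm (V (False, l, x, r)) \<le> m" and V1: "norm (V (True, l, x, r)) \<le> \<kappa> * m"
    using V[of False l x r] V[of True l x r] by (simp_all add: m_def mult_ac)
  have V2: "norm (V (False, l @ [i], x, r)) \<le> X * m" and V3: "norm (V (False, l @ [i, i], x, r)) \<le> X ^ 2 * m" for i
    using V[of False "l @ [i]" x r] V[of False "l @ [i, i]" x r]
    by (simp_all add: m_def mult_ac power2_eq_square)
  show ?thesis
  proof (cases b)
    case True
    have 1: "norm (\<Sum>i\<in>UNIV. a i t * V (False, l @ [i, i], x, r)) \<le> (\<Sum>i\<in>UNIV. norm (a i t)) * (X ^ 2 * m)"
      unfolding sum_distrib_right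
      by (rule order_trans[OF norm_sum sum_mono]) (simp add: norm_mult mult_left_mono V3)
    have 2: "norm (\<Sum>i\<in>UNIV. c i t * V (False, l @ [i], x, r)) \<le> (\<Sum>i\<in>UNIV. norm (c i t)) * (X * m)"
      unfolding sum_distrib_right
      by (rule order_trans[OF norm_sum sum_mono]) (simp add: norm_mult mult_left_mono V2)
    have 3: "norm (d t * V (True, l, x, r)) \<le> norm (d t) * (\<kappa> * m)"
      unfolding norm_mult by (rule mult_left_mono[OF V1]) simp
    have 4: "norm (e t * V (False, l, x, r)) \<le> norm (e t) * m"
      unfolding norm_mult by (rule mult_left_mono[OF V0]) simp
    have tri: "norm (p - q - u - v) \<le> norm p + norm q + norm u + norm v" for p q u v :: complex
      using norm_triangle_ineq4[of "p - q - u" v] norm_triangle_ineq4[of "p - q" u] norm_triangle_ineq4[of p q] by linarith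
    have "wave_op a c d e t V (b, l, x, r) = (\<Sum>i\<in>UNIV. a i t * V (False, l @ [i, i], x, r))
        - (\<Sum>i\<in>UNIV. c i t * V (False, l @ [i], x, r)) - d t * V (True, l, x, r) - e t * V (False, l, x, r)"
      using True by (simp add: wave_op_def)
    also have "norm \<dots> \<le> (\<Sum>i\<in>UNIV. norm (a i t)) * (X ^ 2 * m)
        + (\<Sum>i\<in>UNIV. norm (c i t)) * (X * m) + norm (d t) * (\<kappa> * m) + norm (e t) * m"
      by (rule order_trans[OF tri]) (intro add_mono 1 2 3 4)
    also have "\<dots> = (((\<Sum>i\<in>UNIV. norm (a i t)) * X ^ 2 + (\<Sum>i\<in>UNIV. norm (c i t)) * X + norm (e t)) / \<kappa> + norm (d t)) * (\<kappa> * m)"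
      using \<kappa>(1) by (simp add: field_simps)
    also have "\<dots> \<le> k * (\<kappa> * m)" using k m \<kappa>(1) by (intro mult_right_mono) auto
    finally show ?thesis using True by (simp add: m_def mult_ac)
  next
    case False
    have "\<kappa> * m \<le> k * m" using \<kappa>(2) m by (rule mult_right_mono)
    then show ?thesis using False V1 by (simp add: wave_op_def m_def)
  qed
qed

lemma coordinate_has_vector_derivative:
  assumes "\<And>l x. ((\<lambda>t. D t l x) has_vector_derivative D' l x) F"
  shows "((\<lambda>t. coordinate (D t) l x r) has_vector_derivative coordinate D' l x r) F"
  by (cases r) (auto intro!: has_vector_derivative_diff has_vector_derivative_sum assms
     bounded_linear.has_vector_derivative[OF bounded_linear_scaleR_right])

text \<open>The Picard limit \<open>Y\<close> has values and remainders as independent unknowns. The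
  discrepancy \<open>D\<close> between a remainder unknown and the Taylor remainder formed from the
  value unknowns solves the homogeneous system with zero data, hence vanishes. The weighted bound of
  the remainder unknowns thereby becomes the remainder estimate of \<open>etype\<close>, which makes
  the members of \<open>U t\<close> and \<open>V t\<close> true space derivatives.\<close>

lemma regularised_cauchy_solution:
  fixes a c :: "'n::finite \<Rightarrow> real \<Rightarrow> complex" and G0 G1 :: "'n list \<Rightarrow> real ^ 'n \<Rightarrow> complex"
  assumes T: "T > 0" and \<kappa>: "\<kappa> > 0" and X: "X \<ge> 0"
    and cont: "\<And>i. continuous_on {0..T} (a i)" "\<And>i. continuous_on {0..T} (c i)"
      "continuous_on {0..T} d" "continuous_on {0..T} e"
    and k: "\<And>t. t \<in> {0..T} \<Longrightarrow> \<kappa> \<le> k t" "\<And>t. t \<in> {0..T} \<Longrightarrow> k t \<le> kmax"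
      "\<And>t. t \<in> {0..T} \<Longrightarrow> ((\<Sum>i\<in>UNIV. norm (a i t)) * X ^ 2 + (\<Sum>i\<in>UNIV. norm (c i t)) * X + norm (e t)) / \<kappa>
        + norm (d t) \<le> k t"
    and K: "\<And>t. t \<in> {0..T} \<Longrightarrow> (K has_real_derivative k t) (at t)" "\<And>t. t \<in> {0..T} \<Longrightarrow> 0 \<le> K t"
    and G: "etype M0 X G0" "etype M1 X G1"
    and F: "\<And>t. t \<in> {0..T} \<Longrightarrow> etype MF X (F t)" "\<And>l x. continuous_on {0..T} (\<lambda>t. F t l x)"
  obtains U V where
    "U 0 = G0" "V 0 = G1"
    "\<And>t l x. t \<in> {0..T} \<Longrightarrow> ((\<lambda>t. U t l x) has_vector_derivative V t l x) (at t within {0..T})"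
    "\<And>t l x. t \<in> {0..T} \<Longrightarrow> ((\<lambda>t. V t l x) has_vector_derivative
       F t l x + ((\<Sum>i\<in>UNIV. a i t * U t (l @ [i, i]) x) - (\<Sum>i\<in>UNIV. c i t * U t (l @ [i]) x)
         - d t * V t l x - e t * U t l x)) (at t within {0..T})"
    "\<And>t. t \<in> {0..T} \<Longrightarrow> etype ((M0 + (M1 + T * MF) / \<kappa>) * exp (K t)) X (U t)"
    "\<And>t. t \<in> {0..T} \<Longrightarrow> etype (\<kappa> * ((M0 + (M1 + T * MF) / \<kappa>) * exp (K t))) X (V t)"
proof -
  let ?A = "wave_op a c d e"
  have M: "M0 \<ge> 0" "M1 \<ge> 0" "MF \<ge> 0"
    using etype_nonneg[OF G(1)] etype_nonneg[OF G(2)] etype_nonneg[OF F(1)[of 0]] T by auto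
  \<comment> \<open>Size of the zeroth Picard term: the initial time derivative and the source
    accumulated over \<open>{0..T}\<close> are measured in units of \<kappa>.\<close>
  define C where "C = M0 + (M1 + T * MF) / \<kappa>"
  have C: "C \<ge> 0" using M T \<kappa> by (simp add: C_def)
  define wt where "wt \<rho> = (\<lambda>(b, l :: 'n list, x :: real ^ 'n, r). (if b then \<kappa> else 1) * X ^ length l * \<rho> r)"
    for \<rho> :: "(real ^ 'n) option \<Rightarrow> real"
  have bd: "norm (?A t V i) \<le> k t * (M * wt \<rho> i)"
    if "t \<in> {0..T}" "\<And>i. norm (V i) \<le> M * wt \<rho> i" for t V M \<rho> i
  proof -
    obtain b l x r where i: "i = (b, l, x, r)" by (cases i)
    have "norm (?A t V (b, l, x, r)) \<le> k t * (M * ((if b then \<kappa> else 1) * X ^ length l * \<rho> r))"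
    proof (rule wave_op_bound)
      show "\<kappa> > 0" by (rule \<kappa>)
      show "\<kappa> \<le> k t" by (rule k(1)[OF that(1)])
      show "((\<Sum>i\<in>UNIV. norm (a i t)) * X ^ 2 + (\<Sum>i\<in>UNIV. norm (c i t)) * X + norm (e t)) / \<kappa> + norm (d t) \<le> k t"
        by (rule k(3)[OF that(1)])
      show "norm (V (b, l, x, r)) \<le> M * ((if b then \<kappa> else 1) * X ^ length l * \<rho> r)" for b l x r
        using that(2)[of "(b, l, x, r)"] by (simp add: wt_def)
    qed
    then show ?thesis by (simp add: wt_def i)
  qed
  have wt_nonneg: "wt \<rho> i \<ge> 0" if "\<And>r. \<rho> r \<ge> 0" for \<rho> i
    using that \<kappa> X by (cases i) (simp add: wt_def)
  have rw: "remainder_weight X r \<ge> 0" for r :: "(real ^ 'n) option"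
    by (cases r) (simp_all add: remainder_weight_def)
  have k0: "0 \<le> k t" if "t \<in> {0..T}" for t using k(1)[OF that] \<kappa> by simp
  have Fc: "continuous_on {0..T} (\<lambda>t. coordinate (F t) l x r)" for l x r
    by (cases r) (auto intro!: continuous_intros F(2))
  \<comment> \<open>Zeroth Picard term: initial data plus integrated source, in coordinates. The
    source acts on the time derivative only.\<close>
  define S where "S t = (\<lambda>(b, l, x, r). if b then coordinate G1 l x r + integral {0..t} (\<lambda>s. coordinate (F s) l x r)
      else coordinate G0 l x r)" for t :: real
  define S' where "S' t = (\<lambda>(b, l, x, r). if b then coordinate (F t) l x r else 0)" for t :: real
  have S': "((\<lambda>t. S t i) has_vector_derivative S' t i) (at t within {0..T})" if t: "t \<in> {0..T}" for t i
  proof -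
    obtain b l x r where i: "i = (b, l, x, r)" by (cases i)
    have "((\<lambda>t. integral {0..t} (\<lambda>s. coordinate (F s) l x r)) has_vector_derivative coordinate (F t) l x r) (at t within {0..T})"
      by (rule integral_has_vector_derivative) (rule Fc, rule t)
    from has_vector_derivative_add[OF has_vector_derivative_const[of "coordinate G1 l x r"] this]
    have *: "((\<lambda>t. coordinate G1 l x r + integral {0..t} (\<lambda>s. coordinate (F s) l x r)) has_vector_derivative
        coordinate (F t) l x r) (at t within {0..T})" by (simp only: add_0_left)
    show ?thesis
    proof (cases b)
      case True
      with * show ?thesis by (simp only: i S_def S'_def prod.case if_True)
    next
      case False
      then show ?thesis by (simp only: i S_def S'_def prod.case if_False has_vector_derivative_const)
    qed
  qed
  have Sbd: "norm (S t i) \<le> C * wt (remainder_weight X) i" if t: "t \<in> {0..T}" for t i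
  proof -
    obtain b l x r where i: "i = (b, l, x, r)" by (cases i)
    let ?w = "X ^ length l * remainder_weight X r"
    have w: "?w \<ge> 0" using X rw by simp
    have g0: "norm (coordinate G0 l x r) \<le> M0 * ?w" and g1: "norm (coordinate G1 l x r) \<le> M1 * ?w"
      using G unfolding etype_iff_coordinate by blast+
    show ?thesis
    proof (cases b)
      case True
      have "norm (integral {0..t} (\<lambda>s. coordinate (F s) l x r)) \<le> (MF * ?w) * (t - 0)"
      proof (rule integral_bound)
        show "norm (coordinate (F s) l x r) \<le> MF * ?w" if "s \<in> {0..t}" for s
          using F(1)[of s] that t unfolding etype_iff_coordinate by auto
      qed (use t in \<open>auto intro: continuous_on_subset[OF Fc]\<close>)
      also have "\<dots> \<le> (MF * ?w) * T" using t M(3) w by (intro mult_left_mono) auto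
      finally have "norm (S t i) \<le> M1 * ?w + (MF * ?w) * T"
        using True g1 by (simp add: S_def i) (intro order_trans[OF norm_triangle_ineq] add_mono)
      also have "\<dots> = (M1 + T * MF) * ?w" by (simp only: ring_distribs mult_ac)
      also have "\<dots> = (M1 + T * MF) / \<kappa> * (\<kappa> * ?w)" using \<kappa> by simp
      also have "\<dots> \<le> C * (\<kappa> * ?w)" using M(1) \<kappa> w unfolding C_def by (intro mult_right_mono) auto
      finally show ?thesis using True by (simp add: wt_def i mult_ac)
    next
      case False
      have "M0 * ?w \<le> C * ?w" using w M T \<kappa> unfolding C_def by (intro mult_right_mono) auto
      then show ?thesis using False g0 by (simp add: S_def wt_def i)
    qed
  qed
  obtain Y where Y: "\<And>i. Y 0 i = S 0 i"
    "\<And>t i. t \<in> {0..T} \<Longrightarrow> ((\<lambda>t. Y t i) has_vector_derivative S' t i + ?A t (Y t) i) (at t within {0..T})"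
    "\<And>t i. t \<in> {0..T} \<Longrightarrow> norm (Y t i) \<le> C * exp (K t) * wt (remainder_weight X) i"
  proof (rule weighted_ode_solution[where A = ?A and w = "wt (remainder_weight X)" and k = k and K = K
        and kmax = kmax and ?V0.0 = S and F = S' and C = C and T = T])
    note witness = that
    show "T > 0" "C \<ge> 0" by (fact T C)+
    show "wt (remainder_weight X) i \<ge> 0" for i by (rule wt_nonneg[OF rw])
    show "?A t (\<lambda>i. V i + W i) i = ?A t V i + ?A t W i" for t V W i by (rule wave_op_add)
    show "continuous_on {0..T} (\<lambda>t. ?A t (V t) i)" if "\<And>i. continuous_on {0..T} (\<lambda>t. V t i)" for V i
      by (rule wave_op_continuous[OF cont that])
    show "norm (?A t V i) \<le> k t * (M * wt (remainder_weight X) i)"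
      if "t \<in> {0..T}" "\<And>i. norm (V i) \<le> M * wt (remainder_weight X) i" for t V M i
      by (rule bd[OF that])
    fix t assume t: "t \<in> {0..T}"
    show "(K has_real_derivative k t) (at t)" by (rule K(1)[OF t])
    show "0 \<le> K t" by (rule K(2)[OF t])
    show "0 \<le> k t" by (rule k0[OF t])
    show "k t \<le> kmax" by (rule k(2)[OF t])
    show "((\<lambda>t. S t i) has_vector_derivative S' t i) (at t within {0..T})" for i by (rule S'[OF t])
    show "norm (S t i) \<le> C * wt (remainder_weight X) i" for i by (rule Sbd[OF t])
  next
    note witness = that
    show thesis if "\<And>i. V 0 i = S 0 i"
      "\<And>t i. t \<in> {0..T} \<Longrightarrow> ((\<lambda>t. V t i) has_vector_derivative S' t i + ?A t (V t) i) (at t within {0..T})"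
      "\<And>t i. t \<in> {0..T} \<Longrightarrow> norm (V t i) \<le> C * exp (K t) * wt (remainder_weight X) i" for V
      by (rule witness[OF that])
  qed
  define D where "D t = (\<lambda>(b, l, x, r). case r of None \<Rightarrow> 0
      | Some h \<Rightarrow> Y t (b, l, x, Some h) - coordinate (\<lambda>l x. Y t (b, l, x, None)) l x (Some h))" for t
  \<comment> \<open>The Taylor remainder formed from values is so far controlled by the triangle
    inequality only: two values and a gradient term, with linear growth in the increment. The weight
    for uniqueness has to allow for this in addition to the quadratic one.\<close>
  define \<rho>' where "\<rho>' r = (case r of None \<Rightarrow> 1 | Some h \<Rightarrow> remainder_weight X (Some h) + 2 + real CARD('n) * X * norm h)"
    for r :: "(real ^ 'n) option"
  have \<rho>': "\<rho>' r \<ge> 0" for r using rw X by (cases r) (auto simp: \<rho>'_def intro!: add_nonneg_nonneg)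
  have Kmax: "K t \<le> K T" if "t \<in> {0..T}" for t
  proof (rule DERIV_nonneg_imp_nondecreasing[of t T K])
    show "\<exists>y. (K has_real_derivative y) (at x) \<and> 0 \<le> y" if "t \<le> x" "x \<le> T" for x
      using K(1)[of x] k0[of x] that \<open>t \<in> {0..T}\<close> by auto
  qed (use that in auto)
  have D0: "D t i = 0" if t: "t \<in> {0..T}" for t i
  proof (rule weighted_ode_unique[where A = ?A and w = "wt \<rho>'" and k = k and K = K and C = "C * exp (K T)" and T = T])
    show "T > 0" by (rule T)
    show "wt \<rho>' i \<ge> 0" for i by (rule wt_nonneg[OF \<rho>'])
    show "continuous_on {0..T} (\<lambda>t. ?A t (V t) i)" if "\<And>i. continuous_on {0..T} (\<lambda>t. V t i)" for V i
      by (rule wave_op_continuous[OF cont that])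
    show "norm (?A t V i) \<le> k t * (M * wt \<rho>' i)"
      if "t \<in> {0..T}" "\<And>i. norm (V i) \<le> M * wt \<rho>' i" for t V M i
      by (rule bd[OF that])
    show "(K has_real_derivative k t) (at t)" "0 \<le> K t" if "t \<in> {0..T}" for t
      by (rule K(1)[OF that], rule K(2)[OF that])
    show "t \<in> {0..T}" by (rule t)
    show "0 \<le> C * exp (K T)" using C by simp
    show "D 0 i = 0" for i
    proof -
      obtain b l x r where i: "i = (b, l, x, r)" by (cases i)
      show ?thesis by (cases r; cases b) (simp_all add: D_def i Y(1) S_def)
    qed
    fix t :: real and i :: "'n coord" assume t: "t \<in> {0..T}"
    obtain b l x r where i: "i = (b, l, x, r)" by (cases i)
    show "((\<lambda>t. D t i) has_vector_derivative ?A t (D t) i) (at t within {0..T})"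
    proof (cases r)
      case None
      have "?A t (D t) i = 0" by (simp add: wave_op_def D_def i None)
      then show ?thesis by (simp add: D_def i None)
    next
      case (Some h)
      have "((\<lambda>t. Y t (b, l, x, Some h) - coordinate (\<lambda>l x. Y t (b, l, x, None)) l x (Some h)) has_vector_derivative
          (S' t (b, l, x, Some h) + ?A t (Y t) (b, l, x, Some h))
            - coordinate (\<lambda>l x. S' t (b, l, x, None) + ?A t (Y t) (b, l, x, None)) l x (Some h)) (at t within {0..T})"
        by (intro has_vector_derivative_diff coordinate_has_vector_derivative Y(2) t)
      moreover have "(S' t (b, l, x, Some h) + ?A t (Y t) (b, l, x, Some h))
            - coordinate (\<lambda>l x. S' t (b, l, x, None) + ?A t (Y t) (b, l, x, None)) l x (Some h) = ?A t (D t) (b, l, x, Some h)"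
      proof (cases b)
        case True
        \<comment> \<open>Exchanging the finite sums over appended and prepended letters is all that
          the commutation of the operator with remainders amounts to.\<close>
        have sw: "(\<Sum>j\<in>UNIV. (h $ j) *\<^sub>R (\<Sum>i\<in>UNIV. p i * q i j)) = (\<Sum>i\<in>UNIV. p i * (\<Sum>j\<in>UNIV. (h $ j) *\<^sub>R (q i j :: complex)))"
          for p :: "'n \<Rightarrow> complex" and q
        proof -
          have "(\<Sum>j\<in>UNIV. (h $ j) *\<^sub>R (\<Sum>i\<in>UNIV. p i * q i j)) = (\<Sum>j\<in>UNIV. \<Sum>i\<in>UNIV. p i * ((h $ j) *\<^sub>R q i j))"
            by (simp add: scaleR_sum_right)
          also have "\<dots> = (\<Sum>i\<in>UNIV. \<Sum>j\<in>UNIV. p i * ((h $ j) *\<^sub>R q i j))" by (rule sum.swap)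
          finally show ?thesis by (simp only: sum_distrib_left)
        qed
        have sw1: "(\<Sum>j\<in>UNIV. (h $ j) *\<^sub>R (p * q j)) = p * (\<Sum>j\<in>UNIV. (h $ j) *\<^sub>R (q j :: complex))" for p :: complex and q
          by (simp add: sum_distrib_left)
        show ?thesis using True
          by (simp add: S'_def wave_op_def D_def right_diff_distrib sum_subtractf sum.distrib scaleR_add_right
              scaleR_diff_right sw sw1)
      next
        case False
        then show ?thesis by (simp add: S'_def wave_op_def D_def)
      qed
      ultimately show ?thesis by (simp add: D_def i Some)
    qed
    show "norm (D t i) \<le> C * exp (K T) * wt \<rho>' i"
    proof (cases r)
      case None
      then show ?thesis using C wt_nonneg[of \<rho>', OF \<rho>'] by (simp add: D_def i)
    next
      case (Some h)
      define q where "q = C * exp (K T) * ((if b then \<kappa> else 1) * X ^ length l)"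
      have q: "q \<ge> 0" using C \<kappa> X by (simp add: q_def)
      have Yq: "norm (Y t j) \<le> C * exp (K T) * wt (remainder_weight X) j" for j
        using Kmax[OF t] C wt_nonneg[of "remainder_weight X", OF rw]
        by (intro order_trans[OF Y(3)[OF t]] mult_right_mono mult_left_mono) auto
      have y1: "norm (Y t (b, l, x, Some h)) \<le> q * remainder_weight X (Some h)"
        using Yq[of "(b, l, x, Some h)"] by (simp add: wt_def q_def mult_ac)
      have y2: "norm (Y t (b, l, x', None)) \<le> q" for x'
        using Yq[of "(b, l, x', None)"] by (simp add: wt_def q_def remainder_weight_def mult_ac)
      have y3: "norm (\<Sum>j\<in>UNIV. (h $ j) *\<^sub>R Y t (b, j # l, x, None)) \<le> real CARD('n) * (q * X) * norm h"
      proof (rule norm_sum_component_le)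
        show "norm (Y t (b, j # l, x, None)) \<le> q * X" for j
          using Yq[of "(b, j # l, x, None)"] by (simp add: wt_def q_def remainder_weight_def mult_ac)
      qed
      have tri: "norm (p - (u - v - z)) \<le> norm p + (norm u + norm v + norm z)" for p u v z :: complex
        using norm_triangle_ineq4[of p "u - v - z"] norm_triangle_ineq4[of "u - v" z] norm_triangle_ineq4[of u v] by linarith
      have "D t i = Y t (b, l, x, Some h) - (Y t (b, l, x + h, None) - Y t (b, l, x, None)
          - (\<Sum>j\<in>UNIV. (h $ j) *\<^sub>R Y t (b, j # l, x, None)))"
        using Some by (simp add: D_def i)
      also have "norm \<dots> \<le> q * remainder_weight X (Some h) + (q + q + real CARD('n) * (q * X) * norm h)"
        by (rule order_trans[OF tri]) (intro add_mono y1 y2 y3)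
      also have "\<dots> = q * \<rho>' (Some h)" by (simp add: \<rho>'_def ring_distribs mult_ac)
      finally show ?thesis using Some by (simp add: wt_def q_def i mult_ac)
    qed
  qed
  define U where "U t l x = Y t (False, l, x, None)" for t l x
  define V where "V t l x = Y t (True, l, x, None)" for t l x
  have coord: "coordinate (\<lambda>l x. Y t (b, l, x, None)) l x r = Y t (b, l, x, r)" if "t \<in> {0..T}" for t b l x r
    using D0[OF that, of "(b, l, x, r)"] by (cases r) (simp_all add: D_def)
  show ?thesis
  proof (rule that[of U V])
    show "U 0 = G0" "V 0 = G1" by (simp_all add: U_def V_def Y(1) S_def fun_eq_iff)
    fix t assume t: "t \<in> {0..T}"
    show "((\<lambda>t. U t l x) has_vector_derivative V t l x) (at t within {0..T})" for l x
      using Y(2)[OF t, of "(False, l, x, None)"] by (simp add: U_def V_def S'_def wave_op_def)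
    show "((\<lambda>t. V t l x) has_vector_derivative
       F t l x + ((\<Sum>i\<in>UNIV. a i t * U t (l @ [i, i]) x) - (\<Sum>i\<in>UNIV. c i t * U t (l @ [i]) x)
         - d t * V t l x - e t * U t l x)) (at t within {0..T})" for l x
      using Y(2)[OF t, of "(True, l, x, None)"] by (simp add: U_def V_def S'_def wave_op_def)
    show "etype ((M0 + (M1 + T * MF) / \<kappa>) * exp (K t)) X (U t)"
      unfolding etype_iff_coordinate C_def[symmetric] U_def[abs_def] coord[OF t]
      using Y(3)[OF t, of "(False, _, _, _)"] by (simp add: wt_def)
    show "etype (\<kappa> * ((M0 + (M1 + T * MF) / \<kappa>) * exp (K t))) X (V t)"
      unfolding etype_iff_coordinate C_def[symmetric] V_def[abs_def] coord[OF t]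
      using Y(3)[OF t, of "(True, _, _, _)"] by (simp add: wt_def mult_ac)
  qed
qed

section \<open>Nets of functions of exponential type\<close>

lemma has_vector_derivative_cong_on:
  assumes "\<And>t. t \<in> S \<Longrightarrow> f t = g t" "t \<in> S"
  shows "(f has_vector_derivative d) (at t within S) \<longleftrightarrow> (g has_vector_derivative d) (at t within S)"
  unfolding has_vector_derivative_def
proof
  assume "(f has_derivative (\<lambda>x. x *\<^sub>R d)) (at t within S)"
  then show "(g has_derivative (\<lambda>x. x *\<^sub>R d)) (at t within S)"
    by (rule has_derivative_transform[OF assms(2), rotated]) (rule assms(1)[symmetric])
next
  assume "(g has_derivative (\<lambda>x. x *\<^sub>R d)) (at t within S)"
  then show "(f has_derivative (\<lambda>x. x *\<^sub>R d)) (at t within S)"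
    by (rule has_derivative_transform[OF assms(2), rotated]) (rule assms(1))
qed

lemma dt_eq:
  assumes "T > 0" "t \<in> {0..T}" "((\<lambda>t. h t x) has_vector_derivative d) (at t within {0..T})"
  shows "dt T h t x = d"
  unfolding dt_def using assms by (intro vector_derivative_within_closed_interval) auto

lemma dt_cong:
  assumes "\<And>t. t \<in> {0..T} \<Longrightarrow> h t x = h' t x" "t \<in> {0..T}"
  shows "dt T h t x = dt T h' t x"
proof -
  have "((\<lambda>t. h t x) has_vector_derivative d) (at t within {0..T}) \<longleftrightarrow>
      ((\<lambda>t. h' t x) has_vector_derivative d) (at t within {0..T})" for d
    by (rule has_vector_derivative_cong_on) (rule assms(1), assumption, rule assms(2))
  then show ?thesis by (simp add: dt_def vector_derivative_def)
qed

lemma funpow_dt_cong: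
  assumes "\<And>t. t \<in> {0..T} \<Longrightarrow> h t x = h' t x" "t \<in> {0..T}"
  shows "(dt T ^^ k) h t x = (dt T ^^ k) h' t x"
  using assms(2)
proof (induction k arbitrary: t)
  case 0
  then show ?case using assms(1) by simp
next
  case (Suc k)
  have "dt T ((dt T ^^ k) h) t x = dt T ((dt T ^^ k) h') t x"
    by (rule dt_cong) (rule Suc.IH, assumption, rule Suc.prems)
  then show ?case by simp
qed

definition mbounded :: "real \<Rightarrow> (real \<Rightarrow> real) \<Rightarrow> (real \<Rightarrow> real \<Rightarrow> 'i list \<Rightarrow> 'x \<Rightarrow> complex) \<Rightarrow> bool"
  where "mbounded T X W \<longleftrightarrow> (\<exists>m. moderate m \<and>
    (\<forall>\<epsilon>\<in>{0<..1}. \<forall>t\<in>{0..T}. \<forall>l x. norm (W \<epsilon> t l x) \<le> m \<epsilon> * X \<epsilon> ^ length l))"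

text \<open>Moderate bounds for \<open>W\<close> and \<open>k\<close> of its time derivatives. The
  derivative net is existential and the definition recursive, so that time regularity can be raised
  one order at a time from a differential equation.\<close>

primrec mnet :: "real \<Rightarrow> (real \<Rightarrow> real) \<Rightarrow> nat \<Rightarrow> (real \<Rightarrow> real \<Rightarrow> 'i list \<Rightarrow> 'x \<Rightarrow> complex) \<Rightarrow> bool"
  where
    "mnet T X 0 W \<longleftrightarrow> mbounded T X W"
  | "mnet T X (Suc k) W \<longleftrightarrow> mbounded T X W \<and> (\<exists>W'. mnet T X k W' \<and>
       (\<forall>\<epsilon>\<in>{0<..1}. \<forall>t\<in>{0..T}. \<forall>l x. ((\<lambda>t. W \<epsilon> t l x) has_vector_derivative W' \<epsilon> t l x) (at t within {0..T})))"

lemma mnet_0I: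
  assumes "moderate m" "\<And>\<epsilon> t l x. \<epsilon> \<in> {0<..1} \<Longrightarrow> t \<in> {0..T} \<Longrightarrow> norm (W \<epsilon> t l x) \<le> m \<epsilon> * X \<epsilon> ^ length l"
  shows "mnet T X 0 W"
  using assms by (auto simp: mbounded_def)

lemma mnet_0E:
  assumes "mnet T X 0 W"
  obtains m where "moderate m" "\<And>\<epsilon> t l x. \<epsilon> \<in> {0<..1} \<Longrightarrow> t \<in> {0..T} \<Longrightarrow> norm (W \<epsilon> t l x) \<le> m \<epsilon> * X \<epsilon> ^ length l"
  using assms unfolding mnet.simps(1) mbounded_def by (elim exE conjE) (rule that, assumption, blast)

lemma mnet_SucI:
  assumes "mnet T X 0 W" "mnet T X k W'"
    "\<And>\<epsilon> t l x. \<epsilon> \<in> {0<..1} \<Longrightarrow> t \<in> {0..T} \<Longrightarrow> ((\<lambda>t. W \<epsilon> t l x) has_vector_derivative W' \<epsilon> t l x) (at t within {0..T})"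
  shows "mnet T X (Suc k) W"
  unfolding mnet.simps(2) mnet.simps(1)[symmetric] using assms by (intro conjI exI[of _ W']) auto

lemma mnet_SucE:
  assumes "mnet T X (Suc k) W"
  obtains W' where "mnet T X 0 W" "mnet T X k W'"
    "\<And>\<epsilon> t l x. \<epsilon> \<in> {0<..1} \<Longrightarrow> t \<in> {0..T} \<Longrightarrow> ((\<lambda>t. W \<epsilon> t l x) has_vector_derivative W' \<epsilon> t l x) (at t within {0..T})"
  using assms unfolding mnet.simps(2) mnet.simps(1)[symmetric] by (elim exE conjE) (rule that, assumption, assumption, blast)

declare mnet.simps [simp del]

lemma mnet_zero: "mnet T X k W \<Longrightarrow> mnet T X 0 W"
  by (cases k) (auto elim: mnet_SucE)

lemma mnet_lower: "mnet T X (Suc k) W \<Longrightarrow> mnet T X k W"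
proof (induction k arbitrary: W)
  case 0
  then show ?case by (rule mnet_zero)
next
  case (Suc k)
  obtain W' where W': "mnet T X 0 W" "mnet T X (Suc k) W'"
    "\<And>\<epsilon> t l x. \<epsilon> \<in> {0<..1} \<Longrightarrow> t \<in> {0..T} \<Longrightarrow> ((\<lambda>t. W \<epsilon> t l x) has_vector_derivative W' \<epsilon> t l x) (at t within {0..T})"
    by (rule mnet_SucE[OF Suc.prems]) (rule that)
  show ?case by (rule mnet_SucI[OF W'(1) Suc.IH[OF W'(2)] W'(3)])
qed

lemma mnet_add:
  assumes "mnet T X k V" "mnet T X k W" and X: "\<And>\<epsilon>. X \<epsilon> \<ge> 0"
  shows "mnet T X k (\<lambda>\<epsilon> t l x. V \<epsilon> t l x + W \<epsilon> t l x)"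
  using assms(1,2)
proof (induction k arbitrary: V W)
  case 0
  obtain m where m: "moderate m" "\<And>\<epsilon> t l x. \<epsilon> \<in> {0<..1} \<Longrightarrow> t \<in> {0..T} \<Longrightarrow> norm (V \<epsilon> t l x) \<le> m \<epsilon> * X \<epsilon> ^ length l"
    by (rule mnet_0E[OF 0(1)]) (rule that)
  obtain m' where m': "moderate m'" "\<And>\<epsilon> t l x. \<epsilon> \<in> {0<..1} \<Longrightarrow> t \<in> {0..T} \<Longrightarrow> norm (W \<epsilon> t l x) \<le> m' \<epsilon> * X \<epsilon> ^ length l"
    by (rule mnet_0E[OF 0(2)]) (rule that)
  show ?case
  proof (rule mnet_0I[OF moderate_add[OF m(1) m'(1)]])
    fix \<epsilon> t l x assume "\<epsilon> \<in> {0<..1::real}" "t \<in> {0..T}"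
    then show "norm (V \<epsilon> t l x + W \<epsilon> t l x) \<le> (m \<epsilon> + m' \<epsilon>) * X \<epsilon> ^ length l"
      unfolding distrib_right by (intro order_trans[OF norm_triangle_ineq] add_mono m m')
  qed
next
  case (Suc k)
  obtain V' where V': "mnet T X 0 V" "mnet T X k V'"
    "\<And>\<epsilon> t l x. \<epsilon> \<in> {0<..1} \<Longrightarrow> t \<in> {0..T} \<Longrightarrow> ((\<lambda>t. V \<epsilon> t l x) has_vector_derivative V' \<epsilon> t l x) (at t within {0..T})"
    by (rule mnet_SucE[OF Suc.prems(1)]) (rule that)
  obtain W' where W': "mnet T X 0 W" "mnet T X k W'"
    "\<And>\<epsilon> t l x. \<epsilon> \<in> {0<..1} \<Longrightarrow> t \<in> {0..T} \<Longrightarrow> ((\<lambda>t. W \<epsilon> t l x) has_vector_derivative W' \<epsilon> t l x) (at t within {0..T})"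
    by (rule mnet_SucE[OF Suc.prems(2)]) (rule that)
  have "mnet T X k (\<lambda>\<epsilon> t l x. V \<epsilon> t l x + W \<epsilon> t l x)"
    by (rule Suc.IH[OF mnet_lower[OF Suc.prems(1)] mnet_lower[OF Suc.prems(2)]])
  from mnet_SucI[OF mnet_zero[OF this] Suc.IH[OF V'(2) W'(2)]] show ?case
    using V'(3) W'(3) by (simp add: has_vector_derivative_add)
qed

definition snet :: "real \<Rightarrow> (real \<Rightarrow> nat \<Rightarrow> real \<Rightarrow> complex) \<Rightarrow> bool"
  where "snet T H \<longleftrightarrow> (\<forall>\<epsilon>\<in>{0<..1}. dseq (H \<epsilon>)) \<and>
    (\<forall>k. \<exists>m. moderate m \<and> (\<forall>\<epsilon>\<in>{0<..1}. \<forall>t\<in>{0..T}. norm (H \<epsilon> k t) \<le> m \<epsilon>))"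

lemma snet_Suc: "snet T H \<Longrightarrow> snet T (\<lambda>\<epsilon> k. H \<epsilon> (Suc k))"
  unfolding snet_def dseq_def by blast

lemma snet_const: "snet T (\<lambda>\<epsilon> k t. if k = 0 then z else 0)"
  unfolding snet_def dseq_def
proof (intro conjI ballI allI)
  fix k
  show "\<exists>m. moderate m \<and> (\<forall>\<epsilon>\<in>{0<..1}. \<forall>t\<in>{0..T}. norm (if k = 0 then z else 0) \<le> m \<epsilon>)"
    by (intro exI[of _ "\<lambda>_. norm z"]) auto
qed auto

text \<open>The product rule differentiates the coefficient too, so the induction runs over all
  \<open>H\<close> and the shifted net takes its place.\<close>

lemma mnet_mult:
  assumes "mnet T X k W" "snet T H" and X: "\<And>\<epsilon>. X \<epsilon> \<ge> 0"
  shows "mnet T X k (\<lambda>\<epsilon> t l x. H \<epsilon> 0 t * W \<epsilon> t l x)"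
  using assms(1,2)
proof (induction k arbitrary: W H)
  case 0
  obtain m where m: "moderate m" "\<And>\<epsilon> t l x. \<epsilon> \<in> {0<..1} \<Longrightarrow> t \<in> {0..T} \<Longrightarrow> norm (W \<epsilon> t l x) \<le> m \<epsilon> * X \<epsilon> ^ length l"
    by (rule mnet_0E[OF 0(1)]) (rule that)
  from 0(2)[unfolded snet_def, THEN conjunct2, THEN spec, of 0]
  obtain m' where m': "moderate m'" "\<forall>\<epsilon>\<in>{0<..1}. \<forall>t\<in>{0..T}. norm (H \<epsilon> 0 t) \<le> m' \<epsilon>"
    by (elim exE conjE) (rule that)
  show ?case
  proof (rule mnet_0I[OF moderate_mult[OF m'(1) m(1)]])
    fix \<epsilon> t l x assume e: "\<epsilon> \<in> {0<..1::real}" "t \<in> {0..T}"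
    have h: "norm (H \<epsilon> 0 t) \<le> m' \<epsilon>" using m'(2) e by blast
    have "norm (H \<epsilon> 0 t * W \<epsilon> t l x) \<le> m' \<epsilon> * (m \<epsilon> * X \<epsilon> ^ length l)"
      unfolding norm_mult
      by (rule mult_mono[OF h m(2)[OF e] order_trans[OF norm_ge_zero h] norm_ge_zero])
    then show "norm (H \<epsilon> 0 t * W \<epsilon> t l x) \<le> m' \<epsilon> * m \<epsilon> * X \<epsilon> ^ length l" by (simp only: mult.assoc)
  qed
next
  case (Suc k)
  obtain W' where W': "mnet T X 0 W" "mnet T X k W'"
    "\<And>\<epsilon> t l x. \<epsilon> \<in> {0<..1} \<Longrightarrow> t \<in> {0..T} \<Longrightarrow> ((\<lambda>t. W \<epsilon> t l x) has_vector_derivative W' \<epsilon> t l x) (at t within {0..T})"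
    by (rule mnet_SucE[OF Suc.prems(1)]) (rule that)
  have "mnet T X k (\<lambda>\<epsilon> t l x. H \<epsilon> 0 t * W \<epsilon> t l x)"
    by (rule Suc.IH[OF mnet_lower[OF Suc.prems(1)] Suc.prems(2)])
  then have 0: "mnet T X 0 (\<lambda>\<epsilon> t l x. H \<epsilon> 0 t * W \<epsilon> t l x)" by (rule mnet_zero)
  have 1: "mnet T X k (\<lambda>\<epsilon> t l x. H \<epsilon> 0 t * W' \<epsilon> t l x + H \<epsilon> (Suc 0) t * W \<epsilon> t l x)"
    by (rule mnet_add[OF Suc.IH[OF W'(2) Suc.prems(2)] Suc.IH[OF mnet_lower[OF Suc.prems(1)] snet_Suc[OF Suc.prems(2)]] X])
  show ?case
  proof (rule mnet_SucI[OF 0 1])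
    fix \<epsilon> t l x assume e: "\<epsilon> \<in> {0<..1::real}" "t \<in> {0..T}"
    have "(H \<epsilon> 0 has_vector_derivative H \<epsilon> (Suc 0) t) (at t within {0..T})"
      by (rule has_vector_derivative_at_within[OF dseqD])
         (rule bspec[OF Suc.prems(2)[unfolded snet_def, THEN conjunct1] e(1)])
    from has_vector_derivative_mult[OF this W'(3)[OF e]]
    show "((\<lambda>t. H \<epsilon> 0 t * W \<epsilon> t l x) has_vector_derivative H \<epsilon> 0 t * W' \<epsilon> t l x + H \<epsilon> (Suc 0) t * W \<epsilon> t l x) (at t within {0..T})" .
  qed
qed

text \<open>Appending a fixed word is a space derivative and costs the fixed power
  \<open>X \<epsilon> ^ length w\<close>, which is moderate; hence the class of these nets is closed
  under space derivatives.\<close>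

lemma mnet_append:
  assumes "mnet T X k W" and X: "moderate X"
  shows "mnet T X k (\<lambda>\<epsilon> t l x. W \<epsilon> t (l @ w) x)"
  using assms(1)
proof (induction k arbitrary: W)
  case 0
  obtain m where m: "moderate m" "\<And>\<epsilon> t l x. \<epsilon> \<in> {0<..1} \<Longrightarrow> t \<in> {0..T} \<Longrightarrow> norm (W \<epsilon> t l x) \<le> m \<epsilon> * X \<epsilon> ^ length l"
    by (rule mnet_0E[OF 0(1)]) (rule that)
  show ?case
  proof (rule mnet_0I[OF moderate_mult[OF m(1) moderate_power[OF X, of "length w"]]])
    fix \<epsilon> t l x assume "\<epsilon> \<in> {0<..1::real}" "t \<in> {0..T}"
    from m(2)[OF this, of "l @ w" x] show "norm (W \<epsilon> t (l @ w) x) \<le> m \<epsilon> * X \<epsilon> ^ length w * X \<epsilon> ^ length l"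
      by (simp add: power_add mult_ac)
  qed
next
  case (Suc k)
  obtain W' where W': "mnet T X 0 W" "mnet T X k W'"
    "\<And>\<epsilon> t l x. \<epsilon> \<in> {0<..1} \<Longrightarrow> t \<in> {0..T} \<Longrightarrow> ((\<lambda>t. W \<epsilon> t l x) has_vector_derivative W' \<epsilon> t l x) (at t within {0..T})"
    by (rule mnet_SucE[OF Suc.prems(1)]) (rule that)
  show ?case
    by (rule mnet_SucI[OF mnet_zero[OF Suc.IH[OF mnet_lower[OF Suc.prems]]] Suc.IH[OF W'(2)] W'(3)])
qed

lemma mnet_sum:
  assumes "finite I" "\<And>i. i \<in> I \<Longrightarrow> mnet T X k (W i)" and X: "\<And>\<epsilon>. X \<epsilon> \<ge> 0"
  shows "mnet T X k (\<lambda>\<epsilon> t l x. \<Sum>i\<in>I. W i \<epsilon> t l x)"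
  using assms(1,2)
proof (induction I rule: finite_induct)
  case empty
  have "mnet T X k (\<lambda>_ _ _ _. 0)"
  proof (induction k)
    case 0
    then show ?case by (rule mnet_0I[OF moderate_const[of 0]]) simp
  next
    case (Suc k)
    show ?case by (rule mnet_SucI[OF mnet_zero[OF Suc] Suc]) simp
  qed
  then show ?case by simp
next
  case (insert i I)
  then show ?case using mnet_add[OF insert.prems[of i] insert.IH X] by simp
qed

text \<open>Identifies the existential derivative nets with the iterates of \<open>dt\<close>. The
  spare order \<open>j\<close> is 0 where a bound is wanted and 1 where the derivative itself must
  be differentiable.\<close>

lemma mnet_dt:
  assumes T: "T > 0" and W: "mnet T X (k + j) W"
  obtains Wk where "mnet T X j Wk"
    "\<And>\<epsilon> t l x. \<epsilon> \<in> {0<..1} \<Longrightarrow> t \<in> {0..T} \<Longrightarrow> (dt T ^^ k) (\<lambda>t. W \<epsilon> t l) t x = Wk \<epsilon> t l x"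
proof -
  have "\<exists>Wk. mnet T X j Wk \<and> (\<forall>\<epsilon>\<in>{0<..1}. \<forall>t\<in>{0..T}. \<forall>l x. (dt T ^^ k) (\<lambda>t. W \<epsilon> t l) t x = Wk \<epsilon> t l x)"
    using W
  proof (induction k arbitrary: W)
    case 0
    then show ?case by (intro exI[of _ W]) simp
  next
    case (Suc k)
    have "mnet T X (Suc (k + j)) W" using Suc.prems by simp
    then obtain W' where W': "mnet T X 0 W" "mnet T X (k + j) W'"
      "\<And>\<epsilon> t l x. \<epsilon> \<in> {0<..1} \<Longrightarrow> t \<in> {0..T} \<Longrightarrow> ((\<lambda>t. W \<epsilon> t l x) has_vector_derivative W' \<epsilon> t l x) (at t within {0..T})"
      by (rule mnet_SucE) (rule that)
    from Suc.IH[OF W'(2)] obtain Wk where Wk: "mnet T X j Wk"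
      "\<forall>\<epsilon>\<in>{0<..1}. \<forall>t\<in>{0..T}. \<forall>l x. (dt T ^^ k) (\<lambda>t. W' \<epsilon> t l) t x = Wk \<epsilon> t l x"
      by (elim exE conjE) (rule that)
    have "(dt T ^^ Suc k) (\<lambda>t. W \<epsilon> t l) t x = Wk \<epsilon> t l x" if e: "\<epsilon> \<in> {0<..1}" "t \<in> {0..T}" for \<epsilon> t l x
    proof -
      have "(dt T ^^ Suc k) (\<lambda>t. W \<epsilon> t l) t x = (dt T ^^ k) (dt T (\<lambda>t. W \<epsilon> t l)) t x"
        by (simp only: funpow_Suc_right o_def)
      also have "\<dots> = (dt T ^^ k) (\<lambda>t. W' \<epsilon> t l) t x"
      proof (rule funpow_dt_cong[OF _ e(2)])
        fix t assume t: "t \<in> {0..T}"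
        show "dt T (\<lambda>t. W \<epsilon> t l) t x = W' \<epsilon> t l x" by (rule dt_eq[where h = "\<lambda>t. W \<epsilon> t l", OF T t W'(3)[OF e(1) t]])
      qed
      also have "\<dots> = Wk \<epsilon> t l x" using Wk(2) e by blast
      finally show ?thesis .
    qed
    with Wk(1) show ?case by (intro exI[of _ Wk]) blast
  qed
  then show ?thesis by (elim exE conjE) (rule that, assumption, blast)
qed

section \<open>From exponential type to Gevrey estimates\<close>

lemma mfact_powr_ge_1:
  assumes "s \<ge> 1"
  shows "1 \<le> mfact \<alpha> powr s"
proof -
  have "1 \<le> mfact \<alpha>" unfolding mfact_def by (intro prod_ge_1) (simp add: fact_ge_1)
  then show ?thesis using assms by (intro ge_one_powr_ge_zero) auto
qed

lemma moderateE:
  assumes "moderate m"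
  obtains C N where "C > 0" "\<And>\<epsilon>. \<epsilon> \<in> {0<..1} \<Longrightarrow> m \<epsilon> \<le> C * (1 / \<epsilon>) ^ N"
proof -
  obtain C N where C: "C > 0" "\<forall>\<epsilon>\<in>{0<..1}. \<bar>m \<epsilon>\<bar> \<le> C * (1 / \<epsilon>) ^ N"
    using assms[unfolded moderate_def] by (elim exE conjE) (rule that)
  show ?thesis
  proof (rule that[OF C(1)])
    fix \<epsilon> :: real assume "\<epsilon> \<in> {0<..1}"
    with C(2) have "\<bar>m \<epsilon>\<bar> \<le> C * (1 / \<epsilon>) ^ N" by blast
    then show "m \<epsilon> \<le> C * (1 / \<epsilon>) ^ N" by linarith
  qed
qed

text \<open>Exponential type is stronger than Gevrey regularity: \<open>X ^ k\<close> with
  \<open>X \<le> q * (1 / \<epsilon>)\<close> already has the form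
  \<open>q ^ k * (1 / \<epsilon>) ^ k\<close>, and the factor \<open>g\<close>, which stands for the
  factorial weight, is at least 1 and only enlarges the right-hand side.\<close>

lemma exponential_type_gevrey_bound:
  assumes m: "m \<le> C * (1 / \<epsilon>) ^ N" and X: "0 \<le> X" "X \<le> q * (1 / \<epsilon>)" and q: "q \<ge> 1" and e: "\<epsilon> > 0"
    and C: "C > 0" and g: "g \<ge> (1::real)"
  shows "m * X ^ k \<le> C * (1 / \<epsilon>) ^ N * (q ^ (k + 1) * g * (1 / \<epsilon>) ^ k)"
proof -
  have "m * X ^ k \<le> (C * (1 / \<epsilon>) ^ N) * (q * (1 / \<epsilon>)) ^ k"
    using m X C e by (intro mult_mono power_mono) auto
  also have "(q * (1 / \<epsilon>)) ^ k = q ^ k * 1 * (1 / \<epsilon>) ^ k" by (simp add: power_mult_distrib power_divide)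
  also have "C * (1 / \<epsilon>) ^ N * (q ^ k * 1 * (1 / \<epsilon>) ^ k) \<le> C * (1 / \<epsilon>) ^ N * (q ^ (k + 1) * g * (1 / \<epsilon>) ^ k)"
    using C e q g by (intro mult_left_mono mult_right_mono mult_mono power_increasing) auto
  finally show ?thesis .
qed

lemma mnet_smooth_gevrey_moderate:
  fixes W :: "real \<Rightarrow> real \<Rightarrow> 'n::finite list \<Rightarrow> real ^ 'n \<Rightarrow> complex"
  assumes T: "T > 0" and s: "s \<ge> 1" and W: "\<And>k. mnet T X k W"
    and D: "\<And>\<epsilon> t. \<epsilon> \<in> {0<..1} \<Longrightarrow> t \<in> {0..T} \<Longrightarrow> dfam (W \<epsilon> t)"
    and X: "\<And>\<epsilon>. X \<epsilon> \<ge> 0" "\<And>\<epsilon>. \<epsilon> \<in> {0<..1} \<Longrightarrow> X \<epsilon> \<le> q * (1 / \<epsilon>)" and q: "q \<ge> 1"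
  shows "smooth_gevrey_moderate T s (\<lambda>\<epsilon> t. W \<epsilon> t [])"
proof -
  have dtx: "dtx T k \<alpha> (\<lambda>t. W \<epsilon> t []) t x = (dt T ^^ k) (\<lambda>t. W \<epsilon> t (word \<alpha>)) t x"
    if "\<epsilon> \<in> {0<..1}" "t \<in> {0..T}" for k \<alpha> \<epsilon> t x
    unfolding dtx_def
  proof (rule funpow_dt_cong[OF _ that(2)])
    fix t assume "t \<in> {0..T}"
    then show "mdiff \<alpha> (W \<epsilon> t []) x = W \<epsilon> t (word \<alpha>) x" by (simp only: mdiff_dfam[OF D[OF that(1)]])
  qed
  have bound: "\<exists>C>0. \<exists>N. \<forall>\<epsilon>\<in>{0<..1}. \<forall>\<alpha>. \<forall>t\<in>{0..T}. \<forall>x. norm (dtx T k \<alpha> (\<lambda>t. W \<epsilon> t []) t x)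
      \<le> C * (1 / \<epsilon>) ^ N * (q ^ (mlen \<alpha> + 1) * mfact \<alpha> powr s * (1 / \<epsilon>) ^ mlen \<alpha>)" for k
  proof -
    have "mnet T X (k + 0) W" using W by simp
    then obtain Wk where Wk: "mnet T X 0 Wk"
      "\<And>\<epsilon> t l x. \<epsilon> \<in> {0<..1} \<Longrightarrow> t \<in> {0..T} \<Longrightarrow> (dt T ^^ k) (\<lambda>t. W \<epsilon> t l) t x = Wk \<epsilon> t l x"
      by (rule mnet_dt[OF T]) (rule that)
    obtain m where m: "moderate m" "\<And>\<epsilon> t l x. \<epsilon> \<in> {0<..1} \<Longrightarrow> t \<in> {0..T} \<Longrightarrow> norm (Wk \<epsilon> t l x) \<le> m \<epsilon> * X \<epsilon> ^ length l"
      by (rule mnet_0E[OF Wk(1)]) (rule that)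
    obtain C N where C: "C > 0" "\<And>\<epsilon>. \<epsilon> \<in> {0<..1} \<Longrightarrow> m \<epsilon> \<le> C * (1 / \<epsilon>) ^ N"
      by (rule moderateE[OF m(1)]) (rule that)
    have "norm (dtx T k \<alpha> (\<lambda>t. W \<epsilon> t []) t x) \<le> C * (1 / \<epsilon>) ^ N * (q ^ (mlen \<alpha> + 1) * mfact \<alpha> powr s * (1 / \<epsilon>) ^ mlen \<alpha>)"
      if e: "\<epsilon> \<in> {0<..1}" and t: "t \<in> {0..T}" for \<epsilon> \<alpha> t x
    proof -
      have "norm (dtx T k \<alpha> (\<lambda>t. W \<epsilon> t []) t x) \<le> m \<epsilon> * X \<epsilon> ^ mlen \<alpha>"
        unfolding dtx[OF e t] Wk(2)[OF e t] length_word[symmetric] by (rule m(2)[OF e t])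
      also have "\<dots> \<le> C * (1 / \<epsilon>) ^ N * (q ^ (mlen \<alpha> + 1) * mfact \<alpha> powr s * (1 / \<epsilon>) ^ mlen \<alpha>)"
        using e by (intro exponential_type_gevrey_bound C X q mfact_powr_ge_1 s) auto
      finally show ?thesis .
    qed
    with C(1) show ?thesis by blast
  qed
  have diff: "(\<lambda>t. dtx T k \<alpha> (\<lambda>t. W \<epsilon> t []) t x) differentiable_on {0..T}" if e: "\<epsilon> \<in> {0<..1}" for k \<alpha> \<epsilon> x
  proof -
    have "mnet T X (k + Suc 0) W" by (rule W)
    then obtain Wk where Wk: "mnet T X (Suc 0) Wk"
      "\<And>\<epsilon> t l x. \<epsilon> \<in> {0<..1} \<Longrightarrow> t \<in> {0..T} \<Longrightarrow> (dt T ^^ k) (\<lambda>t. W \<epsilon> t l) t x = Wk \<epsilon> t l x"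
      by (rule mnet_dt[OF T]) (rule that)
    obtain W' where W': "mnet T X 0 Wk" "mnet T X 0 W'"
      "\<And>\<epsilon> t l x. \<epsilon> \<in> {0<..1} \<Longrightarrow> t \<in> {0..T} \<Longrightarrow> ((\<lambda>t. Wk \<epsilon> t l x) has_vector_derivative W' \<epsilon> t l x) (at t within {0..T})"
      by (rule mnet_SucE[OF Wk(1)]) (rule that)
    show ?thesis unfolding differentiable_on_def
    proof (intro ballI)
      fix t assume t: "t \<in> {0..T}"
      have "((\<lambda>t. dtx T k \<alpha> (\<lambda>t. W \<epsilon> t []) t x) has_vector_derivative W' \<epsilon> t (word \<alpha>) x) (at t within {0..T})"
      proof (rule has_vector_derivative_cong_on[THEN iffD2, OF _ t W'(3)[OF e t]])
        show "dtx T k \<alpha> (\<lambda>t. W \<epsilon> t []) t x = Wk \<epsilon> t (word \<alpha>) x" if "t \<in> {0..T}" for t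
          by (simp only: dtx[OF e that] Wk(2)[OF e that])
      qed
      then show "(\<lambda>t. dtx T k \<alpha> (\<lambda>t. W \<epsilon> t []) t x) differentiable (at t within {0..T})"
        by (rule differentiableI_vector)
    qed
  qed
  have "(\<lambda>t. W \<epsilon> t []) \<in> smooth_gevrey T s" if e: "\<epsilon> \<in> {0<..1}" for \<epsilon>
    unfolding smooth_gevrey_def
  proof (intro CollectI conjI ballI allI impI)
    show "smooth (W \<epsilon> t [])" if "t \<in> {0..T}" for t by (rule dfam_smooth[OF D[OF e that]])
    show "(\<lambda>t. dtx T k \<alpha> (\<lambda>t. W \<epsilon> t []) t x) differentiable_on {0..T}" for k \<alpha> x by (rule diff[OF e])
    fix k and K :: "(real ^ 'n) set"
    from bound[of k] obtain C N where C: "C > 0" "\<forall>\<epsilon>\<in>{0<..1}. \<forall>\<alpha>. \<forall>t\<in>{0..T}. \<forall>x. norm (dtx T k \<alpha> (\<lambda>t. W \<epsilon> t []) t x)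
      \<le> C * (1 / \<epsilon>) ^ N * (q ^ (mlen \<alpha> + 1) * mfact \<alpha> powr s * (1 / \<epsilon>) ^ mlen \<alpha>)"
      by (elim exE conjE) (rule that)
    \<comment> \<open>For a fixed \<epsilon> all powers of \<open>1 / \<epsilon>\<close> are
      constants. The maximum with 1 lets the prefactor be raised to the power
      \<open>mlen \<alpha> + 1\<close>.\<close>
    define c where "c = max 1 (C * (1 / \<epsilon>) ^ N) * (q * (1 / \<epsilon>))"
    have pos: "q * (1 / \<epsilon>) \<ge> 1" using e q mult_mono[of 1 q 1 "1 / \<epsilon>"] by auto
    show "\<exists>C>0. \<forall>\<alpha>. \<forall>t\<in>{0..T}. \<forall>x\<in>K. norm (dtx T k \<alpha> (\<lambda>t. W \<epsilon> t []) t x) \<le> C ^ (mlen \<alpha> + 1) * mfact \<alpha> powr s"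
    proof (intro exI[of _ c] conjI allI ballI)
      show "c > 0" unfolding c_def
      proof (rule mult_pos_pos)
        show "0 < q * (1 / \<epsilon>)" using pos by linarith
      qed simp
      fix \<alpha> :: "real ^ 'n \<Rightarrow> nat" and t x assume t: "t \<in> {0..T}"
      let ?k = "mlen \<alpha>" and ?g = "mfact \<alpha> powr s"
      have g: "?g \<ge> 0" by simp
      have "norm (dtx T k \<alpha> (\<lambda>t. W \<epsilon> t []) t x) \<le> (C * (1 / \<epsilon>) ^ N) * (q ^ (?k + 1) * ?g * (1 / \<epsilon>) ^ ?k)"
        using C(2) e t by blast
      also have "\<dots> \<le> max 1 (C * (1 / \<epsilon>) ^ N) ^ (?k + 1) * (q ^ (?k + 1) * ?g * (1 / \<epsilon>) ^ (?k + 1))"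
      proof (intro mult_mono mult_left_mono)
        show "C * (1 / \<epsilon>) ^ N \<le> max 1 (C * (1 / \<epsilon>) ^ N) ^ (?k + 1)"
          by (rule order_trans[OF max.cobounded2 self_le_power]) auto
        show "(1 / \<epsilon>) ^ ?k \<le> (1 / \<epsilon>) ^ (?k + 1)" using e by (intro power_increasing) auto
      qed (use e q g in auto)
      also have "\<dots> = c ^ (?k + 1) * ?g" unfolding c_def power_mult_distrib by (simp only: mult_ac)
      finally show "norm (dtx T k \<alpha> (\<lambda>t. W \<epsilon> t []) t x) \<le> c ^ (?k + 1) * ?g" .
    qed
  qed
  moreover have "\<exists>N. \<exists>c>0. \<forall>k. \<exists>Nk. \<exists>ck>0. \<forall>\<alpha>. \<forall>t\<in>{0..T}. \<forall>x\<in>K. \<forall>\<epsilon>\<in>{0<..1}.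
         norm (dtx T k \<alpha> (\<lambda>t. W \<epsilon> t []) t x)
           \<le> ck * (1 / \<epsilon>) ^ Nk * c ^ (mlen \<alpha> + 1) * mfact \<alpha> powr s * (1 / \<epsilon>) ^ (N + mlen \<alpha>)" for K :: "(real ^ 'n) set"
  \<comment> \<open>\<open>N\<close> and \<open>c\<close> must be chosen before the order
    \<open>k\<close> of the time derivative. The values 0 and \<open>q\<close> work, because the
    growth in \<alpha> comes from \<open>X\<close> alone and all dependence on \<open>k\<close> sits
    in the prefactor.\<close>
  proof (rule exI[of _ 0], rule exI[of _ q], intro conjI allI)
    show "q > 0" using q by simp
    fix k
    from bound[of k] obtain C N where C: "C > 0" "\<forall>\<epsilon>\<in>{0<..1}. \<forall>\<alpha>. \<forall>t\<in>{0..T}. \<forall>x. norm (dtx T k \<alpha> (\<lambda>t. W \<epsilon> t []) t x)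
      \<le> C * (1 / \<epsilon>) ^ N * (q ^ (mlen \<alpha> + 1) * mfact \<alpha> powr s * (1 / \<epsilon>) ^ mlen \<alpha>)"
      by (elim exE conjE) (rule that)
    show "\<exists>Nk. \<exists>ck>0. \<forall>\<alpha>. \<forall>t\<in>{0..T}. \<forall>x\<in>K. \<forall>\<epsilon>\<in>{0<..1}.
         norm (dtx T k \<alpha> (\<lambda>t. W \<epsilon> t []) t x)
           \<le> ck * (1 / \<epsilon>) ^ Nk * q ^ (mlen \<alpha> + 1) * mfact \<alpha> powr s * (1 / \<epsilon>) ^ (0 + mlen \<alpha>)"
      by (rule exI[of _ N], rule exI[of _ C]) (use C in \<open>simp only: mult.assoc add_0, blast\<close>)
  qed
  ultimately show ?thesis unfolding smooth_gevrey_moderate_def by blast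
qed

lemma etype_gevrey_moderate:
  fixes W :: "real \<Rightarrow> 'n::finite list \<Rightarrow> real ^ 'n \<Rightarrow> complex"
  assumes s: "s \<ge> 1" and W: "\<And>\<epsilon>. \<epsilon> \<in> {0<..1} \<Longrightarrow> etype (m \<epsilon>) (X \<epsilon>) (W \<epsilon>)" and m: "moderate m"
    and X: "\<And>\<epsilon>. X \<epsilon> \<ge> 0" "\<And>\<epsilon>. \<epsilon> \<in> {0<..1} \<Longrightarrow> X \<epsilon> \<le> q * (1 / \<epsilon>)" and q: "q \<ge> 1"
  shows "gevrey_moderate s (\<lambda>\<epsilon>. W \<epsilon> [])"
proof -
  obtain C N where C: "C > 0" "\<And>\<epsilon>. \<epsilon> \<in> {0<..1} \<Longrightarrow> m \<epsilon> \<le> C * (1 / \<epsilon>) ^ N"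
    by (rule moderateE[OF m]) (rule that)
  define c where "c = max 1 C * q"
  have bound: "norm (mdiff \<alpha> (W \<epsilon> []) x) \<le> c ^ (mlen \<alpha> + 1) * mfact \<alpha> powr s * (1 / \<epsilon>) ^ (N + mlen \<alpha>)"
    if e: "\<epsilon> \<in> {0<..1}" for \<epsilon> \<alpha> x
  proof -
    let ?k = "mlen \<alpha>" and ?g = "mfact \<alpha> powr s"
    have "norm (mdiff \<alpha> (W \<epsilon> []) x) \<le> m \<epsilon> * X \<epsilon> ^ ?k"
      unfolding mdiff_dfam[OF etype_dfam[OF W[OF e]]] length_word[symmetric] by (rule etype_bound[OF W[OF e]])
    also have "\<dots> \<le> C * (1 / \<epsilon>) ^ N * (q ^ (?k + 1) * ?g * (1 / \<epsilon>) ^ ?k)"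
      using e by (intro exponential_type_gevrey_bound C X q mfact_powr_ge_1 s) auto
    also have "\<dots> = C * (q ^ (?k + 1) * ?g * (1 / \<epsilon>) ^ (N + ?k))" by (simp only: power_add mult_ac)
    also have "\<dots> \<le> max 1 C ^ (?k + 1) * (q ^ (?k + 1) * ?g * (1 / \<epsilon>) ^ (N + ?k))"
    proof (rule mult_right_mono)
      show "C \<le> max 1 C ^ (?k + 1)" by (rule order_trans[OF max.cobounded2 self_le_power]) auto
    qed (use e q in auto)
    also have "\<dots> = c ^ (?k + 1) * ?g * (1 / \<epsilon>) ^ (N + ?k)" unfolding c_def power_mult_distrib by (simp only: mult_ac)
    finally show ?thesis .
  qed
  have c: "c > 0" using q by (simp add: c_def)
  show ?thesis unfolding gevrey_moderate_def
  proof (intro conjI ballI allI impI)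
    fix \<epsilon> :: real assume e: "\<epsilon> \<in> {0<..1}"
    \<comment> \<open>The exponent \<open>N + 1\<close> makes
      \<open>(N + 1) * (mlen \<alpha> + 1)\<close> at least \<open>N + mlen \<alpha>\<close>, which
      absorbs the powers of \<open>1 / \<epsilon>\<close>.\<close>
    define c' where "c' = c * (1 / \<epsilon>) ^ (N + 1)"
    show "W \<epsilon> [] \<in> gevrey s" unfolding gevrey_def
    proof (intro CollectI conjI allI impI)
      show "smooth (W \<epsilon> [])" by (rule dfam_smooth[OF etype_dfam[OF W[OF e]]])
      fix K :: "(real ^ 'n) set"
      show "\<exists>C>0. \<forall>\<alpha>. \<forall>x\<in>K. norm (mdiff \<alpha> (W \<epsilon> []) x) \<le> C ^ (mlen \<alpha> + 1) * mfact \<alpha> powr s"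
      proof (intro exI[of _ c'] conjI allI ballI)
        show "c' > 0" using c e by (simp add: c'_def)
        fix \<alpha> :: "real ^ 'n \<Rightarrow> nat" and x
        let ?k = "mlen \<alpha>" and ?g = "mfact \<alpha> powr s"
        have "norm (mdiff \<alpha> (W \<epsilon> []) x) \<le> c ^ (?k + 1) * ?g * (1 / \<epsilon>) ^ (N + ?k)" by (rule bound[OF e])
        also have "\<dots> \<le> c ^ (?k + 1) * ?g * (1 / \<epsilon>) ^ ((N + 1) * (?k + 1))"
          using e c by (intro mult_left_mono power_increasing) auto
        also have "\<dots> = c' ^ (?k + 1) * ?g" unfolding c'_def power_mult_distrib power_mult[symmetric] by (simp only: mult_ac)
        finally show "norm (mdiff \<alpha> (W \<epsilon> []) x) \<le> c' ^ (?k + 1) * ?g" .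
      qed
    qed
  next
    fix K :: "(real ^ 'n) set"
    show "\<exists>c>0. \<exists>N. \<forall>\<alpha>. \<forall>x\<in>K. \<forall>\<epsilon>\<in>{0<..1}.
       norm (mdiff \<alpha> (W \<epsilon> []) x) \<le> c ^ (mlen \<alpha> + 1) * mfact \<alpha> powr s * (1 / \<epsilon>) ^ (N + mlen \<alpha>)"
      using c bound by blast
  qed
qed

lemma mnet_diff:
  assumes "mnet T X k V" "mnet T X k W" and X: "\<And>\<epsilon>. X \<epsilon> \<ge> 0"
  shows "mnet T X k (\<lambda>\<epsilon> t l x. V \<epsilon> t l x - W \<epsilon> t l x)"
  using mnet_add[OF assms(1) mnet_mult[OF assms(2) snet_const[of T "-1"] X] X] by simp

section \<open>Logarithmic scales and Levi conditions\<close>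

context
  fixes \<eta> :: real
  assumes \<eta>: "0 < \<eta>" "\<eta> < 1"
begin

text \<open>Nets are frozen at \<eta> for \<epsilon> above \<eta>. This costs a factor
  \<open>1 / \<eta>\<close> in moderate bounds and in return keeps the logarithm above
  \<open>ln (1 / \<eta>) > 0\<close>, so that one may divide by it on all of
  \<open>{0<..1}\<close>.\<close>

lemma inverse_min_le:
  assumes "\<epsilon> \<in> {0<..1}"
  shows "1 / min \<epsilon> \<eta> \<le> (1 / \<eta>) * (1 / \<epsilon>)"
proof -
  have "\<eta> * \<epsilon> \<le> \<epsilon>" "\<eta> * \<epsilon> \<le> \<eta>" using \<eta> assms by (auto simp: mult_left_le mult_le_cancel_right1)
  then have "1 / min \<epsilon> \<eta> \<le> 1 / (\<eta> * \<epsilon>)" using \<eta> assms by (intro divide_left_mono) auto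
  then show ?thesis by simp
qed

lemma log_ge:
  assumes "\<epsilon> \<in> {0<..1}"
  shows "ln (1 / \<eta>) \<le> ln (1 / min \<epsilon> \<eta>)" "0 < ln (1 / \<eta>)"
proof -
  have "1 / \<eta> \<le> 1 / min \<epsilon> \<eta>" using \<eta> assms by (intro divide_left_mono) auto
  then show "ln (1 / \<eta>) \<le> ln (1 / min \<epsilon> \<eta>)" using \<eta> assms by (subst ln_le_cancel_iff) auto
  show "0 < ln (1 / \<eta>)" using \<eta> by (intro ln_gt_zero) auto
qed

lemma log_le:
  assumes "\<epsilon> \<in> {0<..1}"
  shows "ln (1 / min \<epsilon> \<eta>) \<le> (1 / \<eta>) * (1 / \<epsilon>)"
proof -
  have "ln (1 / min \<epsilon> \<eta>) \<le> 1 / min \<epsilon> \<eta> - 1" using \<eta> assms by (intro ln_le_minus_one) auto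
  then show ?thesis using inverse_min_le[OF assms] by linarith
qed

lemma moderate_inverse_min: "moderate (\<lambda>\<epsilon>. 1 / min \<epsilon> \<eta>)"
proof (rule moderate_mono[OF moderate_mult[OF moderate_const[of "1 / \<eta>"] moderate_inverse]])
  fix \<epsilon> :: real assume e: "\<epsilon> \<in> {0<..1}"
  then have "1 / min \<epsilon> \<eta> > 0" using \<eta> by auto
  then show "\<bar>1 / min \<epsilon> \<eta>\<bar> \<le> (1 / \<eta>) * (1 / \<epsilon>)" using inverse_min_le[OF e] by linarith
qed

lemma moderate_log: "moderate (\<lambda>\<epsilon>. ln (1 / min \<epsilon> \<eta>))"
proof (rule moderate_mono[OF moderate_mult[OF moderate_const[of "1 / \<eta>"] moderate_inverse]])
  fix \<epsilon> :: real assume e: "\<epsilon> \<in> {0<..1}"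
  then show "\<bar>ln (1 / min \<epsilon> \<eta>)\<bar> \<le> (1 / \<eta>) * (1 / \<epsilon>)" using log_le[OF e] log_ge[OF e] by linarith
qed

lemma log_scale_pos: "\<epsilon> \<in> {0<..1} \<Longrightarrow> 0 < log_scale r (min \<epsilon> \<eta>)"
  using log_ge[of \<epsilon>] by (simp add: log_scale_def)

lemma log_scale_le:
  assumes "r > 0" "\<epsilon> \<in> {0<..1}"
  shows "log_scale r (min \<epsilon> \<eta>) \<le> 1 / ln (1 / \<eta>) powr r"
  unfolding log_scale_def using log_ge[OF assms(2)] assms(1)
  by (intro divide_left_mono powr_mono2 mult_pos_pos) auto

lemma moderate_inverse_log_scale:
  assumes "r > 0"
  shows "moderate (\<lambda>\<epsilon>. 1 / log_scale r (min \<epsilon> \<eta>))"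
proof (rule moderate_mono[OF moderate_power[OF moderate_add[OF moderate_const[of 1] moderate_log], of "nat \<lceil>r\<rceil>"]])
  fix \<epsilon> :: real assume e: "\<epsilon> \<in> {0<..1}"
  let ?L = "ln (1 / min \<epsilon> \<eta>)"
  have L: "?L > 0" using log_ge[OF e] by linarith
  \<comment> \<open>Passing to \<open>1 + ?L\<close> gives a base of at least 1, so that the real
    exponent may be rounded up.\<close>
  have "?L powr r \<le> (1 + ?L) powr r" using L assms by (intro powr_mono2) auto
  also have "\<dots> \<le> (1 + ?L) powr real (nat \<lceil>r\<rceil>)" using L by (intro powr_mono real_nat_ceiling_ge) auto
  also have "\<dots> = (1 + ?L) ^ nat \<lceil>r\<rceil>" using L by (intro powr_realpow) auto
  finally show "\<bar>1 / log_scale r (min \<epsilon> \<eta>)\<bar> \<le> (1 + ?L) ^ nat \<lceil>r\<rceil>" by (simp add: log_scale_def)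
qed

lemma scale_log_scale:
  assumes "r > 0"
  shows "scale (\<lambda>\<epsilon>. log_scale r (min \<epsilon> \<eta>))"
  unfolding scale_def
proof (intro conjI ballI log_scale_pos)
  have "filterlim (\<lambda>\<epsilon>::real. ln (inverse \<epsilon>)) at_top (at_right 0)"
    by (rule filterlim_compose[OF ln_at_top filterlim_inverse_at_top_right])
  then have lim: "((\<lambda>\<epsilon>::real. ln (inverse \<epsilon>) powr (-r)) \<longlongrightarrow> 0) (at_right 0)"
    using assms by (intro tendsto_neg_powr) auto
  have "eventually (\<lambda>\<epsilon>. \<epsilon> \<in> {0<..<\<eta>}) (at_right 0)"
    using \<eta> by (rule_tac eventually_at_right_real) auto
  then have "eventually (\<lambda>\<epsilon>. ln (inverse \<epsilon>) powr (-r) = log_scale r (min \<epsilon> \<eta>)) (at_right 0)"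
    by eventually_elim (simp add: log_scale_def powr_minus divide_inverse)
  from Lim_transform_eventually[OF lim this]
  show "((\<lambda>\<epsilon>. log_scale r (min \<epsilon> \<eta>)) \<longlongrightarrow> 0) (at_right 0)" .
qed

end

text \<open>On two opposite vectors of length \<open>R\<close> along an axis the left-hand
  expressions are \<open>z + e\<close> and \<open>- z + e\<close>; half their sum is
  \<open>e\<close> and half their difference is \<open>z\<close>, which separates the two
  coefficients. The square root on the right is removed by
  \<open>2 * x \<le> (1 + x)\<^sup>2\<close>, so that the bounds are linear in \<open>a i\<close>,
  as suits integration against a positive measure.\<close>

lemma levi_coefficient_bounds:
  fixes c :: "'n::finite \<Rightarrow> complex" and a :: "'n \<Rightarrow> real" and e :: complex
  assumes levi: "\<And>\<xi> :: real ^ 'n. norm \<xi> \<ge> R \<Longrightarrow>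
      (cmod (\<i> * (\<Sum>i\<in>UNIV. c i * of_real (\<xi> $ i)) + e))\<^sup>2 \<le> C * L\<^sup>2 * (2 * (\<Sum>i\<in>UNIV. a i * (\<xi> $ i)\<^sup>2))"
    and R: "R > 0" and C: "C > 0" and L: "L > 0" and a: "\<And>i. a i \<ge> 0"
  shows "norm (c i) \<le> L * (1 + C * a i)" "norm e \<le> L * R * (1 + C * a i)"
proof -
  let ?S = "L * R * (1 + C * a i)"
  have S: "?S \<ge> 0" using L R C a[of i] by simp
  have bd: "cmod (\<i> * (c i * of_real \<rho>) + e) \<le> ?S" if "\<bar>\<rho>\<bar> = R" for \<rho>
  proof (rule power2_le_imp_le[OF _ S])
    have s1: "(\<Sum>j\<in>UNIV. c j * of_real (axis i \<rho> $ j)) = c i * of_real \<rho>"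
    proof -
      have "(\<Sum>j\<in>UNIV. c j * of_real (axis i \<rho> $ j)) = (\<Sum>j\<in>UNIV. if j = i then c j * of_real \<rho> else 0)"
        by (intro sum.cong) (auto simp: axis_def)
      then show ?thesis by simp
    qed
    have s2: "(\<Sum>j\<in>UNIV. a j * (axis i \<rho> $ j)\<^sup>2) = a i * \<rho>\<^sup>2"
    proof -
      have "(\<Sum>j\<in>UNIV. a j * (axis i \<rho> $ j)\<^sup>2) = (\<Sum>j\<in>UNIV. if j = i then a j * \<rho>\<^sup>2 else 0)"
        by (intro sum.cong) (auto simp: axis_def)
      then show ?thesis by simp
    qed
    have "\<rho>\<^sup>2 = R\<^sup>2" using that power2_abs[of \<rho>] by simp
    moreover have "norm (axis i \<rho> :: real ^ 'n) \<ge> R"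
      using that component_le_norm_cart[of "axis i \<rho> :: real ^ 'n" i] by simp
    ultimately have "(cmod (\<i> * (c i * of_real \<rho>) + e))\<^sup>2 \<le> C * L\<^sup>2 * (2 * (a i * R\<^sup>2))"
      using levi[of "axis i \<rho>"] by (simp only: s1 s2)
    also have "\<dots> = (L * R)\<^sup>2 * (2 * (C * a i))" by (simp add: power_mult_distrib)
    also have "\<dots> \<le> (L * R)\<^sup>2 * (1 + C * a i)\<^sup>2"
      by (rule mult_left_mono) (auto simp: power2_sum)
    also have "\<dots> = ?S\<^sup>2" by (simp only: power_mult_distrib)
    finally show "(cmod (\<i> * (c i * of_real \<rho>) + e))\<^sup>2 \<le> ?S\<^sup>2" .
  qed
  define z where "z = \<i> * (c i * of_real R)"
  have p: "cmod (z + e) \<le> ?S" "cmod (- z + e) \<le> ?S"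
    using bd[of R] bd[of "-R"] R by (simp_all add: z_def)
  have nz: "cmod z = R * cmod (c i)" using R by (simp add: z_def norm_mult)
  have "2 * cmod e = cmod ((z + e) + (- z + e))" by (simp add: norm_mult flip: mult_2)
  also have "\<dots> \<le> ?S + ?S" by (rule order_trans[OF norm_triangle_ineq add_mono[OF p]])
  finally show "norm e \<le> ?S" by simp
  have "2 * cmod z = cmod ((z + e) - (- z + e))" by (simp add: norm_mult flip: mult_2)
  also have "\<dots> \<le> ?S + ?S" by (rule order_trans[OF norm_triangle_ineq4 add_mono[OF p]])
  finally have "cmod z \<le> ?S" by linarith
  then have "R * cmod (c i) \<le> R * (L * (1 + C * a i))" by (simp add: nz mult_ac)
  then show "norm (c i) \<le> L * (1 + C * a i)" using R by simp
qed

text \<open>With \<open>X = B L\<close>, the growth rate of the weighted system is of order \<open>L\<close> in \<open>L\<^sup>1\<close>.\<close>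

lemma growth_rate_bound:
  fixes a :: "'n::finite \<Rightarrow> real" and c :: "'n \<Rightarrow> complex"
  assumes a: "\<And>i. a i \<ge> 0" and c: "\<And>i. norm (c i) \<le> L * (1 + C * a i)"
    and e: "\<And>i. norm e \<le> L * R * (1 + C * a i)" and d: "(norm d)\<^sup>2 \<le> C' * L\<^sup>2"
    and pos: "C > 0" "C' > 0" "R > 0" "B \<ge> 0" "L0 > 0" "L0 \<le> L"
  shows "((\<Sum>i\<in>UNIV. a i) * (B * L) ^ 2 + (\<Sum>i\<in>UNIV. norm (c i)) * (B * L) + norm e) / L + norm d
    \<le> L * ((1 + B * real CARD('n) + R / L0 + C') + (B\<^sup>2 + B * C + R / L0 * C) * (\<Sum>i\<in>UNIV. a i))"
proof -
  let ?A = "\<Sum>i\<in>UNIV. a i"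
  have L: "L > 0" using pos by linarith
  have A: "?A \<ge> 0" using a by (intro sum_nonneg) auto
  have c': "(\<Sum>i\<in>UNIV. norm (c i)) \<le> L * (real CARD('n) + C * ?A)"
  proof -
    have "(\<Sum>i\<in>UNIV. norm (c i)) \<le> (\<Sum>i\<in>UNIV. L * (1 + C * a i))" by (intro sum_mono c)
    also have "\<dots> = L * (real CARD('n) + C * ?A)" by (simp add: sum_distrib_left[symmetric] sum.distrib)
    finally show ?thesis .
  qed
  have e': "norm e / L \<le> L * (R / L0 * (1 + C * ?A))"
  proof -
    \<comment> \<open>The bound for \<open>e\<close> holds with every index; any one of them will
      do, as the sum dominates it.\<close>
    have "a undefined \<le> ?A" using a by (intro member_le_sum) auto
    then have "L * R * (1 + C * a undefined) \<le> L * R * (1 + C * ?A)"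
      using L pos by (intro mult_left_mono add_left_mono) auto
    with e[of undefined] have "norm e \<le> L * R * (1 + C * ?A)" by linarith
    then have "norm e / L \<le> R * (1 + C * ?A)" using L by (simp add: divide_le_eq mult_ac)
    also have "\<dots> = 1 * (R * (1 + C * ?A))" by simp
    \<comment> \<open>This term carries no factor \<open>L\<close>. The factor
      \<open>L / L0\<close>, which is at least 1, gives it the form of the others and is the origin
      of \<open>R / L0\<close>.\<close>
    also have "\<dots> \<le> (L / L0) * (R * (1 + C * ?A))"
      using pos A by (intro mult_right_mono) auto
    finally show ?thesis by simp
  qed
  \<comment> \<open>\<open>1 + C'\<close> serves as a bound for the square root of
    \<open>C'\<close>.\<close>
  have d': "norm d \<le> L * (1 + C')"
  proof (rule power2_le_imp_le)
    have "(norm d)\<^sup>2 \<le> C' * L\<^sup>2" by (rule d)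
    also have "\<dots> \<le> (1 + C')\<^sup>2 * L\<^sup>2" using pos by (intro mult_right_mono) (auto simp: power2_sum)
    finally show "(norm d)\<^sup>2 \<le> (L * (1 + C'))\<^sup>2" by (simp only: power_mult_distrib mult.commute)
  qed (use L pos in auto)
  have "(?A * (B * L) ^ 2 + (\<Sum>i\<in>UNIV. norm (c i)) * (B * L) + norm e) / L + norm d
      = ?A * (B\<^sup>2 * L) + (\<Sum>i\<in>UNIV. norm (c i)) * B + norm e / L + norm d"
    using L by (simp add: field_simps power2_eq_square)
  also have "\<dots> \<le> ?A * (B\<^sup>2 * L) + (L * (real CARD('n) + C * ?A)) * B + L * (R / L0 * (1 + C * ?A)) + L * (1 + C')"
    using c' e' d' pos(4) L by (intro add_mono mult_right_mono) auto
  also have "\<dots> = L * ((1 + B * real CARD('n) + R / L0 + C') + (B\<^sup>2 + B * C + R / L0 * C) * ?A)"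
    by (simp only: ring_distribs mult_1_right mult_1_left) (simp only: mult_ac add_ac)
  finally show ?thesis .
qed

lemma dseq_family_smooth_moderate:
  assumes H: "\<And>\<epsilon>. \<epsilon> \<in> {0<..1} \<Longrightarrow> dseq (H \<epsilon>)"
    and bd: "\<And>k \<tau>. \<exists>m. moderate m \<and> (\<forall>\<epsilon>\<in>{0<..1}. \<forall>t. \<bar>t\<bar> \<le> \<tau> \<longrightarrow> norm (H \<epsilon> k t) \<le> m \<epsilon>)"
    and h: "\<And>\<epsilon>. \<epsilon> \<in> {0<..1} \<Longrightarrow> H \<epsilon> 0 = h \<epsilon>"
  shows "smooth_moderate h"
  unfolding smooth_moderate_def
proof (intro conjI ballI allI impI)
  fix \<epsilon> :: real assume e: "\<epsilon> \<in> {0<..1}"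
  show "smooth (h \<epsilon>)" unfolding smooth_real_iff using H[OF e] h[OF e] by (intro exI[of _ "H \<epsilon>"]) simp
next
  fix K :: "real set" and \<alpha> :: "real \<Rightarrow> nat" assume "compact K"
  then obtain \<tau> where \<tau>: "\<And>x. x \<in> K \<Longrightarrow> \<bar>x\<bar> \<le> \<tau>"
    using compact_imp_bounded[of K] unfolding bounded_iff by auto
  from bd[of \<tau> "\<alpha> 1"] obtain m where m: "moderate m" "\<forall>\<epsilon>\<in>{0<..1}. \<forall>t. \<bar>t\<bar> \<le> \<tau> \<longrightarrow> norm (H \<epsilon> (\<alpha> 1) t) \<le> m \<epsilon>"
    by (elim exE conjE) (rule that)
  obtain C N where C: "C > 0" "\<And>\<epsilon>. \<epsilon> \<in> {0<..1} \<Longrightarrow> m \<epsilon> \<le> C * (1 / \<epsilon>) ^ N"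
    by (rule moderateE[OF m(1)]) (rule that)
  have "norm (mdiff \<alpha> (h \<epsilon>) x) \<le> C * (1 / \<epsilon>) ^ N" if e: "\<epsilon> \<in> {0<..1}" and x: "x \<in> K" for \<epsilon> x
  proof -
    have "norm (mdiff \<alpha> (h \<epsilon>) x) \<le> m \<epsilon>"
      unfolding h[OF e, symmetric] mdiff_dseq[OF H[OF e]] using m(2) e \<tau>[OF x] by blast
    with C(2)[OF e] show ?thesis by linarith
  qed
  with C(1) show "\<exists>N. \<exists>c>0. \<forall>\<epsilon>\<in>{0<..1}. \<forall>x\<in>K. norm (mdiff \<alpha> (h \<epsilon>) x) \<le> c * (1 / \<epsilon>) ^ N" by blast
qed

text \<open>The hypotheses concern \<open>\<epsilon> \<le> \<eta>\<close>; replacing \<epsilon> by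
  \<open>min \<epsilon> \<eta>\<close> is the normalisation to \<open>{0<..1}\<close>. A very weak
  solution is only asked to belong to some regularisation of the coefficients, so the second
  conjunct ties the same \<open>u\<close> to the given logarithmic one and to mollifiers of type (2)
  for the data.\<close>

theorem theorem5p3:
  fixes T s r \<eta> R C1 C2 :: real
    and a c :: "'n::finite \<Rightarrow> (real \<Rightarrow> complex) \<Rightarrow> complex"
    and d e :: "(real \<Rightarrow> complex) \<Rightarrow> complex"
    and f :: "real \<Rightarrow> real ^ 'n \<Rightarrow> complex"
    and g0 g1 :: "real ^ 'n \<Rightarrow> complex"
    and \<psi> :: "real \<Rightarrow> complex"
  assumes "T > 0" and "s \<ge> 1"
    and "\<And>i. distribution (a i) \<and> dist_supp_in (a i) {0..T} \<and> dist_real (a i) \<and> dist_nonneg (a i)"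
    and "\<And>i. distribution (c i) \<and> dist_supp_in (c i) {0..T}"
    and "distribution d" and "dist_supp_in d {0..T}"
    and "distribution e" and "dist_supp_in e {0..T}"
    and "cont_gevrey_c T s f"
    and "g0 \<in> gevrey_c s" and "g1 \<in> gevrey_c s"
    and "mollifier1 \<psi>" and "r > 0"
    and "0 < \<eta>" and "\<eta> < 1" and "C1 > 0" and "C2 > 0" and "R > 0"
    and "\<And>t \<epsilon> \<xi> :: real ^ 'n. t \<in> {0..T} \<Longrightarrow> \<epsilon> \<in> {0<..\<eta>} \<Longrightarrow> norm \<xi> \<ge> R \<Longrightarrow>
      (cmod (\<i> * (\<Sum>i\<in>UNIV. log_reg T r \<psi> (c i) \<epsilon> t * of_real (\<xi> $ i)) + log_reg T r \<psi> e \<epsilon> t))\<^sup>2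
        \<le> C1 * (ln (1 / \<epsilon>))\<^sup>2 * (2 * (\<Sum>i\<in>UNIV. Re (log_reg T r \<psi> (a i) \<epsilon> t) * (\<xi> $ i)\<^sup>2))"
    and "\<And>t \<epsilon>. t \<in> {0..T} \<Longrightarrow> \<epsilon> \<in> {0<..\<eta>} \<Longrightarrow>
      (cmod (log_reg T r \<psi> d \<epsilon> t))\<^sup>2 \<le> C2 * (ln (1 / \<epsilon>))\<^sup>2"
  shows "\<exists>u. very_weak_solution T s a c d e f g0 g1 u \<and>
    very_weak_for mollifier2 T s
      (\<lambda>i \<epsilon>. log_reg T r \<psi> (a i) (min \<epsilon> \<eta>)) (\<lambda>i \<epsilon>. log_reg T r \<psi> (c i) (min \<epsilon> \<eta>))
      (\<lambda>\<epsilon>. log_reg T r \<psi> d (min \<epsilon> \<eta>)) (\<lambda>\<epsilon>. log_reg T r \<psi> e (min \<epsilon> \<eta>)) f g0 g1 u"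
proof -

  \<comment> \<open>Scales and regularised coefficients\<close>
  note T = assms(1) and s = assms(2) and \<psi> = assms(12) and \<eta> = assms(14,15)
  define \<omega> where "\<omega> \<epsilon> = log_scale r (min \<epsilon> \<eta>)" for \<epsilon>
  define L where "L \<epsilon> = ln (1 / min \<epsilon> \<eta>)" for \<epsilon>
  \<comment> \<open>The data are regularised with the exponent 1 whatever \<open>r\<close> is: then
    \<open>1 / \<omega>' \<epsilon>\<close> equals \<open>L \<epsilon>\<close>, and the exponential
    type is of the order \<open>L \<epsilon>\<close> that matches the Levi conditions.\<close>
  define \<omega>' where "\<omega>' \<epsilon> = log_scale 1 (min \<epsilon> \<eta>)" for \<epsilon>
  define L0 where "L0 = ln (1 / \<eta>)"
  have L0: "L0 > 0" using log_ge(2)[OF \<eta>, of 1] by (simp add: L0_def)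
  have L: "L0 \<le> L \<epsilon>" "L \<epsilon> > 0" if "\<epsilon> \<in> {0<..1}" for \<epsilon>
    using log_ge[OF \<eta> that] by (auto simp: L0_def L_def)
  have \<omega>'_eq: "\<omega>' \<epsilon> = 1 / L \<epsilon>" if "\<epsilon> \<in> {0<..1}" for \<epsilon>
    using L[OF that] by (simp add: \<omega>'_def log_scale_def L_def)
  have \<omega>_pos: "0 < \<omega> \<epsilon> \<and> \<omega> \<epsilon> \<le> 1 / ln (1 / \<eta>) powr r" if "\<epsilon> \<in> {0<..1}" for \<epsilon>
    unfolding \<omega>_def using log_scale_pos[OF \<eta> that] log_scale_le[OF \<eta> assms(13) that] by blast
  have \<omega>_mod: "moderate (\<lambda>\<epsilon>. 1 / \<omega> \<epsilon>)" unfolding \<omega>_def by (rule moderate_inverse_log_scale[OF \<eta> assms(13)])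
  have \<omega>_scale: "scale \<omega>" unfolding \<omega>_def[abs_def] by (rule scale_log_scale[OF \<eta> assms(13)])
  have \<omega>'_pos: "0 < \<omega>' \<epsilon>" if "\<epsilon> \<in> {0<..1}" for \<epsilon>
    unfolding \<omega>'_def by (rule log_scale_pos[OF \<eta> that])
  have \<omega>'_mod: "moderate (\<lambda>\<epsilon>. 1 / \<omega>' \<epsilon>)"
    unfolding \<omega>'_def by (rule moderate_inverse_log_scale[OF \<eta> zero_less_one])
  have \<omega>'_scale: "scale \<omega>'" unfolding \<omega>'_def[abs_def] by (rule scale_log_scale[OF \<eta> zero_less_one])
  have L_mod: "moderate L" unfolding L_def[abs_def] by (rule moderate_log[OF \<eta>])
  define reg where "reg w \<epsilon> = log_reg T r \<psi> w (min \<epsilon> \<eta>)" for w \<epsilon>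
  have reg_conv: "reg w \<epsilon> = dist_conv {0..T} w (rescale (\<omega> \<epsilon>) \<psi>)" for w \<epsilon>
    by (simp add: reg_def log_reg_def[abs_def] \<omega>_def)
  define derivs where "derivs w H \<longleftrightarrow> (\<forall>\<epsilon>\<in>{0<..1}. dseq (H \<epsilon>) \<and> H \<epsilon> 0 = reg w \<epsilon>) \<and>
      (\<forall>k \<tau>. \<exists>m. moderate m \<and> (\<forall>\<epsilon>\<in>{0<..1}. \<forall>t. \<bar>t\<bar> \<le> \<tau> \<longrightarrow> norm (H \<epsilon> k t) \<le> m \<epsilon>))" for w H
  have family: "\<exists>H. derivs w H"
    if w: "distribution w \<and> dist_supp_in w {0..T}" for w
  proof -
    obtain H where H: "\<And>\<epsilon>. \<epsilon> \<in> {0<..1} \<Longrightarrow> dseq (H \<epsilon>)"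
      "\<And>\<epsilon>. \<epsilon> \<in> {0<..1} \<Longrightarrow> H \<epsilon> 0 = dist_conv {0..T} w (rescale (\<omega> \<epsilon>) \<psi>)"
      "\<And>k \<tau>. \<exists>m. moderate m \<and> (\<forall>\<epsilon>\<in>{0<..1}. \<forall>t. \<bar>t\<bar> \<le> \<tau> \<longrightarrow> norm (H \<epsilon> k t) \<le> m \<epsilon>)"
      by (rule regularised_coefficient_family[OF w[THEN conjunct1] w[THEN conjunct2] \<psi> \<omega>_pos \<omega>_mod])
         (assumption, rule that)
    show ?thesis unfolding derivs_def
      by (rule exI[of _ H], intro conjI ballI allI H(3)) (rule H(1), assumption, simp only: reg_conv H(2))
  qed
  \<comment> \<open>A fixed choice makes the derivatives of a regularisation a function of the
    distribution, so that they can be used under sums over the coefficients.\<close>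
  define fam where "fam w = (SOME H. derivs w H)" for w
  define adm where "adm w \<longleftrightarrow> distribution w \<and> dist_supp_in w {0..T}" for w :: "(real \<Rightarrow> complex) \<Rightarrow> complex"
  have adm: "adm (a i)" "adm (c i)" "adm d" "adm e" for i
    using assms(3)[of i] assms(4)[of i] assms(5-8) by (auto simp: adm_def)
  have fam_derivs: "derivs w (fam w)" if "adm w" for w
    unfolding fam_def by (rule someI_ex[OF family[OF that[unfolded adm_def]]])
  have fam: "dseq (fam w \<epsilon>)" "fam w \<epsilon> 0 = reg w \<epsilon>" if "adm w" "\<epsilon> \<in> {0<..1}" for w \<epsilon>
    using fam_derivs[OF that(1), unfolded derivs_def] that(2) by auto
  have fam_bd: "\<exists>m. moderate m \<and> (\<forall>\<epsilon>\<in>{0<..1}. \<forall>t. \<bar>t\<bar> \<le> \<tau> \<longrightarrow> norm (fam w \<epsilon> k t) \<le> m \<epsilon>)" if "adm w" for w k \<tau>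
    using fam_derivs[OF that, unfolded derivs_def] by blast
  have snet: "snet T (fam w)" if "adm w" for w
    unfolding snet_def
  proof (intro conjI ballI allI fam(1)[OF that])
    fix k
    from fam_bd[OF that, of T k] show "\<exists>m. moderate m \<and> (\<forall>\<epsilon>\<in>{0<..1}. \<forall>t\<in>{0..T}. norm (fam w \<epsilon> k t) \<le> m \<epsilon>)"
      by (elim exE conjE) (rule exI, rule conjI, assumption, auto)
  qed
  have smod: "smooth_moderate (reg w)" if "adm w" for w
    by (rule dseq_family_smooth_moderate[OF fam(1)[OF that] fam_bd[OF that] fam(2)[OF that]])
  have reg_c: "reg_coeff T w (reg w)" for w
    unfolding reg_coeff_def reg_conv using \<psi> \<omega>_scale by (intro exI[of _ \<psi>] exI[of _ \<omega>]) (simp add: mollifier_def)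

  \<comment> \<open>Mass of the nonnegative coefficients\<close>
  have prim: "\<exists>M\<ge>0. \<forall>\<epsilon>\<in>{0<..1}. (\<forall>t. reg (a i) \<epsilon> t \<in> \<real>\<^sub>\<ge>\<^sub>0) \<and>
      (\<exists>A. \<forall>t\<in>{0..T}. (A has_real_derivative Re (reg (a i) \<epsilon> t)) (at t) \<and> 0 \<le> A t \<and> A t \<le> M)" for i
  proof -
    obtain M where M: "M \<ge> 0"
      "\<And>\<omega>. 0 < \<omega> \<Longrightarrow> \<omega> \<le> 1 / ln (1 / \<eta>) powr r \<Longrightarrow> (\<forall>t. dist_conv {0..T} (a i) (rescale \<omega> \<psi>) t \<in> \<real>\<^sub>\<ge>\<^sub>0) \<and>
      (\<exists>A. \<forall>t\<in>{0..T}. (A has_real_derivative Re (dist_conv {0..T} (a i) (rescale \<omega> \<psi>) t)) (at t) \<and> 0 \<le> A t \<and> A t \<le> M)"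
      by (rule nonneg_regularisation_primitive[of "a i" T \<psi>, where \<omega>max = "1 / ln (1 / \<eta>) powr r"])
         (use assms(3)[of i] \<psi> T in blast)+
    show ?thesis unfolding reg_conv using M(1) M(2) \<omega>_pos by blast
  qed
  then obtain M where M: "\<And>i. M i \<ge> 0" "\<And>i \<epsilon>. \<epsilon> \<in> {0<..1} \<Longrightarrow> (\<forall>t. reg (a i) \<epsilon> t \<in> \<real>\<^sub>\<ge>\<^sub>0) \<and>
      (\<exists>A. \<forall>t\<in>{0..T}. (A has_real_derivative Re (reg (a i) \<epsilon> t)) (at t) \<and> 0 \<le> A t \<and> A t \<le> M i)"
    by metis

  \<comment> \<open>The band-limited mollifier in several variables and its exponential type\<close>
  obtain \<Phi> B C where \<Phi>: "dseq \<Phi>" "B \<ge> 1" "C > 0" "\<And>k x. norm (\<Phi> k x) \<le> C * B ^ k"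
    "\<And>k m. \<exists>C. \<forall>x. (1 + \<bar>x\<bar>) ^ m * norm (\<Phi> k x) \<le> C"
    "(LINT x|lborel. \<Phi> 0 x) = 1"
    "\<And>k. integrable lborel (\<lambda>x. of_real (x ^ k) * \<Phi> 0 x)"
    "\<And>k. k > 0 \<Longrightarrow> (LINT x|lborel. of_real (x ^ k) * \<Phi> 0 x) = 0"
    by (rule band_limited_mollifier_real[OF \<psi>]) (rule that)
  define D :: "'n list \<Rightarrow> real ^ 'n \<Rightarrow> complex" where "D = tensor \<Phi>"
  have D: "dfam D" unfolding D_def by (rule tensor_dfam[OF \<Phi>(1)])
  have Dbd: "norm (D l x) \<le> C ^ CARD('n) * B ^ length l" for l x
    unfolding D_def by (rule tensor_bound[OF \<Phi>(4)])
  have Dm: "mollifier2 (D [])" unfolding D_def by (rule tensor_mollifier2[OF \<Phi>(1,5,6,7,8)])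
  \<comment> \<open>The absolute value makes \<open>X\<close> nonnegative for every real \<epsilon>,
    as the lemmas on nets require; on \<open>{0<..1}\<close> it changes nothing.\<close>
  define X where "X \<epsilon> = B * \<bar>L \<epsilon>\<bar>" for \<epsilon>
  have X: "X \<epsilon> \<ge> 0" for \<epsilon> using \<Phi>(2) by (simp add: X_def)
  have X_eq: "X \<epsilon> = B * L \<epsilon>" "B / \<omega>' \<epsilon> = X \<epsilon>" if "\<epsilon> \<in> {0<..1}" for \<epsilon>
    using L[OF that] \<omega>'_eq[OF that] by (auto simp: X_def)
  define q where "q = B / \<eta>"
  have q: "q \<ge> 1" using \<Phi>(2) \<eta> by (simp add: q_def)
  have X_le: "X \<epsilon> \<le> q * (1 / \<epsilon>)" if "\<epsilon> \<in> {0<..1}" for \<epsilon>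
    using mult_left_mono[OF log_le[OF \<eta> that], of B] \<Phi>(2) by (simp add: X_eq(1)[OF that] q_def L_def)
  have X_mod: "moderate X"
    by (rule moderate_mono[OF moderate_mult[OF moderate_const[of B] L_mod]])
       (unfold abs_of_nonneg[OF X], rule eq_refl, rule X_eq(1))

  \<comment> \<open>Regularised initial data\<close>
  define G where "G g \<epsilon> l x = (LINT y|lborel. g y * rescaled (\<omega>' \<epsilon>) D l (x - y))" for g \<epsilon> l x
  define mG where "mG g \<epsilon> = C ^ CARD('n) * (1 / \<omega>' \<epsilon>) ^ CARD('n) * (LINT y|lborel. norm (g y))" for g :: "real ^ 'n \<Rightarrow> complex" and \<epsilon>
  have G_et: "etype (mG g \<epsilon>) (X \<epsilon>) (G g \<epsilon>)" if g: "g \<in> gevrey_c s" and e: "\<epsilon> \<in> {0<..1}" for g \<epsilon>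
    unfolding mG_def G_def[abs_def] X_eq(2)[OF e, symmetric]
  proof (rule convolution_etype[OF gevrey_c_integrable[OF g] rescaled_etype[OF D Dbd \<omega>'_pos[OF e]]])
    show "0 \<le> B / \<omega>' \<epsilon>" using X_eq(2)[OF e] X[of \<epsilon>] by simp
  qed
  have mG: "moderate (mG g)" for g unfolding mG_def[abs_def]
    by (intro moderate_mult moderate_const moderate_power \<omega>'_mod)
  have G_gm: "gevrey_moderate s (\<lambda>\<epsilon>. G g \<epsilon> [])" if "g \<in> gevrey_c s" for g
    by (rule etype_gevrey_moderate[OF s G_et[OF that] mG X X_le q])
  have G_reg: "reg_init mollifier2 g (\<lambda>\<epsilon>. G g \<epsilon> [])" for g
    unfolding reg_init_def
    by (intro exI[of _ "D []"] exI[of _ \<omega>'] conjI Dm \<omega>'_scale) (simp add: G_def fun_conv_def rescaled_Nil)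

  \<comment> \<open>Regularised right-hand side\<close>
  have B0: "B \<ge> 0" using \<Phi>(2) by simp
  obtain F where F: "\<And>\<epsilon> k t l x. \<epsilon> \<in> {0<..1} \<Longrightarrow> ((\<lambda>t. F \<epsilon> k t l x) has_vector_derivative F \<epsilon> (Suc k) t l x) (at t)"
    "\<And>k. \<exists>m. moderate m \<and> (\<forall>\<epsilon>\<in>{0<..1}. \<forall>t. etype (m \<epsilon>) (B / \<omega>' \<epsilon>) (F \<epsilon> k t))"
    "\<And>\<epsilon> t x. \<epsilon> \<in> {0<..1} \<Longrightarrow> F \<epsilon> 0 t [] x =
       fun_conv (\<lambda>\<tau>. if \<tau> \<in> {0..T} then fun_conv (f \<tau>) (rescale (\<omega>' \<epsilon>) (D [])) x else 0) (rescale (\<omega>' \<epsilon>) \<psi>) t"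
    by (rule regularised_rhs_family[OF T assms(9) \<psi> D Dbd B0 \<omega>'_pos \<omega>'_mod]) (assumption, rule that)
  have F_reg: "reg_rhs mollifier2 T f (\<lambda>\<epsilon> t. F \<epsilon> 0 t [])"
    unfolding reg_rhs_def
  proof (intro exI[of _ "D []"] exI[of _ \<omega>'] conjI Dm \<omega>'_scale disjI2 exI[of _ \<psi>] ballI allI)
    show "mollifier \<psi>" using \<psi> by (simp add: mollifier_def)
  qed (rule F(3))
  have F_net: "mnet T X k (\<lambda>\<epsilon> t l x. F \<epsilon> j t l x)" for k j
  proof (induction k arbitrary: j)
    case 0
    from F(2)[of j] obtain m where m: "moderate m" "\<forall>\<epsilon>\<in>{0<..1}. \<forall>t. etype (m \<epsilon>) (B / \<omega>' \<epsilon>) (F \<epsilon> j t)"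
      by (elim exE conjE) (rule that)
    show ?case
    proof (rule mnet_0I[OF m(1)])
      fix \<epsilon> t l x assume e: "\<epsilon> \<in> {0<..1::real}"
      with m(2) have "etype (m \<epsilon>) (B / \<omega>' \<epsilon>) (F \<epsilon> j t)" by blast
      then have "etype (m \<epsilon>) (X \<epsilon>) (F \<epsilon> j t)" unfolding X_eq(2)[OF e] .
      then show "norm (F \<epsilon> j t l x) \<le> m \<epsilon> * X \<epsilon> ^ length l" by (rule etype_bound)
    qed
  next
    case (Suc k)
    show ?case
      by (rule mnet_SucI[OF mnet_zero[OF Suc] Suc]) (rule has_vector_derivative_at_within[OF F(1)])
  qed
  from F(2)[of 0] obtain mF where mF: "moderate mF" "\<forall>\<epsilon>\<in>{0<..1}. \<forall>t. etype (mF \<epsilon>) (B / \<omega>' \<epsilon>) (F \<epsilon> 0 t)"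
    by (elim exE conjE) (rule that)
  have F_et: "etype (mF \<epsilon>) (X \<epsilon>) (F \<epsilon> 0 t)" if "\<epsilon> \<in> {0<..1}" for \<epsilon> t
    unfolding X_eq(2)[OF that, symmetric] using mF(2) that by blast
  have F_gm: "smooth_gevrey_moderate T s (\<lambda>\<epsilon> t. F \<epsilon> 0 t [])"
    by (rule mnet_smooth_gevrey_moderate[OF T s F_net etype_dfam[OF F_et] X X_le q])

  \<comment> \<open>Growth exponent and solutions for each parameter\<close>
  define \<kappa>0 where "\<kappa>0 = 1 + B * real CARD('n) + R / L0 + C2"
  define \<kappa>1 where "\<kappa>1 = B\<^sup>2 + B * C1 + R / L0 * C1"
  have \<kappa>0: "\<kappa>0 \<ge> 1" using B0 assms(17,18) L0 by (simp add: \<kappa>0_def)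
  have \<kappa>1: "\<kappa>1 \<ge> 0" using B0 assms(16,18) L0 by (simp add: \<kappa>1_def)
  \<comment> \<open>\<open>L \<epsilon> * \<mu>\<close> bounds the integral of the growth rate over
    \<open>{0..T}\<close>: \<open>\<kappa>0\<close> and \<open>\<kappa>1\<close> are the constants
    of \<open>growth_rate_bound\<close>, and \<open>M i\<close> bounds the mass of the coefficient
    with index \<open>i\<close>. As \<mu> does not depend on \<epsilon>, the exponential growth is a
    fixed power of \<open>1 / min \<epsilon> \<eta>\<close>.\<close>
  define \<mu> where "\<mu> = \<kappa>0 * T + \<kappa>1 * (\<Sum>i\<in>UNIV. M i)"
  define E where "E \<epsilon> = (1 / min \<epsilon> \<eta>) ^ nat \<lceil>\<mu>\<rceil>" for \<epsilon>
  have E_mod: "moderate E" unfolding E_def[abs_def] by (rule moderate_power[OF moderate_inverse_min[OF \<eta>]])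
  have E_exp: "exp (L \<epsilon> * \<mu>) \<le> E \<epsilon>" if e: "\<epsilon> \<in> {0<..1}" for \<epsilon>
  proof -
    have "L \<epsilon> * \<mu> \<le> real (nat \<lceil>\<mu>\<rceil>) * L \<epsilon>"
      using L(2)[OF e] real_nat_ceiling_ge[of \<mu>] by (simp add: mult.commute mult_right_mono)
    then have "exp (L \<epsilon> * \<mu>) \<le> exp (real (nat \<lceil>\<mu>\<rceil>) * L \<epsilon>)" by simp
    also have "\<dots> = exp (L \<epsilon>) ^ nat \<lceil>\<mu>\<rceil>" by (rule exp_of_nat_mult)
    also have "exp (L \<epsilon>) = 1 / min \<epsilon> \<eta>" using e \<eta> by (simp add: L_def)
    finally show ?thesis by (simp add: E_def)
  qed

  define Q where "Q \<epsilon> = (mG g0 \<epsilon> + (mG g1 \<epsilon> + T * mF \<epsilon>) / L \<epsilon>) * E \<epsilon>" for \<epsilon>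
  have mG0: "0 \<le> mG g0 \<epsilon>" "0 \<le> mG g1 \<epsilon>" "0 \<le> mF \<epsilon>" if "\<epsilon> \<in> {0<..1}" for \<epsilon>
    using etype_nonneg[OF G_et[OF assms(10) that]] etype_nonneg[OF G_et[OF assms(11) that]]
      etype_nonneg[OF F_et[OF that, of 0]] by auto
  define sol where "sol \<epsilon> U V \<longleftrightarrow> U 0 = G g0 \<epsilon> \<and> V 0 = G g1 \<epsilon> \<and>
      (\<forall>t\<in>{0..T}. \<forall>l x. ((\<lambda>t. U t l x) has_vector_derivative V t l x) (at t within {0..T})) \<and>
      (\<forall>t\<in>{0..T}. \<forall>l x. ((\<lambda>t. V t l x) has_vector_derivative
         F \<epsilon> 0 t l x + ((\<Sum>i\<in>UNIV. reg (a i) \<epsilon> t * U t (l @ [i, i]) x) - (\<Sum>i\<in>UNIV. reg (c i) \<epsilon> t * U t (l @ [i]) x)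
           - reg d \<epsilon> t * V t l x - reg e \<epsilon> t * U t l x)) (at t within {0..T})) \<and>
      (\<forall>t\<in>{0..T}. etype (Q \<epsilon>) (X \<epsilon>) (U t) \<and> etype (L \<epsilon> * Q \<epsilon>) (X \<epsilon>) (V t))" for \<epsilon> U V
  have sol: "\<exists>U V. sol \<epsilon> U V"
    if e: "\<epsilon> \<in> {0<..1}" for \<epsilon>
  proof -
    have m: "min \<epsilon> \<eta> \<in> {0<..\<eta>}" using e \<eta> by auto
    define \<alpha> where "\<alpha> i t = Re (reg (a i) \<epsilon> t)" for i t
    have \<alpha>: "\<alpha> i t \<ge> 0" "norm (reg (a i) \<epsilon> t) = \<alpha> i t" for i t
    proof -
      have "reg (a i) \<epsilon> t \<in> \<real>\<^sub>\<ge>\<^sub>0" using M(2)[OF e] by blast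
      then show "\<alpha> i t \<ge> 0" "norm (reg (a i) \<epsilon> t) = \<alpha> i t"
        by (auto simp: \<alpha>_def nonneg_Reals_def)
    qed
    have "\<forall>i. \<exists>A. \<forall>t\<in>{0..T}. (A has_real_derivative \<alpha> i t) (at t) \<and> 0 \<le> A t \<and> A t \<le> M i"
      unfolding \<alpha>_def using M(2)[OF e] by blast
    then obtain A where A: "\<forall>i. \<forall>t\<in>{0..T}. (A i has_real_derivative \<alpha> i t) (at t) \<and> 0 \<le> A i t \<and> A i t \<le> M i"
      by (auto dest!: choice)
    have cont: "continuous_on {0..T} (reg w \<epsilon>)" if "adm w" for w
      using dseq_continuous[OF fam(1)[OF that e], of "{0..T}" 0] fam(2)[OF that e] by simp
    define k where "k t = L \<epsilon> * (\<kappa>0 + \<kappa>1 * (\<Sum>i\<in>UNIV. \<alpha> i t))" for t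
    define K where "K t = L \<epsilon> * (\<kappa>0 * t + \<kappa>1 * (\<Sum>i\<in>UNIV. A i t))" for t
    have sa: "(\<Sum>i\<in>UNIV. \<alpha> i t) \<ge> 0" for t using \<alpha>(1) by (intro sum_nonneg) auto
    have kc: "continuous_on {0..T} k" unfolding k_def[abs_def] \<alpha>_def
      by (intro continuous_intros cont adm)
    \<comment> \<open>The supremum of the rate may depend on \<epsilon> in any way. It serves
      convergence only; the size of the solution is controlled by \<open>K\<close>, which is built
      from the primitives of the coefficients.\<close>
    have "bounded (k ` {0..T})" by (intro compact_imp_bounded compact_continuous_image kc) auto
    then obtain kmax where kmax: "\<forall>z\<in>k ` {0..T}. norm z \<le> kmax" unfolding bounded_iff by (elim exE) (rule that)
    have K: "(K has_real_derivative k t) (at t)" "0 \<le> K t" "K t \<le> L \<epsilon> * \<mu>" if t: "t \<in> {0..T}" for t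
    proof -
      have "((\<lambda>t. \<Sum>i\<in>UNIV. A i t) has_real_derivative (\<Sum>i\<in>UNIV. \<alpha> i t)) (at t)"
        using A t by (intro DERIV_sum) blast
      then have "((\<lambda>t. L \<epsilon> * (\<kappa>0 * t + \<kappa>1 * (\<Sum>i\<in>UNIV. A i t))) has_real_derivative
          L \<epsilon> * (\<kappa>0 * 1 + \<kappa>1 * (\<Sum>i\<in>UNIV. \<alpha> i t))) (at t)"
        by (intro DERIV_cmult DERIV_add DERIV_ident)
      then show "(K has_real_derivative k t) (at t)" by (simp add: K_def[abs_def] k_def)
      have "0 \<le> (\<Sum>i\<in>UNIV. A i t)" using A t by (intro sum_nonneg) blast
      then show "0 \<le> K t" unfolding K_def using L(2)[OF e] \<kappa>0 \<kappa>1 t by (intro mult_nonneg_nonneg add_nonneg_nonneg) auto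
      have "(\<Sum>i\<in>UNIV. A i t) \<le> (\<Sum>i\<in>UNIV. M i)" using A t by (intro sum_mono) blast
      then show "K t \<le> L \<epsilon> * \<mu>" unfolding K_def \<mu>_def
        using L(2)[OF e] \<kappa>0 \<kappa>1 t by (intro mult_left_mono add_mono) auto
    qed
    have rate: "((\<Sum>i\<in>UNIV. norm (reg (a i) \<epsilon> t)) * X \<epsilon> ^ 2 + (\<Sum>i\<in>UNIV. norm (reg (c i) \<epsilon> t)) * X \<epsilon>
        + norm (reg e \<epsilon> t)) / L \<epsilon> + norm (reg d \<epsilon> t) \<le> k t" if t: "t \<in> {0..T}" for t
    proof -
      have levi: "(cmod (\<i> * (\<Sum>i\<in>UNIV. reg (c i) \<epsilon> t * of_real (\<xi> $ i)) + reg e \<epsilon> t))\<^sup>2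
          \<le> C1 * (L \<epsilon>)\<^sup>2 * (2 * (\<Sum>i\<in>UNIV. \<alpha> i t * (\<xi> $ i)\<^sup>2))" if "norm \<xi> \<ge> R" for \<xi> :: "real ^ 'n"
        using assms(19)[OF t m that] by (simp only: reg_def L_def \<alpha>_def)
      have cb: "norm (reg (c i) \<epsilon> t) \<le> L \<epsilon> * (1 + C1 * \<alpha> i t)" for i
        by (rule levi_coefficient_bounds(1)[OF levi assms(18,16) L(2)[OF e] \<alpha>(1)])
      have eb: "norm (reg e \<epsilon> t) \<le> L \<epsilon> * R * (1 + C1 * \<alpha> i t)" for i
        by (rule levi_coefficient_bounds(2)[OF levi assms(18,16) L(2)[OF e] \<alpha>(1)])
      have db: "(norm (reg d \<epsilon> t))\<^sup>2 \<le> C2 * (L \<epsilon>)\<^sup>2"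
        using assms(20)[OF t m] by (simp only: reg_def L_def)
      show ?thesis unfolding k_def \<kappa>0_def \<kappa>1_def X_eq(1)[OF e] \<alpha>(2)
        by (rule growth_rate_bound[OF \<alpha>(1) cb eb db assms(16,17,18) B0 L0 L(1)[OF e]])
    qed
    have k1: "L \<epsilon> \<le> k t" for t
    proof -
      have "1 \<le> \<kappa>0 + \<kappa>1 * (\<Sum>i\<in>UNIV. \<alpha> i t)" using \<kappa>0 \<kappa>1 sa[of t] by (simp add: add_increasing2)
      from mult_left_mono[OF this, of "L \<epsilon>"] show ?thesis using L(2)[OF e] by (simp add: k_def)
    qed
    have k2: "k t \<le> kmax" if "t \<in> {0..T}" for t
      using kmax[THEN bspec, OF imageI[OF that]] by simp
    have Fcont: "continuous_on {0..T} (\<lambda>t. F \<epsilon> 0 t l x)" for l x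
      by (rule continuous_on_vector_derivative) (rule has_vector_derivative_at_within[OF F(1)[OF e]])
    obtain U V where UV: "U 0 = G g0 \<epsilon>" "V 0 = G g1 \<epsilon>"
      "\<And>t l x. t \<in> {0..T} \<Longrightarrow> ((\<lambda>t. U t l x) has_vector_derivative V t l x) (at t within {0..T})"
      "\<And>t l x. t \<in> {0..T} \<Longrightarrow> ((\<lambda>t. V t l x) has_vector_derivative
         F \<epsilon> 0 t l x + ((\<Sum>i\<in>UNIV. reg (a i) \<epsilon> t * U t (l @ [i, i]) x) - (\<Sum>i\<in>UNIV. reg (c i) \<epsilon> t * U t (l @ [i]) x)
           - reg d \<epsilon> t * V t l x - reg e \<epsilon> t * U t l x)) (at t within {0..T})"
      "\<And>t. t \<in> {0..T} \<Longrightarrow> etype ((mG g0 \<epsilon> + (mG g1 \<epsilon> + T * mF \<epsilon>) / L \<epsilon>) * exp (K t)) (X \<epsilon>) (U t)"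
      "\<And>t. t \<in> {0..T} \<Longrightarrow> etype (L \<epsilon> * ((mG g0 \<epsilon> + (mG g1 \<epsilon> + T * mF \<epsilon>) / L \<epsilon>) * exp (K t))) (X \<epsilon>) (V t)"
      by (rule regularised_cauchy_solution[OF T L(2)[OF e] X cont[OF adm(1)] cont[OF adm(2)] cont[OF adm(3)] cont[OF adm(4)]
          k1 k2 rate K(1) K(2) G_et[OF assms(10) e] G_et[OF assms(11) e] F_et[OF e] Fcont]) (assumption+, rule that)
    have Qle: "(mG g0 \<epsilon> + (mG g1 \<epsilon> + T * mF \<epsilon>) / L \<epsilon>) * exp (K t) \<le> Q \<epsilon>" if t: "t \<in> {0..T}" for t
    proof -
      have "exp (K t) \<le> E \<epsilon>" using K(3)[OF t] E_exp[OF e] by (meson exp_le_cancel_iff order_trans)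
      then show ?thesis unfolding Q_def
        using mG0[OF e] L(2)[OF e] T by (intro mult_left_mono add_nonneg_nonneg divide_nonneg_nonneg mult_nonneg_nonneg) auto
    qed
    have "etype (Q \<epsilon>) (X \<epsilon>) (U t)" if t: "t \<in> {0..T}" for t
      by (rule etype_mono[OF UV(5)[OF t] Qle[OF t] X])
    moreover have "etype (L \<epsilon> * Q \<epsilon>) (X \<epsilon>) (V t)" if t: "t \<in> {0..T}" for t
      by (rule etype_mono[OF UV(6)[OF t] mult_left_mono[OF Qle[OF t] less_imp_le[OF L(2)[OF e]]] X])
    ultimately show ?thesis using UV(1-4) unfolding sol_def by (intro exI[of _ U] exI[of _ V]) auto
  qed

  \<comment> \<open>The net of solutions, its time derivatives and the Cauchy problem\<close>
  define U where "U \<epsilon> = (SOME U. \<exists>V. sol \<epsilon> U V)" for \<epsilon>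
  define V where "V \<epsilon> = (SOME V. sol \<epsilon> (U \<epsilon>) V)" for \<epsilon>
  have UV: "sol \<epsilon> (U \<epsilon>) (V \<epsilon>)" if "\<epsilon> \<in> {0<..1}" for \<epsilon>
  proof -
    have "\<exists>V. sol \<epsilon> (U \<epsilon>) V" unfolding U_def by (rule someI_ex[OF sol[OF that]])
    then show ?thesis unfolding V_def by (rule someI_ex)
  qed
  note UV' = UV[unfolded sol_def]
  have U0: "U \<epsilon> 0 = G g0 \<epsilon>" and V0: "V \<epsilon> 0 = G g1 \<epsilon>" if "\<epsilon> \<in> {0<..1}" for \<epsilon>
    using UV'[OF that] by blast+
  have Ud: "((\<lambda>t. U \<epsilon> t l x) has_vector_derivative V \<epsilon> t l x) (at t within {0..T})"
    if "\<epsilon> \<in> {0<..1}" "t \<in> {0..T}" for \<epsilon> t l x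
    using UV'[OF that(1)] that(2) by blast
  have Vd: "((\<lambda>t. V \<epsilon> t l x) has_vector_derivative
         F \<epsilon> 0 t l x + ((\<Sum>i\<in>UNIV. reg (a i) \<epsilon> t * U \<epsilon> t (l @ [i, i]) x) - (\<Sum>i\<in>UNIV. reg (c i) \<epsilon> t * U \<epsilon> t (l @ [i]) x)
           - reg d \<epsilon> t * V \<epsilon> t l x - reg e \<epsilon> t * U \<epsilon> t l x)) (at t within {0..T})"
    if "\<epsilon> \<in> {0<..1}" "t \<in> {0..T}" for \<epsilon> t l x
    using UV'[OF that(1)] that(2) by blast
  have Ue: "etype (Q \<epsilon>) (X \<epsilon>) (U \<epsilon> t)" and Ve: "etype (L \<epsilon> * Q \<epsilon>) (X \<epsilon>) (V \<epsilon> t)"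
    if "\<epsilon> \<in> {0<..1}" "t \<in> {0..T}" for \<epsilon> t
    using UV'[OF that(1)] that(2) by blast+
  have Q_mod: "moderate Q"
  proof -
    have "moderate (\<lambda>\<epsilon>. 1 / L \<epsilon>)"
    proof (rule moderate_mono[OF moderate_const[of "1 / L0"]])
      fix \<epsilon> :: real assume "\<epsilon> \<in> {0<..1}"
      then show "\<bar>1 / L \<epsilon>\<bar> \<le> 1 / L0" using L[of \<epsilon>] L0 by (simp add: frac_le)
    qed
    then have "moderate (\<lambda>\<epsilon>. (mG g0 \<epsilon> + (mG g1 \<epsilon> + T * mF \<epsilon>) * (1 / L \<epsilon>)) * E \<epsilon>)"
      by (intro moderate_mult moderate_add moderate_const mG mF(1) E_mod)
    then show ?thesis by (simp add: Q_def[abs_def])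
  qed
  \<comment> \<open>Both nets are treated at once: the derivative of \<open>U\<close> is
    \<open>V\<close>, and that of \<open>V\<close> is given by the equation through
    \<open>U\<close>, \<open>V\<close> and the source, so each round gains one time derivative for
    both. The space derivatives that occur are handled by \<open>mnet_append\<close>.\<close>
  have net: "mnet T X k U \<and> mnet T X k V" for k
  proof (induction k)
    case 0
    show ?case
      by (rule conjI; rule mnet_0I[OF Q_mod] mnet_0I[OF moderate_mult[OF L_mod Q_mod]])
         (rule etype_bound[OF Ue] etype_bound[OF Ve], assumption, assumption)+
  next
    case (Suc k)
    have IH: "mnet T X k U" "mnet T X k V" using Suc by blast+
    have "mnet T X k (\<lambda>\<epsilon> t l x. F \<epsilon> 0 t l x + ((\<Sum>i\<in>UNIV. fam (a i) \<epsilon> 0 t * U \<epsilon> t (l @ [i, i]) x)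
          - (\<Sum>i\<in>UNIV. fam (c i) \<epsilon> 0 t * U \<epsilon> t (l @ [i]) x)
          - fam d \<epsilon> 0 t * V \<epsilon> t l x - fam e \<epsilon> 0 t * U \<epsilon> t l x))"
      by (intro mnet_add[OF F_net] mnet_diff mnet_sum finite_class.finite_UNIV mnet_mult snet adm X IH
          mnet_append[OF IH(1) X_mod])
    then have "mnet T X (Suc k) V"
      by (rule mnet_SucI[OF mnet_zero[OF IH(2)]]) (use Vd fam(2) adm in auto)
    moreover have "mnet T X (Suc k) U"
      by (rule mnet_SucI[OF mnet_zero[OF IH(1)] IH(2) Ud])
    ultimately show ?case by blast
  qed
  define u where "u \<epsilon> t = U \<epsilon> t []" for \<epsilon> t
  have u_gm: "smooth_gevrey_moderate T s u"
    unfolding u_def[abs_def]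
    by (rule mnet_smooth_gevrey_moderate[OF T s net[THEN conjunct1] etype_dfam[OF Ue] X X_le q])
  have solves: "solves_cauchy T (\<lambda>i. reg (a i) \<epsilon>) (\<lambda>i. reg (c i) \<epsilon>) (reg d \<epsilon>) (reg e \<epsilon>)
      (\<lambda>t. F \<epsilon> 0 t []) (G g0 \<epsilon> []) (G g1 \<epsilon> []) (u \<epsilon>)" if e: "\<epsilon> \<in> {0<..1}" for \<epsilon>
    unfolding solves_cauchy_def
  proof (intro conjI ballI allI)
    have ut: "dt T (u \<epsilon>) t x = V \<epsilon> t [] x" if "t \<in> {0..T}" for t x
      by (rule dt_eq[OF T that]) (use Ud[OF e that] in \<open>simp only: u_def\<close>)
    fix x
    show "u \<epsilon> 0 x = G g0 \<epsilon> [] x" by (simp add: u_def U0[OF e])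
    show "dt T (u \<epsilon>) 0 x = G g1 \<epsilon> [] x" using ut[of 0 x] T by (simp add: V0[OF e])
    fix t assume t: "t \<in> {0..T}"
    have utt: "dt T (dt T (u \<epsilon>)) t x = F \<epsilon> 0 t [] x + ((\<Sum>i\<in>UNIV. reg (a i) \<epsilon> t * U \<epsilon> t [i, i] x)
        - (\<Sum>i\<in>UNIV. reg (c i) \<epsilon> t * U \<epsilon> t [i] x) - reg d \<epsilon> t * V \<epsilon> t [] x - reg e \<epsilon> t * U \<epsilon> t [] x)"
    proof -
      have "dt T (dt T (u \<epsilon>)) t x = dt T (\<lambda>t. V \<epsilon> t []) t x" by (rule dt_cong[where h = "dt T (u \<epsilon>)" and h' = "\<lambda>t. V \<epsilon> t []", OF ut t])
      also have "\<dots> = F \<epsilon> 0 t [] x + ((\<Sum>i\<in>UNIV. reg (a i) \<epsilon> t * U \<epsilon> t [i, i] x)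
        - (\<Sum>i\<in>UNIV. reg (c i) \<epsilon> t * U \<epsilon> t [i] x) - reg d \<epsilon> t * V \<epsilon> t [] x - reg e \<epsilon> t * U \<epsilon> t [] x)"
        by (rule dt_eq[OF T t]) (use Vd[OF e t, of "[]" x] in \<open>simp only: append_Nil\<close>)
      finally show ?thesis .
    qed
    have dU: "dfam (U \<epsilon> t)" by (rule etype_dfam[OF Ue[OF e t]])
    have p1: "pd (axis i 1) (u \<epsilon> t) = U \<epsilon> t [i]" for i
      unfolding u_def by (rule ext) (rule pd_axis_dfam[OF dU])
    have p2: "pd (axis i 1) (U \<epsilon> t [i]) x = U \<epsilon> t [i, i] x" for i
      by (rule pd_axis_dfam[OF dU])
    show "dt T (dt T (u \<epsilon>)) t x - (\<Sum>i\<in>UNIV. reg (a i) \<epsilon> t * pd (axis i 1) (pd (axis i 1) (u \<epsilon> t)) x)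
       + (\<Sum>i\<in>UNIV. reg (c i) \<epsilon> t * pd (axis i 1) (u \<epsilon> t) x)
       + reg d \<epsilon> t * dt T (u \<epsilon>) t x + reg e \<epsilon> t * u \<epsilon> t x = F \<epsilon> 0 t [] x"
      unfolding utt ut[OF t] p1 p2 by (simp add: u_def)
  qed
  \<comment> \<open>Stated for any class of mollifiers that contains those of type (2), since the
    conclusion asks both for the general class and for type (2).\<close>
  have weak: "very_weak_for P T s (\<lambda>i. reg (a i)) (\<lambda>i. reg (c i)) (reg d) (reg e) f g0 g1 u"
    if P: "\<And>\<theta> :: real ^ 'n \<Rightarrow> complex. mollifier2 \<theta> \<Longrightarrow> P \<theta>" for P
    unfolding very_weak_for_def
  proof (intro conjI allI)
    show "smooth_moderate (reg (a i))" "smooth_moderate (reg (c i))" for i by (rule smod[OF adm(1)], rule smod[OF adm(2)])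
    show "smooth_moderate (reg d)" "smooth_moderate (reg e)" by (rule smod[OF adm(3)], rule smod[OF adm(4)])
    have init: "reg_init P g (\<lambda>\<epsilon>. G g \<epsilon> [])" for g
      using G_reg[of g] P unfolding reg_init_def by blast
    have rhs: "reg_rhs P T f (\<lambda>\<epsilon> t. F \<epsilon> 0 t [])"
      using F_reg P unfolding reg_rhs_def by blast
    show "\<exists>f\<epsilon> g0\<epsilon> g1\<epsilon>. reg_rhs P T f f\<epsilon> \<and> smooth_gevrey_moderate T s f\<epsilon> \<and>
      reg_init P g0 g0\<epsilon> \<and> gevrey_moderate s g0\<epsilon> \<and> reg_init P g1 g1\<epsilon> \<and> gevrey_moderate s g1\<epsilon> \<and>
      (\<forall>\<epsilon>\<in>{0<..1}. solves_cauchy T (\<lambda>i. reg (a i) \<epsilon>) (\<lambda>i. reg (c i) \<epsilon>) (reg d \<epsilon>) (reg e \<epsilon>)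
         (f\<epsilon> \<epsilon>) (g0\<epsilon> \<epsilon>) (g1\<epsilon> \<epsilon>) (u \<epsilon>))"
      by (intro exI[of _ "\<lambda>\<epsilon> t. F \<epsilon> 0 t []"] exI[of _ "\<lambda>\<epsilon>. G g0 \<epsilon> []"] exI[of _ "\<lambda>\<epsilon>. G g1 \<epsilon> []"] conjI ballI
          rhs F_gm init G_gm assms(10,11) solves)
    show "smooth_gevrey_moderate T s u" by (rule u_gm)
  qed
  have "very_weak_solution T s a c d e f g0 g1 u"
    unfolding very_weak_solution_def
    by (intro exI[of _ "\<lambda>i. reg (a i)"] exI[of _ "\<lambda>i. reg (c i)"] exI[of _ "reg d"] exI[of _ "reg e"]
        conjI allI reg_c weak) (simp add: mollifier_def)
  moreover have "very_weak_for mollifier2 T s (\<lambda>i. reg (a i)) (\<lambda>i. reg (c i)) (reg d) (reg e) f g0 g1 u"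
    by (rule weak)
  ultimately show ?thesis unfolding reg_def[abs_def] by blast
qed

end
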